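(* Let $\alpha_0,\alpha_1\ge 0$ with $\alpha_0\neq\alpha_1$ and $\alpha_0+\alpha_1\ge 1$, and let $0\le T<1$. Then the likelihood ratio $\phi_{\alpha_0,\alpha_1}(T)=d\mathbb P^{(\alpha_1)}_T/d\mathbb P^{(\alpha_0)}_T$ is given by $$\phi_{\alpha_0,\alpha_1}(T)=\exp\left(\frac{(\alpha_0-\alpha_1)\left(\psi_{\alpha_0,\alpha_1}(T)+\ln(1-T)\right)}{2}\right),$$ where $$\psi_{\alpha_0,\alpha_1}(T)=\frac{X_T^2}{1-T}+(\alpha_0+\alpha_1-1)\int_0^T\frac{X_s^2}{(1-s)^2}\,ds .$$
   Context: For $\alpha\ge 0$, the $\alpha$-Brownian bridge is the process $X^{(\alpha)}_t=\int_0^t\left(\frac{1-t}{1-s}\right)^{\alpha}dW_s$, $0\le t<1$, where $W$ is standard Brownian motion on $[0,1]$. It is the unique strong solution of $dX^{(\alpha)}_t=dW_t-\frac{\alpha X^{(\alpha)}_t}{1-t}\,dt$, $X^{(\alpha)}_0=0$, $0\le t<1$. It extends continuously to $[0,1]$ (for $\alpha>0$ by $X^{(\alpha)}_1=0$; for $\alpha=0$, $X^{(0)}=W$). Let $C([0,1])$ be the space of continuous functions on $[0,1]$ with the supremum norm and its Borel $\sigma$-algebra, let $X=(X_t)_{t\in[0,1]}$ be the coordinate process on $C([0,1])$ and $\mathcal F_t=\sigma(X_s:s\le t)$. $\mathbb P^{(\alpha)}$ denotes the law of $X^{(\alpha)}$ on $C([0,1])$ (so $\mathbb P^{(0)}$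 is Wiener measure, and under $\mathbb P^{(\alpha)}$ the coordinate process $X$ is an $\alpha$-Brownian bridge), and $\mathbb P^{(\alpha)}_t$ denotes the restriction of $\mathbb P^{(\alpha)}$ to $\mathcal F_t$. The Radon-Nikodym derivative is understood up to almost sure equality. *)

theory Defs
  imports "HOL-Probability.Probability"
begin

section \<open>The path space\<close>

typedef unit_interval = "{0..1::real}"
  by (rule exI[of _ 0]) simp

instantiation unit_interval :: metric_space
begin

definition dist_unit_interval :: "unit_interval \<Rightarrow> unit_interval \<Rightarrow> real"
  where "dist x y = dist (Rep_unit_interval x) (Rep_unit_interval y)"

definition uniformity_unit_interval :: "(unit_interval \<times> unit_interval) filter"
  where "uniformity_unit_interval = (INF e\<in>{0 <..}. principal {(x, y). dist x y < e})"

definition open_unit_interval :: "unit_interval set \<Rightarrow> bool"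
  where "open_unit_interval S = (\<forall>x\<in>S. \<forall>\<^sub>F (x', y) in uniformity. x' = x \<longrightarrow> y \<in> S)"

instance
proof
  fix x y z :: unit_interval
  show "dist x y = 0 \<longleftrightarrow> x = y"
    by (simp add: dist_unit_interval_def Rep_unit_interval_inject)
  show "dist x y \<le> dist x z + dist y z"
    unfolding dist_unit_interval_def by (rule dist_triangle2)
qed (simp_all add: uniformity_unit_interval_def open_unit_interval_def)

end

text \<open>
  Continuous functions on the compact interval are bounded, so this is all of $C([0,1])$.
  Its metric is the supremum metric, and \<open>borel\<close> at this type is the Borel
  $\sigma$-algebra of the supremum norm.
\<close>

type_synonym path = "unit_interval \<Rightarrow>\<^sub>C real"

text \<open>The value at time \<open>t\<close> is meaningful only for $0 \le t \le 1$.\<close>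

definition coord :: "real \<Rightarrow> path \<Rightarrow> real"
  where "coord t x = apply_bcontfun x (Abs_unit_interval t)"

definition path_filtration :: "real \<Rightarrow> path measure"
  where "path_filtration t =
    sigma UNIV {coord s -` A | s A. s \<in> {0..t} \<and> A \<in> sets borel}"

lemma borel_measurable_coord [measurable]: "coord t \<in> borel_measurable borel"
proof (rule borel_measurable_continuous_onI)
  have "1-lipschitz_on UNIV (coord t)"
    by (rule lipschitz_onI) (simp_all add: coord_def dist_bounded)
  then show "continuous_on UNIV (coord t)"
    by (rule lipschitz_on_continuous_on)
qed

lemma subalgebra_path_filtration: "subalgebra borel (path_filtration t)"
proof -
  have "sigma_sets UNIV {coord s -` A | s A. s \<in> {0..t} \<and> A \<in> sets borel}
    \<subseteq> sets (borel :: path measure)"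
    by (rule sets.sigma_sets_subset[of _ "borel :: path measure", simplified])
      (use measurable_sets[OF borel_measurable_coord] in auto)
  then show ?thesis
    by (simp add: subalgebra_def path_filtration_def)
qed

section \<open>Brownian motion, Wiener integrals and the bridge\<close>

definition brownian_motion :: "'a measure \<Rightarrow> (real \<Rightarrow> 'a \<Rightarrow> real) \<Rightarrow> bool"
  where "brownian_motion M W \<longleftrightarrow>
    prob_space M \<and>
    (\<forall>t\<in>{0..1}. W t \<in> borel_measurable M) \<and>
    (AE \<omega> in M. W 0 \<omega> = 0) \<and>
    (\<forall>s t. 0 \<le> s \<and> s < t \<and> t \<le> 1 \<longrightarrow>
      distributed M lborel (\<lambda>\<omega>. W t \<omega> - W s \<omega>) (normal_density 0 (sqrt (t - s)))) \<and>
    (\<forall>(n::nat) \<tau>. mono_on {..n} \<tau> \<and> \<tau> ` {..n} \<subseteq> {0..1} \<longrightarrow>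
      prob_space.indep_vars M (\<lambda>_. borel) (\<lambda>i \<omega>. W (\<tau> (Suc i)) \<omega> - W (\<tau> i) \<omega>) {..<n}) \<and>
    (AE \<omega> in M. continuous_on {0..1} (\<lambda>t. W t \<omega>))"

definition step_function :: "nat \<Rightarrow> (nat \<Rightarrow> real) \<Rightarrow> (nat \<Rightarrow> real) \<Rightarrow> real \<Rightarrow> real"
  where "step_function n \<tau> c s = (\<Sum>i<n. c i * indicator {\<tau> i <.. \<tau> (Suc i)} s)"

definition step_integral ::
    "nat \<Rightarrow> (nat \<Rightarrow> real) \<Rightarrow> (nat \<Rightarrow> real) \<Rightarrow> (real \<Rightarrow> 'a \<Rightarrow> real) \<Rightarrow> 'a \<Rightarrow> real"
  where "step_integral n \<tau> c W \<omega> = (\<Sum>i<n. c i * (W (\<tau> (Suc i)) \<omega> - W (\<tau> i) \<omega>))"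

text \<open>
  \<open>I\<close> is a version of $\int_0^t f(s)\,dW_s$ for deterministic square integrable \<open>f\<close>, i.e.
  the $L^2$-limit of the integrals of step functions converging to \<open>f\<close> in $L^2([0,t])$.
  By the Ito isometry the limit exists and does not depend on the approximating sequence.
\<close>

definition is_wiener_integral ::
    "'a measure \<Rightarrow> (real \<Rightarrow> 'a \<Rightarrow> real) \<Rightarrow> real \<Rightarrow> (real \<Rightarrow> real) \<Rightarrow> ('a \<Rightarrow> real) \<Rightarrow> bool"
  where "is_wiener_integral M W t f I \<longleftrightarrow>
    set_borel_measurable lborel {0..t} f \<and>
    I \<in> borel_measurable M \<and>
    (\<exists>(n :: nat \<Rightarrow> nat) \<tau> c.
      (\<forall>k. mono_on {..n k} (\<tau> k) \<and> \<tau> k ` {..n k} \<subseteq> {0..t}) \<and>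
      (\<lambda>k. \<integral>\<^sup>+s\<in>{0..t}. ennreal ((f s - step_function (n k) (\<tau> k) (c k) s)\<^sup>2) \<partial>lborel)
        \<longlonglongrightarrow> 0 \<and>
      (\<lambda>k. \<integral>\<^sup>+\<omega>. ennreal ((I \<omega> - step_integral (n k) (\<tau> k) (c k) W \<omega>)\<^sup>2) \<partial>M)
        \<longlonglongrightarrow> 0)"

text \<open>
  \<open>Y\<close> is the $\alpha$-Brownian bridge driven by \<open>W\<close>, as a random element of $C([0,1])$.
  The value at time 1 is not prescribed: path continuity forces it to be the limit from the left.
\<close>

definition alpha_brownian_bridge ::
    "real \<Rightarrow> 'a measure \<Rightarrow> (real \<Rightarrow> 'a \<Rightarrow> real) \<Rightarrow> ('a \<Rightarrow> path) \<Rightarrow> bool"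
  where "alpha_brownian_bridge \<alpha> M W Y \<longleftrightarrow>
    brownian_motion M W \<and>
    Y \<in> borel_measurable M \<and>
    (\<forall>t. 0 \<le> t \<and> t < 1 \<longrightarrow>
      is_wiener_integral M W t (\<lambda>s. ((1 - t) / (1 - s)) powr \<alpha>) (\<lambda>\<omega>. coord t (Y \<omega>)))"

definition psi :: "real \<Rightarrow> real \<Rightarrow> real \<Rightarrow> path \<Rightarrow> real"
  where "psi \<alpha>\<^sub>0 \<alpha>\<^sub>1 T x =
    (coord T x)\<^sup>2 / (1 - T) +
    (\<alpha>\<^sub>0 + \<alpha>\<^sub>1 - 1) * (LBINT s:{0..T}. (coord s x)\<^sup>2 / (1 - s)\<^sup>2)"

end

theory Submission
  imports Defs "HOL-Real_Asymp.Real_Asymp"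
begin

text \<open>
  In the time scale $u = - \ln (1 - t)$ the process $Y_u = X_t / \sqrt{1 - t}$ is an Ornstein-Uhlenbeck
  process with rate $\kappa = \alpha - 1/2$. On a uniform grid with step $h$ it is a Gaussian Markov
  chain with contraction $\rho = e^{- \kappa h}$ and variance $v = (1 - e^{- 2 \kappa h}) / (2 \kappa)$, and
  the logarithm of its transition density relative to Brownian motion is
  \[ - \frac{1}{2} \ln \frac{v}{h} - \frac{1 - \rho}{2 v} (y'^2 - y^2) - \frac{(1 - \rho)^2}{2 v} y^2
     - \frac{1}{2} \Bigl(\frac{\rho}{v} - \frac{1}{h}\Bigr) (y' - y)^2 . \]
  Since $\rho / v - 1 / h = O(h)$, the quadratic variation drops out as the grid is refined, and the
  likelihood ratio on the grid converges for every single continuous path, without any stochastic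
  calculus. Bounded truncation carries the identity $dP_1 = Z_m \, dP_0$ to the limit.
\<close>

section \<open>Gaussian transition densities\<close>

text \<open>The Brownian reference density is what makes pathwise limits possible. The plain
  exponent of a transition contains (y' - y)^2 / (2 h), whose sum over a grid need not converge
  along a continuous path. Relative to Brownian motion the coefficient of (y' - y)^2 is O(h), and h
  times the sum of squared increments is at most the horizon times the squared modulus of continuity
  at scale h. The reference cancels when two values of \<kappa> are compared. In the limit \<kappa>
  enters linearly in the boundary and logarithmic terms and quadratically in the integral. The
  factor in \<open>psi\<close> comes from \<open>\<kappa>\<^sub>1^2 - \<kappa>\<^sub>0^2 =
  (\<alpha>\<^sub>1 - \<alpha>\<^sub>0) * (\<alpha>\<^sub>0 + \<alpha>\<^sub>1 - 1)\<close>. The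
  second obstacle is that the bridge is given only through L^2 limits of step integrals. Its
  Gaussian transitions, and their independence of the past, are carried through these limits by
  characteristic functions. The grids are dyadic so that an event seen by one grid is seen by all
  finer ones.\<close>

definition ou_var :: "real \<Rightarrow> real \<Rightarrow> real"
  where "ou_var \<kappa> h = (if \<kappa> = 0 then h else (1 - exp (- (2 * \<kappa> * h))) / (2 * \<kappa>))"

lemma ou_var_pos: "h > 0 \<Longrightarrow> ou_var \<kappa> h > 0"
  by (auto simp: ou_var_def zero_less_divide_iff mult_less_0_iff zero_less_mult_iff)

text \<open>\<open>ou_var \<kappa> h\<close> is the integral of exp(- 2 \<kappa> s) over 0 \<le> s
  \<le> h, that is h - \<kappa> h^2 + O(h^3). The value \<kappa> = 0, that is \<alpha> = 1/2, has
  its own branch because the closed form is then 0 / 0.\<close>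

lemma tendsto_ln_ou_var:
  "((\<lambda>h. ln (ou_var \<kappa> h / h) / h) \<longlongrightarrow> - \<kappa>) (at_right 0)"
proof (cases "\<kappa> = 0")
  case True
  have "eventually (\<lambda>h. ln (ou_var \<kappa> h / h) / h = 0) (at_right 0)"
    using eventually_at_right_less[of 0] by eventually_elim (simp add: True ou_var_def)
  then show ?thesis
    by (simp add: True tendsto_eventually)
next
  case False
  \<comment> \<open>Both signs occur, since \<alpha> < 1/2 gives \<kappa> < 0; the sign is fixed
    before the expansion is computed.\<close>
  then consider "\<kappa> > 0" | "\<kappa> < 0" by linarith
  then have "((\<lambda>h. ln (((1 - exp (- (2 * \<kappa> * h))) / (2 * \<kappa>)) / h) / h) \<longlongrightarrow> -\<kappa>) (at_right 0)"
    by cases real_asymp+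
  then show ?thesis by (simp add: ou_var_def False)
qed

text \<open>For \<kappa> \<noteq> 0 the quotient is 2 \<kappa> / (1 + exp(- \<kappa> h)), because
  the variance factors as a difference of squares.\<close>

lemma tendsto_drift_ou_var:
  "((\<lambda>h. (1 - exp (- (\<kappa> * h))) / ou_var \<kappa> h) \<longlongrightarrow> \<kappa>) (at_right 0)"
proof (cases "\<kappa> = 0")
  case False
  then consider "\<kappa> > 0" | "\<kappa> < 0" by linarith
  then have "((\<lambda>h. (1 - exp (- (\<kappa> * h))) / ((1 - exp (- (2 * \<kappa> * h))) / (2 * \<kappa>))) \<longlongrightarrow> \<kappa>) (at_right 0)"
    by cases real_asymp+
  then show ?thesis by (simp add: ou_var_def False)
qed simp

lemma tendsto_drift_square_ou_var:
  "((\<lambda>h. (1 - exp (- (\<kappa> * h)))\<^sup>2 / (ou_var \<kappa> h * h)) \<longlongrightarrow> \<kappa>\<^sup>2) (at_right 0)"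
proof (cases "\<kappa> = 0")
  case False
  then consider "\<kappa> > 0" | "\<kappa> < 0" by linarith
  then have "((\<lambda>h. (1 - exp (- (\<kappa> * h))) / h) \<longlongrightarrow> \<kappa>) (at_right 0)"
    by cases real_asymp+
  from tendsto_mult[OF tendsto_drift_ou_var[of \<kappa>] this] show ?thesis
    by (simp add: power2_eq_square)
qed simp

text \<open>The decisive cancellation: for \<kappa> \<noteq> 0 one has \<rho> / v = \<kappa> /
  sinh(\<kappa> h) = 1 / h - \<kappa>^2 h / 6 + O(h^3), so the singular part 1 / h is exactly the
  Brownian one.\<close>

lemma tendsto_cross_ou_var:
  "((\<lambda>h. (exp (- (\<kappa> * h)) / ou_var \<kappa> h - 1 / h) / h) \<longlongrightarrow> - (\<kappa>\<^sup>2) / 6) (at_right 0)"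
proof (cases "\<kappa> = 0")
  case True
  have "eventually (\<lambda>h. (exp (- (\<kappa> * h)) / ou_var \<kappa> h - 1 / h) / h = 0) (at_right 0)"
    using eventually_at_right_less[of 0] by eventually_elim (simp add: True ou_var_def)
  then show ?thesis
    by (simp add: True tendsto_eventually)
next
  case False
  then consider "\<kappa> > 0" | "\<kappa> < 0" by linarith
  then have "((\<lambda>h. (exp (- (\<kappa> * h)) / ((1 - exp (- (2 * \<kappa> * h))) / (2 * \<kappa>)) - 1 / h) / h) \<longlongrightarrow> - (\<kappa> * \<kappa>) / 6) (at_right 0)"
    by cases real_asymp+
  then show ?thesis by (simp add: ou_var_def False power2_eq_square)
qed

definition ou_density :: "real \<Rightarrow> real \<Rightarrow> real \<Rightarrow> real \<Rightarrow> real"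
  where "ou_density \<kappa> h x = normal_density (exp (- (\<kappa> * h)) * x) (sqrt (ou_var \<kappa> h))"

definition ou_loglik :: "real \<Rightarrow> real \<Rightarrow> nat \<Rightarrow> (nat \<Rightarrow> real) \<Rightarrow> real"
  where "ou_loglik \<kappa> h n y =
    (\<Sum>i<n. ln (ou_density \<kappa> h (y i) (y (Suc i)) / normal_density (y i) (sqrt h) (y (Suc i))))"

lemma ou_density_pos: "h > 0 \<Longrightarrow> ou_density \<kappa> h x y > 0"
  by (simp add: ou_density_def normal_density_pos ou_var_pos)

lemma ln_ou_density_ratio:
  fixes h \<kappa> x y :: real
  assumes "h > 0"
  defines "\<rho> \<equiv> exp (- (\<kappa> * h))" and "v \<equiv> ou_var \<kappa> h"
  shows "ln (ou_density \<kappa> h x y / normal_density x (sqrt h) y) =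
    - (ln (v / h) / 2) - (1 - \<rho>) / (2 * v) * (y\<^sup>2 - x\<^sup>2) - (1 - \<rho>)\<^sup>2 / (2 * v) * x\<^sup>2
      - (\<rho> / v - 1 / h) / 2 * (y - x)\<^sup>2"
proof -
  have v: "v > 0" using ou_var_pos[OF assms(1)] by (simp add: v_def)
  have 1: "ln (normal_density (\<mu>::real) (sqrt w) z) = - ln (2 * pi * w) / 2 - (z - \<mu>)\<^sup>2 / (2 * w)"
    if "w > 0" for \<mu> w z :: real
    using that by (simp add: normal_density_def ln_mult ln_div ln_sqrt add_divide_distrib)
  have "ln (ou_density \<kappa> h x y / normal_density x (sqrt h) y)
      = - ln (2 * pi * v) / 2 - (y - \<rho> * x)\<^sup>2 / (2 * v) + ln (2 * pi * h) / 2 + (y - x)\<^sup>2 / (2 * h)"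
    using v assms(1) ou_density_pos[OF assms(1), of \<kappa> x y] normal_density_pos[of "sqrt h" x y]
    by (subst ln_div) (simp_all add: ou_density_def 1 v_def[symmetric] \<rho>_def[symmetric])
  also have "- ln (2 * pi * v) / 2 = - ln (v / h) / 2 - ln (2 * pi * h) / 2"
    using v assms(1) by (simp add: ln_mult ln_div field_simps)
  \<comment> \<open>The exponent is sorted by what happens under summation over the grid: the first
    term telescopes, the second gives a Riemann sum, the third a sum of squared increments.\<close>
  also have "(y - \<rho> * x)\<^sup>2 / (2 * v) = (1 - \<rho>) / (2 * v) * (y\<^sup>2 - x\<^sup>2) + (1 - \<rho>)\<^sup>2 / (2 * v) * x\<^sup>2 + \<rho> / v / 2 * (y - x)\<^sup>2"
    using v by (simp add: divide_simps) (simp add: algebra_simps power2_eq_square)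
  finally show ?thesis
    using v assms(1) by (simp add: left_diff_distrib diff_divide_distrib)
qed

text \<open>The powers of h are distributed so that every coefficient is one of the four quantities
  whose limits were computed above, while the sums carry the weight h.\<close>

lemma ou_loglik_eq:
  fixes h \<kappa> :: real
  assumes "h > 0"
  defines "\<rho> \<equiv> exp (- (\<kappa> * h))" and "v \<equiv> ou_var \<kappa> h"
  shows "ou_loglik \<kappa> h n y =
    - (n * h) / 2 * (ln (v / h) / h) - (1 - \<rho>) / v / 2 * ((y n)\<^sup>2 - (y 0)\<^sup>2)
    - (1 - \<rho>)\<^sup>2 / (v * h) / 2 * (h * (\<Sum>i<n. (y i)\<^sup>2))
    - (\<rho> / v - 1 / h) / h / 2 * (h * (\<Sum>i<n. (y (Suc i) - y i)\<^sup>2))"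
proof -
  have "ou_loglik \<kappa> h n y = (\<Sum>i<n. - (ln (v / h) / 2) - (1 - \<rho>) / (2 * v) * ((y (Suc i))\<^sup>2 - (y i)\<^sup>2)
     - (1 - \<rho>)\<^sup>2 / (2 * v) * (y i)\<^sup>2 - (\<rho> / v - 1 / h) / 2 * (y (Suc i) - y i)\<^sup>2)"
    unfolding ou_loglik_def \<rho>_def v_def using assms(1) by (simp add: ln_ou_density_ratio)
  also have "\<dots> = - (n * ln (v / h) / 2) - (1 - \<rho>) / (2 * v) * (\<Sum>i<n. (y (Suc i))\<^sup>2 - (y i)\<^sup>2)
     - (1 - \<rho>)\<^sup>2 / (2 * v) * (\<Sum>i<n. (y i)\<^sup>2) - (\<rho> / v - 1 / h) / 2 * (\<Sum>i<n. (y (Suc i) - y i)\<^sup>2)"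
    by (simp only: sum_subtractf sum_distrib_left[symmetric] sum_constant card_lessThan)
  also have "(\<Sum>i<n. (y (Suc i))\<^sup>2 - (y i)\<^sup>2) = (y n)\<^sup>2 - (y 0)\<^sup>2"
    by (rule sum_lessThan_telescope)
  finally have eq: "ou_loglik \<kappa> h n y = - (n * ln (v / h) / 2) - (1 - \<rho>) / (2 * v) * ((y n)\<^sup>2 - (y 0)\<^sup>2)
     - (1 - \<rho>)\<^sup>2 / (2 * v) * (\<Sum>i<n. (y i)\<^sup>2) - (\<rho> / v - 1 / h) / 2 * (\<Sum>i<n. (y (Suc i) - y i)\<^sup>2)" .
  have "c / h / 2 * (h * z) = c / 2 * z" "c / (v * h) / 2 * (h * z) = c / (2 * v) * z"
    "- (n * h) / 2 * (c / h) = - (n * c / 2)" "c / v / 2 = c / (2 * v)" for c z :: real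
    using assms(1) by simp_all
  then show ?thesis unfolding eq by (simp only:)
qed

section \<open>Sums over uniform grids along a continuous function\<close>

lemma uniform_grid_modulus:
  fixes f :: "real \<Rightarrow> real"
  assumes f: "continuous_on {0..U} f" and "U > 0" "e > 0"
  shows "\<forall>\<^sub>F n in sequentially. \<forall>i<n. \<forall>s\<in>{real i * (U / n)..real (Suc i) * (U / n)}.
    s \<in> {0..U} \<and> \<bar>f s - f (real i * (U / n))\<bar> < e"
proof -
  have "uniformly_continuous_on {0..U} f"
    using f by (intro compact_uniformly_continuous) auto
  then obtain d where d: "d > 0"
    "\<And>x x'. x \<in> {0..U} \<Longrightarrow> x' \<in> {0..U} \<Longrightarrow> dist x' x < d \<Longrightarrow> dist (f x') (f x) < e"
    using \<open>e > 0\<close> unfolding uniformly_continuous_on_def by metis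
  have "(\<lambda>n. U / real n) \<longlonglongrightarrow> 0"
    by real_asymp
  then have "\<forall>\<^sub>F n in sequentially. U / real n < d"
    using d(1) by (rule order_tendstoD)
  then show ?thesis
    using eventually_gt_at_top[of 0]
  proof eventually_elim
    case (elim n)
    show ?case
    proof (intro allI impI ballI)
      fix i s assume i: "i < n" and s: "s \<in> {real i * (U / n)..real (Suc i) * (U / n)}"
      have 1: "real (Suc i) * (U / n) \<le> real n * (U / n)"
        using i \<open>U > 0\<close> by (intro mult_right_mono) auto
      have 2: "0 \<le> real i * (U / n)" using \<open>U > 0\<close> by simp
      have 3: "real (Suc i) * (U / n) = real i * (U / n) + U / n" by (simp add: algebra_simps add_divide_distrib)
      have s': "s \<in> {0..U}" "real i * (U / n) \<in> {0..U}"
        using s order.trans[OF 2, of s] order.trans[of s "real (Suc i) * (U / n)" "real n * (U / n)"]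
          order.trans[of "real i * (U / n)" s U] 1 2 elim(2) by auto
      have "dist s (real i * (U / n)) < d"
        using s 3 elim(1) unfolding dist_real_def atLeastAtMost_iff by linarith
      with d(2)[OF s'(2,1)] s' show "s \<in> {0..U} \<and> \<bar>f s - f (real i * (U / n))\<bar> < e"
        by (simp add: dist_real_def)
    qed
  qed
qed

lemma riemann_sum_tendsto:
  fixes f :: "real \<Rightarrow> real"
  assumes f: "continuous_on {0..U} f" and U: "U > 0"
  shows "(\<lambda>n. U / n * (\<Sum>i<n. f (real i * (U / n)))) \<longlonglongrightarrow> integral {0..U} f"
proof (rule LIMSEQ_I)
  fix e :: real assume "e > 0"
  \<comment> \<open>The tolerance e / (2 U) is an error per unit of length; over the length U it
    adds up to e / 2.\<close>
  have "\<forall>\<^sub>F n in sequentially. norm (U / n * (\<Sum>i<n. f (real i * (U / n))) - integral {0..U} f) < e"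
    using uniform_grid_modulus[OF f U, of "e / (2 * U)", OF divide_pos_pos[OF \<open>e > 0\<close> mult_pos_pos[OF zero_less_numeral U]]] eventually_gt_at_top[of 0]
  proof eventually_elim
    case (elim n)
    define t where "t i = real i * (U / n)" for i
    have tS: "t i \<le> t (Suc i)" "t (Suc i) - t i = U / n" for i
      using U by (auto simp: t_def algebra_simps add_divide_distrib)
    have t0: "t 0 = 0" "t n = U" using elim by (auto simp: t_def)
    have sub: "{t i..t (Suc i)} \<subseteq> {0..U}" if "i < n" for i
      using elim that unfolding t_def by blast
    have int: "f integrable_on {t i..t (Suc i)}" if "i < n" for i
      using sub[OF that] f by (intro integrable_continuous_real) (rule continuous_on_subset)
    have mono: "t i \<le> t j" if "i \<le> j" for i j using that U unfolding t_def by (intro mult_right_mono) auto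
    have "integral {t 0..t k} f = (\<Sum>i<k. integral {t i..t (Suc i)} f)" if "k \<le> n" for k
      using that
    proof (induction k)
      case (Suc k)
      have "f integrable_on {t 0..t (Suc k)}"
        using f Suc.prems t0 mono[of "Suc k" n]
        by (intro integrable_continuous_real) (auto elim: continuous_on_subset)
      then have "integral {t 0..t k} f + integral {t k..t (Suc k)} f = integral {t 0..t (Suc k)} f"
        by (intro Henstock_Kurzweil_Integration.integral_combine) (auto simp: tS mono)
      with Suc show ?case by simp
    qed simp
    from this[of n] have I: "integral {0..U} f = (\<Sum>i<n. integral {t i..t (Suc i)} f)"
      by (simp add: t0)
    have "\<bar>U / n * f (t i) - integral {t i..t (Suc i)} f\<bar> \<le> e / (2 * U) * (U / n)" if "i < n" for i
    proof -
      have "U / n * f (t i) - integral {t i..t (Suc i)} f = integral {t i..t (Suc i)} (\<lambda>s. f (t i) - f s)"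
        using int[OF that] tS[of i] by (subst Henstock_Kurzweil_Integration.integral_diff) auto
      also have "norm \<dots> \<le> e / (2 * U) * (t (Suc i) - t i)"
      proof (rule integral_bound)
        show "continuous_on {t i..t (Suc i)} (\<lambda>s. f (t i) - f s)"
          using continuous_on_subset[OF f sub[OF that]] by (intro continuous_intros)
        show "norm (f (t i) - f s) \<le> e / (2 * U)" if "s \<in> {t i..t (Suc i)}" for s
          using elim \<open>i < n\<close> that unfolding t_def by (fastforce simp: abs_minus_commute)
      qed (rule tS)
      finally show ?thesis by (simp add: tS)
    qed
    then have "\<bar>\<Sum>i<n. U / n * f (t i) - integral {t i..t (Suc i)} f\<bar> \<le> (\<Sum>i<n. e / (2 * U) * (U / n))"
      by (intro order.trans[OF sum_abs] sum_mono) auto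
    also have "\<dots> = e / 2" using elim U by simp
    also have "\<dots> < e" using \<open>e > 0\<close> by simp
    finally show ?case
      unfolding I by (simp add: sum_subtractf sum_distrib_left t_def)
  qed
  then show "\<exists>no. \<forall>n\<ge>no. norm (U / n * (\<Sum>i<n. f (real i * (U / n))) - integral {0..U} f) < e"
    by (simp add: eventually_sequentially)
qed

text \<open>There are n increments, each uniformly small by uniform continuity, and the weight U / n
  compensates their number. The unweighted sum, the quadratic variation, may well diverge for such
  f.\<close>

lemma mean_square_increment_tendsto:
  fixes f :: "real \<Rightarrow> real"
  assumes f: "continuous_on {0..U} f" and U: "U > 0"
  shows "(\<lambda>n. U / n * (\<Sum>i<n. (f (real (Suc i) * (U / n)) - f (real i * (U / n)))\<^sup>2)) \<longlonglongrightarrow> 0"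
proof (rule LIMSEQ_I)
  fix e :: real assume "e > 0"
  have "\<forall>\<^sub>F n in sequentially. norm (U / n * (\<Sum>i<n. (f (real (Suc i) * (U / n)) - f (real i * (U / n)))\<^sup>2) - 0) < e"
    using uniform_grid_modulus[OF f U, of "sqrt (e / (2 * U))", OF real_sqrt_gt_zero[OF divide_pos_pos[OF \<open>e > 0\<close> mult_pos_pos[OF zero_less_numeral U]]]] eventually_gt_at_top[of 0]
  proof eventually_elim
    case (elim n)
    have "(f (real (Suc i) * (U / n)) - f (real i * (U / n)))\<^sup>2 \<le> e / (2 * U)" if "i < n" for i
    proof -
      have "real (Suc i) * (U / n) \<in> {real i * (U / n)..real (Suc i) * (U / n)}"
        using U by (auto intro!: divide_right_mono mult_right_mono)
      then have "\<bar>f (real (Suc i) * (U / n)) - f (real i * (U / n))\<bar> < sqrt (e / (2 * U))"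
        using elim that by blast
      then have "\<bar>f (real (Suc i) * (U / n)) - f (real i * (U / n))\<bar>\<^sup>2 \<le> (sqrt (e / (2 * U)))\<^sup>2"
        by (intro power_mono) auto
      then show ?thesis using U \<open>e > 0\<close> by simp
    qed
    then have "(\<Sum>i<n. (f (real (Suc i) * (U / n)) - f (real i * (U / n)))\<^sup>2) \<le> (\<Sum>i<n. e / (2 * U))"
      by (intro sum_mono) auto
    then have "U / n * (\<Sum>i<n. (f (real (Suc i) * (U / n)) - f (real i * (U / n)))\<^sup>2) \<le> U / n * (\<Sum>i<n. e / (2 * U))"
      using U by (intro mult_left_mono) auto
    also have "\<dots> = e / 2" using elim U by simp
    also have "\<dots> < e" using \<open>e > 0\<close> by simp
    finally show ?case
      using U by (simp add: sum_nonneg)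
  qed
  then show "\<exists>no. \<forall>n\<ge>no. norm (U / n * (\<Sum>i<n. (f (real (Suc i) * (U / n)) - f (real i * (U / n)))\<^sup>2) - 0) < e"
    by (simp add: eventually_sequentially)
qed

text \<open>Termwise limit of \<open>ou_loglik_eq\<close>, where n h is the constant U. The constant
  - \<kappa>^2 / 6 of the cross term meets the vanishing mean square of the increments and leaves no
  trace.\<close>

lemma ou_loglik_tendsto:
  fixes f :: "real \<Rightarrow> real"
  assumes f: "continuous_on {0..U} f" and U: "U > 0"
  shows "(\<lambda>n. ou_loglik \<kappa> (U / n) n (\<lambda>i. f (real i * (U / n)))) \<longlonglongrightarrow>
    \<kappa> * U / 2 - \<kappa> / 2 * ((f U)\<^sup>2 - (f 0)\<^sup>2) - \<kappa>\<^sup>2 / 2 * integral {0..U} (\<lambda>u. (f u)\<^sup>2)"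
proof -
  have h: "filterlim (\<lambda>n. U / real n) (at_right 0) sequentially"
    using U by real_asymp
  note lims = filterlim_compose[OF tendsto_ln_ou_var h] filterlim_compose[OF tendsto_drift_ou_var h]
    filterlim_compose[OF tendsto_drift_square_ou_var h] filterlim_compose[OF tendsto_cross_ou_var h]
  let ?h = "\<lambda>n. U / real n"
  have "continuous_on {0..U} (\<lambda>u. (f u)\<^sup>2)"
    using f by (intro continuous_intros)
  note r = riemann_sum_tendsto[OF this U]
  note ms = mean_square_increment_tendsto[OF f U]
  have "(\<lambda>n. - U / 2 * (ln (ou_var \<kappa> (?h n) / ?h n) / ?h n)
      - (1 - exp (- (\<kappa> * ?h n))) / ou_var \<kappa> (?h n) / 2 * ((f U)\<^sup>2 - (f 0)\<^sup>2)
      - (1 - exp (- (\<kappa> * ?h n)))\<^sup>2 / (ou_var \<kappa> (?h n) * ?h n) / 2 * (?h n * (\<Sum>i<n. (f (real i * ?h n))\<^sup>2))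
      - (exp (- (\<kappa> * ?h n)) / ou_var \<kappa> (?h n) - 1 / ?h n) / ?h n / 2 *
          (?h n * (\<Sum>i<n. (f (real (Suc i) * ?h n) - f (real i * ?h n))\<^sup>2)))
    \<longlonglongrightarrow> - U / 2 * (- \<kappa>) - \<kappa> / 2 * ((f U)\<^sup>2 - (f 0)\<^sup>2)
      - \<kappa>\<^sup>2 / 2 * integral {0..U} (\<lambda>u. (f u)\<^sup>2) - (- (\<kappa>\<^sup>2) / 6) / 2 * 0"
    by (intro tendsto_diff tendsto_mult tendsto_divide tendsto_const lims r ms) auto
  moreover have "\<forall>\<^sub>F n in sequentially. (- U / 2 * (ln (ou_var \<kappa> (?h n) / ?h n) / ?h n)
      - (1 - exp (- (\<kappa> * ?h n))) / ou_var \<kappa> (?h n) / 2 * ((f U)\<^sup>2 - (f 0)\<^sup>2)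
      - (1 - exp (- (\<kappa> * ?h n)))\<^sup>2 / (ou_var \<kappa> (?h n) * ?h n) / 2 * (?h n * (\<Sum>i<n. (f (real i * ?h n))\<^sup>2))
      - (exp (- (\<kappa> * ?h n)) / ou_var \<kappa> (?h n) - 1 / ?h n) / ?h n / 2 *
          (?h n * (\<Sum>i<n. (f (real (Suc i) * ?h n) - f (real i * ?h n))\<^sup>2)))
      = ou_loglik \<kappa> (?h n) n (\<lambda>i. f (real i * ?h n))"
    using eventually_gt_at_top[of 0]
  proof eventually_elim
    case (elim n)
    then have "?h n > 0" "real n * ?h n = U" using U by auto
    then show ?case by (subst ou_loglik_eq) (simp_all del: times_divide_eq_left times_divide_eq_right)
  qed
  ultimately show ?thesis
    by (rule Lim_transform_eventually[THEN tendsto_eq_rhs]) (simp add: mult.commute)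
qed

section \<open>$L^2$-convergence and independence\<close>

text \<open>Integrates (a + b)^2 \<le> 2 a^2 + 2 b^2. Extended nonnegative integrals are the form in
  which \<open>is_wiener_integral\<close> states its convergence.\<close>

lemma L2_triangle:
  fixes f g h :: "'a \<Rightarrow> real"
  assumes [measurable]: "f \<in> borel_measurable M" "g \<in> borel_measurable M" "h \<in> borel_measurable M"
  shows "(\<integral>\<^sup>+x. ennreal ((f x - h x)\<^sup>2) \<partial>M) \<le>
    2 * (\<integral>\<^sup>+x. ennreal ((f x - g x)\<^sup>2) \<partial>M) + 2 * (\<integral>\<^sup>+x. ennreal ((g x - h x)\<^sup>2) \<partial>M)"
proof -
  have "(f x - h x)\<^sup>2 \<le> 2 * (f x - g x)\<^sup>2 + 2 * (g x - h x)\<^sup>2" for x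
    using zero_le_power2[of "(f x - g x) - (g x - h x)"] by (simp add: power2_eq_square algebra_simps)
  then have "ennreal ((f x - h x)\<^sup>2) \<le> 2 * ennreal ((f x - g x)\<^sup>2) + 2 * ennreal ((g x - h x)\<^sup>2)" for x
    by (simp add: ennreal_leI ennreal_plus[symmetric] ennreal_mult'[symmetric]
        ennreal_numeral[symmetric] del: ennreal_plus ennreal_numeral)
  then have "(\<integral>\<^sup>+x. ennreal ((f x - h x)\<^sup>2) \<partial>M) \<le>
    (\<integral>\<^sup>+x. 2 * ennreal ((f x - g x)\<^sup>2) + 2 * ennreal ((g x - h x)\<^sup>2) \<partial>M)"
    by (intro nn_integral_mono)
  also have "\<dots> = 2 * (\<integral>\<^sup>+x. ennreal ((f x - g x)\<^sup>2) \<partial>M) + 2 * (\<integral>\<^sup>+x. ennreal ((g x - h x)\<^sup>2) \<partial>M)"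
    by (simp add: nn_integral_add nn_integral_cmult)
  finally show ?thesis .
qed

lemma L2_tendsto_trans:
  fixes f :: "'a \<Rightarrow> real" and g h :: "nat \<Rightarrow> 'a \<Rightarrow> real"
  assumes [measurable]: "f \<in> borel_measurable M" "\<And>k. g k \<in> borel_measurable M" "\<And>k. h k \<in> borel_measurable M"
  assumes 1: "(\<lambda>k. \<integral>\<^sup>+x. ennreal ((f x - g k x)\<^sup>2) \<partial>M) \<longlonglongrightarrow> 0"
    and 2: "(\<lambda>k. \<integral>\<^sup>+x. ennreal ((g k x - h k x)\<^sup>2) \<partial>M) \<longlonglongrightarrow> 0"
  shows "(\<lambda>k. \<integral>\<^sup>+x. ennreal ((f x - h k x)\<^sup>2) \<partial>M) \<longlonglongrightarrow> 0"
proof (rule tendsto_sandwich[OF always_eventually always_eventually tendsto_const])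
  show "(\<lambda>k. 2 * (\<integral>\<^sup>+x. ennreal ((f x - g k x)\<^sup>2) \<partial>M) + 2 * (\<integral>\<^sup>+x. ennreal ((g k x - h k x)\<^sup>2) \<partial>M)) \<longlonglongrightarrow> 0"
    using tendsto_add[OF ennreal_tendsto_cmult[OF _ 1, of 2] ennreal_tendsto_cmult[OF _ 2, of 2]] by simp
qed (auto intro!: L2_triangle)

text \<open>Wiener integrals are known only as L^2 limits. The almost sure subsequence serves twice:
  to obtain versions measurable in the past, and to pass characteristic functions to the
  limit.\<close>

lemma L2_tendsto_AE_subseq:
  fixes f :: "'a \<Rightarrow> real" and u :: "nat \<Rightarrow> 'a \<Rightarrow> real"
  assumes [measurable]: "f \<in> borel_measurable M" "\<And>k. u k \<in> borel_measurable M"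
  assumes lim: "(\<lambda>k. \<integral>\<^sup>+x. ennreal ((f x - u k x)\<^sup>2) \<partial>M) \<longlonglongrightarrow> 0"
  shows "\<exists>r. strict_mono r \<and> (AE x in M. (\<lambda>k. u (r k) x) \<longlonglongrightarrow> f x)"
proof -
  \<comment> \<open>The first few integrals may be infinite. The sequence is shifted by m so that
    all remaining ones are finite and the L^1 subsequence theorem applies.\<close>
  have "\<forall>\<^sub>F k in sequentially. (\<integral>\<^sup>+x. ennreal ((f x - u k x)\<^sup>2) \<partial>M) < 1"
    using lim by (rule order_tendstoD) simp
  then obtain m where m: "\<And>k. k \<ge> m \<Longrightarrow> (\<integral>\<^sup>+x. ennreal ((f x - u k x)\<^sup>2) \<partial>M) < 1"
    by (auto simp: eventually_sequentially)
  let ?v = "\<lambda>k x. (f x - u (k + m) x)\<^sup>2"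
  have int: "integrable M (?v k)" for k
    by (rule integrableI_bounded) (use order.strict_trans[OF m[of "k + m"], of \<infinity>] in auto)
  have "(\<lambda>k. ennreal (LINT x|M. norm (?v k x))) \<longlonglongrightarrow> ennreal 0"
    using LIMSEQ_ignore_initial_segment[OF lim, of m] int by (simp add: nn_integral_eq_integral)
  then have "(\<lambda>k. LINT x|M. norm (?v k x)) \<longlonglongrightarrow> 0"
    by (subst (asm) tendsto_ennreal_iff) auto
  from tendsto_L1_AE_subseq[OF int this] obtain r where
    r: "strict_mono r" "AE x in M. (\<lambda>k. ?v (r k) x) \<longlonglongrightarrow> 0" by blast
  show ?thesis
  proof (intro exI[of _ "\<lambda>k. r k + m"] conjI)
    show "strict_mono (\<lambda>k. r k + m)" using r(1) by (simp add: strict_mono_def)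
    show "AE x in M. (\<lambda>k. u (r k + m) x) \<longlonglongrightarrow> f x"
      using r(2)
    proof eventually_elim
      case (elim x)
      then have "(\<lambda>k. sqrt ((f x - u (r k + m) x)\<^sup>2)) \<longlonglongrightarrow> sqrt 0" by (rule tendsto_real_sqrt)
      then have "(\<lambda>k. \<bar>f x - u (r k + m) x\<bar>) \<longlonglongrightarrow> 0" by simp
      then have "(\<lambda>k. f x - (f x - u (r k + m) x)) \<longlonglongrightarrow> f x - 0"
        by (intro tendsto_diff tendsto_const) (simp add: tendsto_rabs_zero_iff)
      then show ?case by simp
    qed
  qed
qed

lemma L2_norm_tendsto:
  fixes f :: "'a \<Rightarrow> real" and u :: "nat \<Rightarrow> 'a \<Rightarrow> real"
  assumes [measurable]: "f \<in> borel_measurable M" "\<And>k. u k \<in> borel_measurable M"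
  assumes lim: "(\<lambda>k. \<integral>\<^sup>+x. ennreal ((f x - u k x)\<^sup>2) \<partial>M) \<longlonglongrightarrow> 0"
    and f: "integrable M (\<lambda>x. (f x)\<^sup>2)" and u: "\<And>k. integrable M (\<lambda>x. (u k x)\<^sup>2)"
  shows "(\<lambda>k. LINT x|M. (u k x)\<^sup>2) \<longlonglongrightarrow> (LINT x|M. (f x)\<^sup>2)"
proof (rule LIMSEQ_I)
  fix e :: real assume e: "e > 0"
  have d: "integrable M (\<lambda>x. (f x - u k x)\<^sup>2)" for k
  proof (rule Bochner_Integration.integrable_bound)
    show "integrable M (\<lambda>x. 2 * (f x)\<^sup>2 + 2 * (u k x)\<^sup>2)" using f u by simp
    show "AE x in M. norm ((f x - u k x)\<^sup>2) \<le> norm (2 * (f x)\<^sup>2 + 2 * (u k x)\<^sup>2)"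
    proof (rule AE_I2)
      fix x
      have "(f x - u k x)\<^sup>2 \<le> 2 * (f x)\<^sup>2 + 2 * (u k x)\<^sup>2"
        using zero_le_power2[of "f x + u k x"] by (simp add: power2_eq_square algebra_simps)
      then show "norm ((f x - u k x)\<^sup>2) \<le> norm (2 * (f x)\<^sup>2 + 2 * (u k x)\<^sup>2)"
        by simp
    qed
  qed simp
  have "(\<lambda>k. ennreal (LINT x|M. (f x - u k x)\<^sup>2)) \<longlonglongrightarrow> ennreal 0"
    using lim d by (simp add: nn_integral_eq_integral)
  then have dlim: "(\<lambda>k. LINT x|M. (f x - u k x)\<^sup>2) \<longlonglongrightarrow> 0"
    by (subst (asm) tendsto_ennreal_iff) auto
  define C where "C = (LINT x|M. (f x)\<^sup>2)"
  have C: "C \<ge> 0" by (simp add: C_def)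
  \<comment> \<open>The bound below uses 2 |p q| \<le> q^2 / \<delta> + \<delta> p^2, trading the
    cross term for a small multiple of the fixed value C. The summand 1 in the denominator covers C
    = 0.\<close>
  define \<delta> where "\<delta> = e / (2 * (C + 1))"
  have \<delta>: "\<delta> > 0" "\<delta> * C < e / 2"
    using e C by (auto simp: \<delta>_def field_simps)
  have bound: "\<bar>(LINT x|M. (u k x)\<^sup>2) - C\<bar> \<le> (1 + 1 / \<delta>) * (LINT x|M. (f x - u k x)\<^sup>2) + \<delta> * C" for k
  proof -
    have "\<bar>(LINT x|M. (u k x)\<^sup>2) - C\<bar> = \<bar>LINT x|M. (u k x)\<^sup>2 - (f x)\<^sup>2\<bar>"
      using f u by (simp add: C_def)
    also have "\<dots> \<le> (LINT x|M. \<bar>(u k x)\<^sup>2 - (f x)\<^sup>2\<bar>)"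
      by (rule integral_abs_bound)
    also have "\<dots> \<le> (LINT x|M. (1 + 1 / \<delta>) * (f x - u k x)\<^sup>2 + \<delta> * (f x)\<^sup>2)"
    proof (rule integral_mono)
      fix x
      let ?d = "f x - u k x"
      have "(u k x)\<^sup>2 - (f x)\<^sup>2 = ?d\<^sup>2 - 2 * (f x * ?d)"
        by (simp add: power2_eq_square algebra_simps)
      moreover have "2 * \<bar>f x * ?d\<bar> \<le> ?d\<^sup>2 / \<delta> + \<delta> * (f x)\<^sup>2"
      proof -
        have "2 * (p * q) \<le> q\<^sup>2 / \<delta> + \<delta> * p\<^sup>2" for p q :: real
        proof -
          have "0 \<le> (q - \<delta> * p)\<^sup>2 / \<delta>" using \<delta> by simp
          also have "\<dots> = q\<^sup>2 / \<delta> + \<delta> * p\<^sup>2 - 2 * (p * q)"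
            using \<delta> by (simp add: power2_eq_square field_simps)
          finally show ?thesis by simp
        qed
        from this[of "\<bar>f x\<bar>" "\<bar>?d\<bar>"] show ?thesis by (simp add: abs_mult)
      qed
      moreover have "\<bar>p - 2 * r\<bar> \<le> p + q" if "2 * \<bar>r\<bar> \<le> q" "0 \<le> p" for p q r :: real
        using that by linarith
      ultimately have "\<bar>(u k x)\<^sup>2 - (f x)\<^sup>2\<bar> \<le> ?d\<^sup>2 + (?d\<^sup>2 / \<delta> + \<delta> * (f x)\<^sup>2)"
        by (metis zero_le_power2)
      then show "\<bar>(u k x)\<^sup>2 - (f x)\<^sup>2\<bar> \<le> (1 + 1 / \<delta>) * ?d\<^sup>2 + \<delta> * (f x)\<^sup>2"
        by (simp only: distrib_right mult_1_left times_divide_eq_left add.assoc)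
    qed (use f u d in auto)
    also have "\<dots> = (1 + 1 / \<delta>) * (LINT x|M. (f x - u k x)\<^sup>2) + \<delta> * C"
      using f d by (simp add: C_def)
    finally show ?thesis .
  qed
  have "(\<lambda>k. (1 + 1 / \<delta>) * (LINT x|M. (f x - u k x)\<^sup>2)) \<longlonglongrightarrow> (1 + 1 / \<delta>) * 0"
    by (intro tendsto_intros dlim)
  then have "\<forall>\<^sub>F k in sequentially. (1 + 1 / \<delta>) * (LINT x|M. (f x - u k x)\<^sup>2) < e / 2"
    using e by (intro order_tendstoD) auto
  then have "\<forall>\<^sub>F k in sequentially. norm ((LINT x|M. (u k x)\<^sup>2) - C) < e"
  proof eventually_elim
    case (elim k)
    have "\<bar>(LINT x|M. (u k x)\<^sup>2) - C\<bar> < e"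
      using bound[of k] elim \<delta>(2) by linarith
    then show ?case by simp
  qed
  then show "\<exists>no. \<forall>k\<ge>no. norm ((LINT x|M. (u k x)\<^sup>2) - (LINT x|M. (f x)\<^sup>2)) < e"
    by (simp add: eventually_sequentially C_def)
qed

text \<open>\<open>indep_var\<close> speaks of the generated sigma-algebras. Preimages are stable
  under intersection, so the product formula on them extends.\<close>

lemma (in prob_space) indep_varI:
  assumes [measurable]: "random_variable S X" "random_variable T Y"
    and indep: "\<And>A B. A \<in> sets S \<Longrightarrow> B \<in> sets T \<Longrightarrow>
      prob ((X -` A \<inter> space M) \<inter> (Y -` B \<inter> space M)) = prob (X -` A \<inter> space M) * prob (Y -` B \<inter> space M)"
  shows "indep_var S X T Y"
proof -
  have stable: "Int_stable {Z -` A \<inter> space M |A. A \<in> sets R}" for Z and R :: "'z measure"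
  proof (rule Int_stableI)
    fix a b assume "a \<in> {Z -` A \<inter> space M |A. A \<in> sets R}" "b \<in> {Z -` A \<inter> space M |A. A \<in> sets R}"
    then obtain A B where AB: "A \<in> sets R" "B \<in> sets R" "a = Z -` A \<inter> space M" "b = Z -` B \<inter> space M"
      by blast
    then have "a \<inter> b = Z -` (A \<inter> B) \<inter> space M" "A \<inter> B \<in> sets R" by auto
    then show "a \<inter> b \<in> {Z -` A \<inter> space M |A. A \<in> sets R}" by blast
  qed
  show ?thesis
    unfolding indep_var_eq
    by (intro conjI assms(1,2) indep_set_sigma_sets stable indep_setI)
      (auto simp: indep)
qed

section \<open>Brownian increments\<close>

text \<open>The right-hand side is the polarization expression that also gives the covariance of two
  Brownian increments; matching the two yields the isometry.\<close>

lemma measure_Int_Ioc: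
  fixes a b c d :: real
  assumes "a \<le> b" "c \<le> d"
  shows "measure lborel ({a<..b} \<inter> {c<..d}) = (\<bar>b - c\<bar> + \<bar>a - d\<bar> - \<bar>b - d\<bar> - \<bar>a - c\<bar>) / 2"
proof -
  have "{a<..b} \<inter> {c<..d} = {max a c<..min b d}" by auto
  then show ?thesis using assms by (auto simp: max_def min_def abs_if not_le)
qed

lemma finite_Ioc: "emeasure lborel {p<..q::real} < \<top>"
  by (cases "p \<le> q") auto

lemma integral_step_function_square:
  fixes \<tau> c :: "nat \<Rightarrow> real"
  assumes \<tau>: "mono_on {..n} \<tau>"
  shows "integrable lborel (\<lambda>s. (step_function n \<tau> c s)\<^sup>2)"
    and "(LINT s|lborel. (step_function n \<tau> c s)\<^sup>2) = (\<Sum>i<n. (c i)\<^sup>2 * (\<tau> (Suc i) - \<tau> i))"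
proof -
  have "(step_function n \<tau> c s)\<^sup>2 = (\<Sum>i<n. (c i)\<^sup>2 * indicator {\<tau> i<..\<tau> (Suc i)} s)" for s
  proof -
    have disj: "indicator {\<tau> i<..\<tau> (Suc i)} s * (indicator {\<tau> j<..\<tau> (Suc j)} s :: real)
        = (if i = j then indicator {\<tau> i<..\<tau> (Suc i)} s else 0)" if "i < n" "j < n" for i j
    proof (cases i j rule: linorder_cases)
      case less
      then have "\<tau> (Suc i) \<le> \<tau> j" using that \<tau> by (auto simp: mono_on_def)
      then show ?thesis using less by (auto simp: indicator_def)
    next
      case greater
      then have "\<tau> (Suc j) \<le> \<tau> i" using that \<tau> by (auto simp: mono_on_def)
      then show ?thesis using greater by (auto simp: indicator_def)
    qed (auto simp: indicator_def)
    have "(step_function n \<tau> c s)\<^sup>2 = (\<Sum>i<n. \<Sum>j<n. c i * c j *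
        (indicator {\<tau> i<..\<tau> (Suc i)} s * indicator {\<tau> j<..\<tau> (Suc j)} s))"
      unfolding step_function_def power2_eq_square sum_product
      by (intro sum.cong refl) (simp only: ac_simps)
    also have "\<dots> = (\<Sum>i<n. \<Sum>j<n. if i = j then c i * c j * indicator {\<tau> i<..\<tau> (Suc i)} s else 0)"
      by (intro sum.cong refl) (simp add: disj)
    finally show ?thesis by (simp add: sum.delta power2_eq_square)
  qed
  note sq = this
  have int: "integrable lborel (\<lambda>s. (c i)\<^sup>2 * indicator {\<tau> i<..\<tau> (Suc i)} s)" for i
    by (intro integrable_mult_right integrable_real_indicator) (auto simp: finite_Ioc)
  show "integrable lborel (\<lambda>s. (step_function n \<tau> c s)\<^sup>2)"
    unfolding sq by (intro Bochner_Integration.integrable_sum int)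
  have "(LINT s|lborel. (step_function n \<tau> c s)\<^sup>2)
      = (\<Sum>i<n. LINT s|lborel. (c i)\<^sup>2 * indicator {\<tau> i<..\<tau> (Suc i)} s)"
    unfolding sq by (intro Bochner_Integration.integral_sum int)
  also have "\<dots> = (\<Sum>i<n. (c i)\<^sup>2 * (\<tau> (Suc i) - \<tau> i))"
    using \<tau> by (intro sum.cong refl) (auto simp: mono_on_def)
  finally show "(LINT s|lborel. (step_function n \<tau> c s)\<^sup>2) = (\<Sum>i<n. (c i)\<^sup>2 * (\<tau> (Suc i) - \<tau> i))" .
qed

locale brownian = prob_space M for M :: "'a measure" +
  fixes W :: "real \<Rightarrow> 'a \<Rightarrow> real"
  assumes brownian_motion: "brownian_motion M W"
begin

lemma measurable_W: "0 \<le> t \<Longrightarrow> t \<le> 1 \<Longrightarrow> W t \<in> borel_measurable M"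
  and W_0: "AE \<omega> in M. W 0 \<omega> = 0"
  and W_increment: "0 \<le> s \<Longrightarrow> s < t \<Longrightarrow> t \<le> 1 \<Longrightarrow>
    distributed M lborel (\<lambda>\<omega>. W t \<omega> - W s \<omega>) (normal_density 0 (sqrt (t - s)))"
  and indep_increments: "mono_on {..n} \<tau> \<Longrightarrow> \<tau> ` {..n} \<subseteq> {0..1} \<Longrightarrow>
    indep_vars (\<lambda>_. borel) (\<lambda>i \<omega>. W (\<tau> (Suc i)) \<omega> - W (\<tau> i) \<omega>) {..<n::nat}"
  using brownian_motion unfolding brownian_motion_def by auto

lemma increment_second_moment:
  assumes "s \<in> {0..1}" "t \<in> {0..1}"
  shows "integrable M (\<lambda>\<omega>. (W t \<omega> - W s \<omega>)\<^sup>2)" "(LINT \<omega>|M. (W t \<omega> - W s \<omega>)\<^sup>2) = \<bar>t - s\<bar>"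
proof -
  have *: "integrable M (\<lambda>\<omega>. (W t \<omega> - W s \<omega>)\<^sup>2) \<and> (LINT \<omega>|M. (W t \<omega> - W s \<omega>)\<^sup>2) = \<bar>t - s\<bar>"
    if "0 \<le> s" "s < t" "t \<le> 1" for s t
  proof -
    note D = W_increment[OF that]
    have \<sigma>: "0 < sqrt (t - s)" using that by simp
    have "integrable M (\<lambda>\<omega>. (W t \<omega> - W s \<omega>)\<^sup>2)"
      using integrable_normal_moment[OF \<sigma>, of 0 2]
      by (subst distributed_integrable[OF D, symmetric]) simp_all
    moreover have "(LINT \<omega>|M. (W t \<omega> - W s \<omega>)\<^sup>2) = \<bar>t - s\<bar>"
      using normal_distributed_variance[OF \<sigma> D] that
      by (simp add: normal_distributed_expectation[OF \<sigma> D])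
    ultimately show ?thesis by blast
  qed
  have "integrable M (\<lambda>\<omega>. (W t \<omega> - W s \<omega>)\<^sup>2) \<and> (LINT \<omega>|M. (W t \<omega> - W s \<omega>)\<^sup>2) = \<bar>t - s\<bar>"
  proof (cases s t rule: linorder_cases)
    case greater
    then show ?thesis
      using *[of t s] assms by (simp add: power2_commute[of "W t _"] abs_minus_commute)
  qed (use *[of s t] assms in auto)
  then show "integrable M (\<lambda>\<omega>. (W t \<omega> - W s \<omega>)\<^sup>2)" "(LINT \<omega>|M. (W t \<omega> - W s \<omega>)\<^sup>2) = \<bar>t - s\<bar>"
    by auto
qed

text \<open>Polarization: only the second moments of single increments enter, so no common
  refinement of the intervals is needed.\<close>

lemma increment_covariance:
  assumes "a \<in> {0..1}" "b \<in> {0..1}" "c \<in> {0..1}" "d \<in> {0..1}"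
  shows "integrable M (\<lambda>\<omega>. (W b \<omega> - W a \<omega>) * (W d \<omega> - W c \<omega>))"
    and "(LINT \<omega>|M. (W b \<omega> - W a \<omega>) * (W d \<omega> - W c \<omega>)) = (\<bar>b - c\<bar> + \<bar>a - d\<bar> - \<bar>b - d\<bar> - \<bar>a - c\<bar>) / 2"
proof -
  have *: "(W b \<omega> - W a \<omega>) * (W d \<omega> - W c \<omega>) = ((W b \<omega> - W c \<omega>)\<^sup>2 + (W a \<omega> - W d \<omega>)\<^sup>2
      - (W b \<omega> - W d \<omega>)\<^sup>2 - (W a \<omega> - W c \<omega>)\<^sup>2) / 2" for \<omega>
    by (simp add: power2_eq_square algebra_simps)
  show "integrable M (\<lambda>\<omega>. (W b \<omega> - W a \<omega>) * (W d \<omega> - W c \<omega>))"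
    "(LINT \<omega>|M. (W b \<omega> - W a \<omega>) * (W d \<omega> - W c \<omega>)) = (\<bar>b - c\<bar> + \<bar>a - d\<bar> - \<bar>b - d\<bar> - \<bar>a - c\<bar>) / 2"
    unfolding * using assms by (simp_all add: increment_second_moment)
qed

text \<open>Both sides are quadratic forms in c, and their Gram matrices agree by
  \<open>increment_covariance\<close> and \<open>measure_Int_Ioc\<close>. The intervals may overlap,
  which allows differences of step functions on unrelated partitions.\<close>

lemma increments_isometry:
  fixes a b c :: "'j \<Rightarrow> real"
  assumes J: "finite J" and ab: "\<And>j. j \<in> J \<Longrightarrow> 0 \<le> a j \<and> a j \<le> b j \<and> b j \<le> 1"
  shows "(\<integral>\<^sup>+\<omega>. ennreal ((\<Sum>j\<in>J. c j * (W (b j) \<omega> - W (a j) \<omega>))\<^sup>2) \<partial>M) =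
    (\<integral>\<^sup>+s. ennreal ((\<Sum>j\<in>J. c j * indicator {a j<..b j} s)\<^sup>2) \<partial>lborel)"
proof -
  have ab': "a j \<in> {0..1}" "b j \<in> {0..1}" if "j \<in> J" for j using ab[OF that] by auto
  let ?X = "\<lambda>j \<omega>. W (b j) \<omega> - W (a j) \<omega>"
  let ?I = "\<lambda>j. indicator {a j<..b j} :: real \<Rightarrow> real"
  have sq: "(\<Sum>j\<in>J. c j * z j)\<^sup>2 = (\<Sum>j\<in>J. \<Sum>k\<in>J. c j * c k * (z j * z k))" for z :: "'j \<Rightarrow> real"
    by (simp add: power2_eq_square sum_product algebra_simps)
  have I: "?I j s * ?I k s = indicator ({a j<..b j} \<inter> {a k<..b k}) s" for j k s
    by (rule indicator_inter_arith[symmetric])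
  have i1: "integrable M (\<lambda>\<omega>. c j * c k * (?X j \<omega> * ?X k \<omega>))" if "j \<in> J" "k \<in> J" for j k
    using that ab' by (intro integrable_mult_right increment_covariance) auto
  have i2: "integrable lborel (\<lambda>s. c j * c k * (?I j s * ?I k s))" for j k
    unfolding I by (intro integrable_mult_right integrable_real_indicator)
      (auto simp: finite_Ioc)
  have int1: "integrable M (\<lambda>\<omega>. (\<Sum>j\<in>J. c j * ?X j \<omega>)\<^sup>2)"
    unfolding sq by (intro Bochner_Integration.integrable_sum i1)
  have int2: "integrable lborel (\<lambda>s. (\<Sum>j\<in>J. c j * ?I j s)\<^sup>2)"
    unfolding sq by (intro Bochner_Integration.integrable_sum i2)
  have "(\<integral>\<^sup>+\<omega>. ennreal ((\<Sum>j\<in>J. c j * ?X j \<omega>)\<^sup>2) \<partial>M) = ennreal (LINT \<omega>|M. (\<Sum>j\<in>J. c j * ?X j \<omega>)\<^sup>2)"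
    by (intro nn_integral_eq_integral int1) simp
  also have "(LINT \<omega>|M. (\<Sum>j\<in>J. c j * ?X j \<omega>)\<^sup>2) = (\<Sum>j\<in>J. \<Sum>k\<in>J. c j * c k * (LINT \<omega>|M. ?X j \<omega> * ?X k \<omega>))"
    unfolding sq using i1 by (simp add: Bochner_Integration.integrable_sum)
  also have "\<dots> = (\<Sum>j\<in>J. \<Sum>k\<in>J. c j * c k * measure lborel ({a j<..b j} \<inter> {a k<..b k}))"
  proof (intro sum.cong refl arg_cong2[where f = "(*)"])
    fix j k assume jk: "j \<in> J" "k \<in> J"
    show "(LINT \<omega>|M. ?X j \<omega> * ?X k \<omega>) = measure lborel ({a j<..b j} \<inter> {a k<..b k})"
      using ab[OF jk(1)] ab[OF jk(2)]
      by (subst increment_covariance(2)[OF ab'[OF jk(1)] ab'[OF jk(2)]], subst measure_Int_Ioc) auto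
  qed
  also have "\<dots> = (\<Sum>j\<in>J. \<Sum>k\<in>J. c j * c k * (LINT s|lborel. ?I j s * ?I k s))"
    unfolding I by simp
  also have "\<dots> = (LINT s|lborel. (\<Sum>j\<in>J. c j * ?I j s)\<^sup>2)"
    unfolding sq using i2 by (simp add: Bochner_Integration.integrable_sum)
  also have "ennreal \<dots> = (\<integral>\<^sup>+s. ennreal ((\<Sum>j\<in>J. c j * ?I j s)\<^sup>2) \<partial>lborel)"
    by (intro nn_integral_eq_integral[symmetric] int2) simp
  finally show ?thesis .
qed

lemma char_increment:
  assumes "0 \<le> s" "s \<le> t" "t \<le> 1"
  shows "char (distr M borel (\<lambda>\<omega>. c * (W t \<omega> - W s \<omega>))) \<theta> = exp (- (\<theta>\<^sup>2 * (c\<^sup>2 * (t - s))) / 2)"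
proof -
  have [measurable]: "W t \<in> borel_measurable M" "W s \<in> borel_measurable M"
    using assms by (auto intro: measurable_W)
  show ?thesis
  \<comment> \<open>Partitions are only weakly monotone, so degenerate intervals occur; for them the
    increment is constant and has no density.\<close>
  proof (cases "s = t")
    case True
    then show ?thesis by (simp add: char_def integral_distr prob_space del: distr_const)
  next
    case False
    then have lt: "s < t" and pos: "0 < sqrt (t - s)" using assms by auto
    let ?Z = "\<lambda>\<omega>. (W t \<omega> - W s \<omega> - 0) / sqrt (t - s)"
    have "distributed M lborel ?Z std_normal_density"
      using W_increment[OF assms(1) lt assms(3)] by (subst (asm) normal_standard_normal_convert[OF pos])
    then have Z: "distr M borel ?Z = std_normal_distribution"
      using distributed_distr_eq_density by (metis (no_types, lifting) distr_cong sets_lborel)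
    have "char (distr M borel (\<lambda>\<omega>. c * (W t \<omega> - W s \<omega>))) \<theta> = char (distr M borel ?Z) (\<theta> * c * sqrt (t - s))"
      using pos by (simp add: char_def integral_distr)
    also have "\<dots> = exp (- (\<theta>\<^sup>2 * (c\<^sup>2 * (t - s))) / 2)"
      using lt unfolding Z char_std_normal_distribution by (simp add: power_mult_distrib)
    finally show ?thesis .
  qed
qed

lemma measurable_step_integral:
  assumes "\<tau> ` {..n} \<subseteq> {0..1}"
  shows "step_integral n \<tau> c W \<in> borel_measurable M"
  unfolding step_integral_def[abs_def]
  using assms by (intro borel_measurable_sum borel_measurable_times borel_measurable_diff measurable_W)
    (auto simp: image_subset_iff)

text \<open>The increments are independent, so characteristic functions multiply and the variances
  add up to the squared L^2 norm of the step function.\<close>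

lemma char_step_integral:
  assumes \<tau>: "mono_on {..n} \<tau>" "\<tau> ` {..n} \<subseteq> {0..1}"
  shows "char (distr M borel (step_integral n \<tau> c W)) \<theta> =
    exp (- (\<theta>\<^sup>2 * (LINT s|lborel. (step_function n \<tau> c s)\<^sup>2)) / 2)"
proof -
  have "\<tau> i \<in> {0..1} \<and> \<tau> (Suc i) \<in> {0..1} \<and> \<tau> i \<le> \<tau> (Suc i)" if "i < n" for i
    using that \<tau> by (auto simp: mono_on_def image_subset_iff)
  then have *: "i < n \<Longrightarrow> 0 \<le> \<tau> i \<and> \<tau> i \<le> \<tau> (Suc i) \<and> \<tau> (Suc i) \<le> 1" for i by auto
  have "indep_vars (\<lambda>_. borel) (\<lambda>i. (\<lambda>x. c i * x) \<circ> (\<lambda>\<omega>. W (\<tau> (Suc i)) \<omega> - W (\<tau> i) \<omega>)) {..<n}"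
    by (rule indep_vars_compose[OF indep_increments[OF \<tau>]]) simp
  then have "indep_vars (\<lambda>_. borel) (\<lambda>i \<omega>. c i * (W (\<tau> (Suc i)) \<omega> - W (\<tau> i) \<omega>)) {..<n}"
    by (simp add: comp_def)
  from char_distr_sum[OF this] have "char (distr M borel (step_integral n \<tau> c W)) \<theta> =
      (\<Prod>i<n. char (distr M borel (\<lambda>\<omega>. c i * (W (\<tau> (Suc i)) \<omega> - W (\<tau> i) \<omega>))) \<theta>)"
    unfolding step_integral_def[abs_def] .
  also have "\<dots> = (\<Prod>i<n. exp (complex_of_real (- (\<theta>\<^sup>2 * ((c i)\<^sup>2 * (\<tau> (Suc i) - \<tau> i))) / 2)))"
    using * by (intro prod.cong refl) (simp only: lessThan_iff char_increment exp_of_real)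
  also have "\<dots> = exp (\<Sum>i<n. complex_of_real (- (\<theta>\<^sup>2 * ((c i)\<^sup>2 * (\<tau> (Suc i) - \<tau> i))) / 2))"
    by (simp add: exp_sum)
  also have "(\<Sum>i<n. complex_of_real (- (\<theta>\<^sup>2 * ((c i)\<^sup>2 * (\<tau> (Suc i) - \<tau> i))) / 2)) =
      complex_of_real (- (\<theta>\<^sup>2 * (\<Sum>i<n. (c i)\<^sup>2 * (\<tau> (Suc i) - \<tau> i))) / 2)"
    by (simp add: sum_distrib_left sum_negf sum_divide_distrib)
  finally show ?thesis
    by (simp add: integral_step_function_square[OF \<tau>(1)] flip: exp_of_real)
qed

section \<open>Independence of the past from later step integrals\<close>

definition past :: "real \<Rightarrow> 'a measure"
  where "past t = sigma (space M) {W s -` B \<inter> space M | s B. s \<in> {0..t} \<and> B \<in> sets borel}"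

lemma space_past [simp]: "space (past t) = space M"
  by (simp add: past_def space_measure_of_conv)

lemma sets_past: "sets (past t) = sigma_sets (space M) {W s -` B \<inter> space M | s B. s \<in> {0..t} \<and> B \<in> sets borel}"
  unfolding past_def by (rule sets_measure_of) auto

lemma measurable_past_W: "s \<in> {0..t} \<Longrightarrow> W s \<in> borel_measurable (past t)"
  by (rule measurableI) (auto simp: sets_past)

lemma subalgebra_past: "t \<le> 1 \<Longrightarrow> subalgebra M (past t)"
  unfolding subalgebra_def sets_past
  using measurable_sets[OF measurable_W] by (auto intro!: sets.sigma_sets_subset)

text \<open>Preimages at a single time are not closed under intersection, whereas cylinder sets over
  finitely many times are. This makes them the starting point of the pi-lambda argument.\<close>

lemma past_generator:
  "sets (past t) = sigma_sets (space M)
    {{\<omega>\<in>space M. \<forall>s\<in>J. W s \<omega> \<in> B s} | J B. finite J \<and> J \<subseteq> {0..t} \<and> (\<forall>s. B s \<in> sets borel)}"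
  (is "_ = sigma_sets _ ?G")
proof (rule antisym)
  show "sets (past t) \<subseteq> sigma_sets (space M) ?G"
    unfolding sets_past
  proof (rule sigma_sets_mono', safe)
    fix s B assume "s \<in> {0..t}" "B \<in> sets (borel :: real measure)"
    then show "\<exists>J B'. W s -` B \<inter> space M = {\<omega>\<in>space M. \<forall>s\<in>J. W s \<omega> \<in> B' s} \<and>
        finite J \<and> J \<subseteq> {0..t} \<and> (\<forall>s. B' s \<in> sets borel)"
      by (intro exI[of _ "{s}"] exI[of _ "\<lambda>_. B"]) auto
  qed
  show "sigma_sets (space M) ?G \<subseteq> sets (past t)"
  proof (rule sets.sigma_sets_subset[of _ "past t", unfolded space_past], safe)
    fix J and B :: "real \<Rightarrow> real set"
    assume J: "finite J" "J \<subseteq> {0..t}" and B: "\<forall>s. B s \<in> sets borel"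
    have "{\<omega>\<in>space (past t). \<forall>s\<in>J. W s \<omega> \<in> B s} \<in> sets (past t)"
    proof (rule sets.sets_Collect_finite_All[OF _ J(1)])
      fix s assume "s \<in> J"
      then have "W s \<in> borel_measurable (past t)" using J by (intro measurable_past_W) auto
      from measurable_sets[OF this, of "B s"] B show "{\<omega>\<in>space (past t). W s \<omega> \<in> B s} \<in> sets (past t)"
        by (auto simp: vimage_def Int_def conj_commute)
    qed
    then show "{\<omega>\<in>space M. \<forall>s\<in>J. W s \<omega> \<in> B s} \<in> sets (past t)" by simp
  qed
qed

text \<open>The times of the cylinder and the partition of the step integral are strung together
  into one partition. The cylinder depends on its early increments, the step integral on its late
  ones, and these two blocks are independent.\<close>

lemma prob_cylinder_step_integral:
  assumes J: "finite J" "J \<subseteq> {0..t}" and B: "\<And>s. B s \<in> sets borel"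
    and t: "0 \<le> t" "t \<le> 1"
    and \<tau>: "mono_on {..n} \<tau>" "\<tau> ` {..n} \<subseteq> {t..1}"
    and C: "C \<in> sets borel"
  shows "prob ({\<omega>\<in>space M. \<forall>s\<in>J. W s \<omega> \<in> B s} \<inter> (step_integral n \<tau> c W -` C \<inter> space M)) =
    prob {\<omega>\<in>space M. \<forall>s\<in>J. W s \<omega> \<in> B s} * prob (step_integral n \<tau> c W -` C \<inter> space M)"
proof -
  \<comment> \<open>With 0 inserted, the list is nonempty and starts at 0. As W vanishes at 0 almost
    surely, each earlier value of W is then a sum of increments.\<close>
  define xs where "xs = sorted_list_of_set (insert 0 J)"
  define m where "m = length xs - 1"
  have xs: "sorted xs" "set xs = insert 0 J"
    unfolding xs_def using J(1) by (simp_all only: sorted_sorted_list_of_set set_sorted_list_of_set finite_insert)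
  have len: "length xs = Suc m"
    using xs(2) by (cases xs) (auto simp: m_def)
  have xs_range: "xs ! i \<in> {0..t}" if "i \<le> m" for i
  proof -
    have "xs ! i \<in> set xs" using that len by simp
    then show ?thesis using xs(2) J(2) t by auto
  qed
  have xs0: "xs ! 0 = 0"
  proof -
    obtain k where k: "k < length xs" "xs ! k = 0"
      using xs(2) by (metis in_set_conv_nth insertI1)
    have "xs ! 0 \<le> xs ! k" using k xs(1) by (intro sorted_nth_mono) auto
    with k(2) xs_range[of 0] show ?thesis by auto
  qed
  \<comment> \<open>Indices 0, ..., m run through the past times and Suc m, ..., N through the n + 1
    points of \<tau>.\<close>
  define \<sigma> where "\<sigma> i = (if i \<le> m then xs ! i else \<tau> (i - Suc m))" for i
  define N where "N = Suc m + n"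
  have \<tau>_range: "\<tau> i \<in> {t..1}" if "i \<le> n" for i using \<tau>(2) that by auto
  have \<sigma>_mono: "mono_on {..N} \<sigma>"
  proof (rule mono_onI)
    fix i j assume ij: "i \<in> {..N}" "j \<in> {..N}" "i \<le> j"
    consider "j \<le> m" | "i \<le> m" "m < j" | "m < i" by linarith
    then show "\<sigma> i \<le> \<sigma> j"
    proof cases
      case 1
      then show ?thesis using ij xs(1) len by (auto simp: \<sigma>_def intro: sorted_nth_mono)
    next
      case 2
      then have "j - Suc m \<le> n" using ij by (auto simp: N_def)
      with 2 show ?thesis using ij xs_range[of i] \<tau>_range[of "j - Suc m"] by (auto simp: \<sigma>_def N_def)
    next
      case 3
      then show ?thesis using ij \<tau>(1) by (auto simp: \<sigma>_def N_def intro!: mono_onD[OF \<tau>(1)])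
    qed
  qed
  have "\<sigma> i \<in> {0..1}" if "i \<le> N" for i
  proof (cases "i \<le> m")
    case False
    then have "i - Suc m \<le> n" using that by (auto simp: N_def)
    with False show ?thesis using \<tau>_range[of "i - Suc m"] t by (auto simp: \<sigma>_def)
  qed (use xs_range[of i] t in \<open>auto simp: \<sigma>_def\<close>)
  then have \<sigma>_range: "\<sigma> ` {..N} \<subseteq> {0..1}" by auto
  define X where "X i \<omega> = W (\<sigma> (Suc i)) \<omega> - W (\<sigma> i) \<omega>" for i \<omega>
  \<comment> \<open>Increment number m bridges the gap from the last past time to
    \<open>\<tau> 0\<close>; it belongs to neither block.\<close>
  let ?A = "{..<m}" and ?B = "{Suc m..<N}"
  have "indep_vars (\<lambda>_. borel) X {..<N}"
    unfolding X_def[abs_def] by (rule indep_increments[OF \<sigma>_mono \<sigma>_range])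
  then have ind: "indep_var (Pi\<^sub>M ?A (\<lambda>_. borel)) (\<lambda>\<omega>. \<lambda>i\<in>?A. X i \<omega>) (Pi\<^sub>M ?B (\<lambda>_. borel)) (\<lambda>\<omega>. \<lambda>i\<in>?B. X i \<omega>)"
    by (rule indep_var_restrict) (auto simp: N_def)
  \<comment> \<open>The inserted time 0 may lie outside J and must then impose no condition.\<close>
  define B' where "B' s = (if s \<in> J then B s else UNIV)" for s
  have B': "B' s \<in> sets borel" for s using B by (simp add: B'_def)
  define F :: "(nat \<Rightarrow> real) \<Rightarrow> real" where
    "F x = indicator {x\<in>space (Pi\<^sub>M ?A (\<lambda>_. borel)). \<forall>i\<in>{..m}. (\<Sum>j<i. x j) \<in> B' (xs ! i)} x" for x
  define G :: "(nat \<Rightarrow> real) \<Rightarrow> real" where "G x = (\<Sum>i<n. c i * x (Suc m + i))" for x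
  have F: "F \<in> borel_measurable (Pi\<^sub>M ?A (\<lambda>_. borel))"
    unfolding F_def[abs_def]
  proof (rule borel_measurable_indicator, rule sets.sets_Collect_finite_All)
    fix i assume "i \<in> {..m}"
    then have "(\<lambda>x. \<Sum>j<i. x j :: real) \<in> borel_measurable (Pi\<^sub>M ?A (\<lambda>_. borel))"
      by (intro borel_measurable_sum measurable_component_singleton) auto
    from measurable_sets[OF this B'[of "xs ! i"]]
    show "{x \<in> space (Pi\<^sub>M ?A (\<lambda>_. borel)). (\<Sum>j<i. x j) \<in> B' (xs ! i)} \<in> sets (Pi\<^sub>M ?A (\<lambda>_. borel))"
      by (simp add: vimage_def Int_def conj_commute)
  qed simp
  have G: "G \<in> borel_measurable (Pi\<^sub>M ?B (\<lambda>_. borel))"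
    unfolding G_def[abs_def]
    by (intro borel_measurable_sum borel_measurable_times measurable_component_singleton) (auto simp: N_def)
  define F' G' where "F' = F \<circ> (\<lambda>\<omega>. \<lambda>i\<in>?A. X i \<omega>)" and "G' = G \<circ> (\<lambda>\<omega>. \<lambda>i\<in>?B. X i \<omega>)"
  have ind': "indep_var borel F' borel G'"
    unfolding F'_def G'_def by (rule indep_var_compose[OF ind F G])
  have G'_eq: "G' \<omega> = step_integral n \<tau> c W \<omega>" for \<omega>
    unfolding G'_def G_def step_integral_def comp_def X_def
    by (intro sum.cong refl) (auto simp: N_def \<sigma>_def)
  have [measurable]: "F' \<in> borel_measurable M" "G' \<in> borel_measurable M"
    using ind' indep_var_rv1 indep_var_rv2 by blast+
  have F'_eq: "AE \<omega> in M. F' \<omega> = 1 \<longleftrightarrow> (\<forall>s\<in>J. W s \<omega> \<in> B s)"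
    using W_0
  proof eventually_elim
    case (elim \<omega>)
    have S: "(\<Sum>j<i. X j \<omega>) = W (xs ! i) \<omega>" if "i \<le> m" for i
    proof -
      have "(\<Sum>j<i. X j \<omega>) = (\<Sum>j<i. W (xs ! Suc j) \<omega> - W (xs ! j) \<omega>)"
        using that by (intro sum.cong refl) (auto simp: X_def \<sigma>_def)
      also have "\<dots> = W (xs ! i) \<omega> - W (xs ! 0) \<omega>" by (rule sum_lessThan_telescope)
      finally show ?thesis using elim by (simp add: xs0)
    qed
    have "F' \<omega> = 1 \<longleftrightarrow> (\<forall>i\<in>{..m}. (\<Sum>j<i. X j \<omega>) \<in> B' (xs ! i))"
      by (auto simp: F'_def F_def indicator_def space_PiM intro!: sum.cong)
    also have "\<dots> \<longleftrightarrow> (\<forall>i\<in>{..m}. W (xs ! i) \<omega> \<in> B' (xs ! i))" by (simp add: S)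
    also have "\<dots> \<longleftrightarrow> (\<forall>s\<in>set xs. W s \<omega> \<in> B' s)"
      using len by (auto simp: all_set_conv_all_nth less_Suc_eq_le)
    finally show ?case using xs(2) by (auto simp: B'_def)
  qed
  have [measurable]: "W s \<in> borel_measurable M" if "s \<in> J" for s
    using that J(2) t by (intro measurable_W) auto
  have [measurable]: "{\<omega>\<in>space M. \<forall>s\<in>J. W s \<omega> \<in> B s} \<in> sets M"
    using B by (intro sets.sets_Collect_finite_All J(1)) simp
  have "prob ((F' -` {1} \<inter> space M) \<inter> (G' -` C \<inter> space M)) = prob (F' -` {1} \<inter> space M) * prob (G' -` C \<inter> space M)"
    using indep_varD[OF ind', of "{1}" C] C by (simp add: vimage_def Int_def conj_ac)
  moreover have "prob (F' -` {1} \<inter> space M) = prob {\<omega>\<in>space M. \<forall>s\<in>J. W s \<omega> \<in> B s}"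
    by (intro finite_measure_eq_AE) (use F'_eq in auto)
  moreover have "prob ((F' -` {1} \<inter> space M) \<inter> (G' -` C \<inter> space M)) =
      prob ({\<omega>\<in>space M. \<forall>s\<in>J. W s \<omega> \<in> B s} \<inter> (G' -` C \<inter> space M))"
    using C by (intro finite_measure_eq_AE) (use F'_eq in auto)
  moreover have "G' = step_integral n \<tau> c W" by (rule ext) (rule G'_eq)
  ultimately show ?thesis by simp
qed

text \<open>Extends the product formula from cylinder sets to the whole past: both generating
  families are intersection-stable, so independence passes to the sigma-algebras they
  generate.\<close>

lemma indep_var_past_step_integral:
  assumes X: "X \<in> measurable (past t) S"
    and t: "0 \<le> t" "t \<le> 1"
    and \<tau>: "mono_on {..n} \<tau>" "\<tau> ` {..n} \<subseteq> {t..1}"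
  shows "indep_var S X borel (step_integral n \<tau> c W)"
proof (rule indep_varI)
  let ?Y = "step_integral n \<tau> c W"
  show [measurable]: "X \<in> measurable M S"
    using X subalgebra_past[OF t(2)] measurable_from_subalg by blast
  show [measurable]: "?Y \<in> borel_measurable M"
    using \<tau>(2) t by (intro measurable_step_integral) auto
  let ?G = "{{\<omega>\<in>space M. \<forall>s\<in>J. W s \<omega> \<in> B s} | J B. finite J \<and> J \<subseteq> {0..t} \<and> (\<forall>s. B s \<in> sets borel)}"
  let ?H = "{?Y -` C \<inter> space M | C. C \<in> sets borel}"
  have "indep_set ?G ?H"
  proof (rule indep_setI)
    show "?G \<subseteq> events"
      using past_generator[of t] subalgebra_past[OF t(2)] by (auto simp: subalgebra_def)
    show "?H \<subseteq> events" by auto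
  qed (use prob_cylinder_step_integral[OF _ _ _ t \<tau>] in blast)
  moreover have "Int_stable ?G"
  proof (rule Int_stableI, safe)
    fix J1 J2 and B1 B2 :: "real \<Rightarrow> real set"
    assume *: "finite J1" "J1 \<subseteq> {0..t}" "\<forall>s. B1 s \<in> sets borel" "finite J2" "J2 \<subseteq> {0..t}" "\<forall>s. B2 s \<in> sets borel"
    show "\<exists>J B. {\<omega>\<in>space M. \<forall>s\<in>J1. W s \<omega> \<in> B1 s} \<inter> {\<omega>\<in>space M. \<forall>s\<in>J2. W s \<omega> \<in> B2 s} =
        {\<omega>\<in>space M. \<forall>s\<in>J. W s \<omega> \<in> B s} \<and> finite J \<and> J \<subseteq> {0..t} \<and> (\<forall>s. B s \<in> sets borel)"
      by (rule exI[of _ "J1 \<union> J2"],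
          rule exI[of _ "\<lambda>s. (if s \<in> J1 then B1 s else UNIV) \<inter> (if s \<in> J2 then B2 s else UNIV)"])
        (use * in \<open>auto split: if_splits\<close>)
  qed
  moreover have "Int_stable ?H"
  proof (rule Int_stableI, safe)
    fix C D :: "real set" assume "C \<in> sets borel" "D \<in> sets borel"
    then show "\<exists>E. ?Y -` C \<inter> space M \<inter> (?Y -` D \<inter> space M) = ?Y -` E \<inter> space M \<and> E \<in> sets borel"
      by (intro exI[of _ "C \<inter> D"]) auto
  qed
  ultimately have "indep_set (sigma_sets (space M) ?G) (sigma_sets (space M) ?H)"
    by (rule indep_set_sigma_sets)
  then have "indep_set (sets (past t)) (sigma_sets (space M) ?H)"
    by (simp add: past_generator)
  moreover fix A B assume "A \<in> sets S" and B: "B \<in> sets (borel :: real measure)"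
  then have "X -` A \<inter> space M \<in> sets (past t)"
    using measurable_sets[OF X, of A] by simp
  ultimately show "prob ((X -` A \<inter> space M) \<inter> (?Y -` B \<inter> space M)) = prob (X -` A \<inter> space M) * prob (?Y -` B \<inter> space M)"
    using B by (intro indep_setD[where B = "sigma_sets (space M) ?H"]) auto
qed

end

section \<open>Wiener integrals\<close>

lemma measurable_step_function [measurable]: "step_function n \<tau> c \<in> borel_measurable borel"
  unfolding step_function_def[abs_def] by measurable

text \<open>A partition is cut at t by clamping its points from above and from below. The clamped
  partitions keep the index set and the coefficients; the identity is W(u) = W(min u t) + W(max u t)
  - W(t).\<close>

lemma step_integral_split:
  "step_integral n \<tau> c W \<omega> =
    step_integral n (\<lambda>i. min (\<tau> i) t) c W \<omega> + step_integral n (\<lambda>i. max (\<tau> i) t) c W \<omega>"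
proof -
  have "W u \<omega> = W (min u t) \<omega> + W (max u t) \<omega> - W t \<omega>" for u
    by (cases "u \<le> t") (auto simp: min_def max_def)
  then have "W v \<omega> - W u \<omega> = W (min v t) \<omega> - W (min u t) \<omega> + (W (max v t) \<omega> - W (max u t) \<omega>)" for u v
    by (smt (verit))
  then show ?thesis
    unfolding step_integral_def sum.distrib[symmetric] distrib_left[symmetric] by metis
qed

lemma step_function_min:
  "step_function n (\<lambda>i. min (\<tau> i) t) c s = indicator {..t} s * step_function n \<tau> c s"
  unfolding step_function_def sum_distrib_left by (intro sum.cong refl) (auto simp: indicator_def)

lemma step_function_max:
  "step_function n (\<lambda>i. max (\<tau> i) t) c s = indicator {t<..} s * step_function n \<tau> c s"
  unfolding step_function_def sum_distrib_left by (intro sum.cong refl) (auto simp: indicator_def)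

lemma step_function_eq_0:
  "\<tau> ` {..n} \<subseteq> {a..b} \<Longrightarrow> s \<notin> {a<..b} \<Longrightarrow> step_function n \<tau> c s = 0"
proof -
  assume \<tau>: "\<tau> ` {..n} \<subseteq> {a..b}" and s: "s \<notin> {a<..b}"
  have "\<tau> i \<ge> a \<and> \<tau> (Suc i) \<le> b" if "i < n" for i using \<tau> that by (auto simp: image_subset_iff)
  then show ?thesis
    using s unfolding step_function_def by (intro sum.neutral) (force simp: indicator_def)
qed

lemma tendsto_0_ennreal_le:
  fixes u v :: "nat \<Rightarrow> ennreal"
  assumes "v \<longlonglongrightarrow> 0" "\<And>k. u k \<le> v k"
  shows "u \<longlonglongrightarrow> 0"
  by (rule tendsto_sandwich[OF _ _ tendsto_const assms(1)]) (auto simp: assms(2))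

lemma is_wiener_integralE:
  assumes "is_wiener_integral M W t f I"
  obtains n :: "nat \<Rightarrow> nat" and \<tau> c where
    "\<And>k. mono_on {..n k} (\<tau> k)" "\<And>k. \<tau> k ` {..n k} \<subseteq> {0..t}"
    "(\<lambda>k. \<integral>\<^sup>+s\<in>{0..t}. ennreal ((f s - step_function (n k) (\<tau> k) (c k) s)\<^sup>2) \<partial>lborel) \<longlonglongrightarrow> 0"
    "(\<lambda>k. \<integral>\<^sup>+\<omega>. ennreal ((I \<omega> - step_integral (n k) (\<tau> k) (c k) W \<omega>)\<^sup>2) \<partial>M) \<longlonglongrightarrow> 0"
    "I \<in> borel_measurable M" "(\<lambda>s. indicator {0..t} s * f s) \<in> borel_measurable lborel"
  using assms unfolding is_wiener_integral_def set_borel_measurable_def real_scaleR_def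
  by (elim conjE exE) (rule that, auto)

context brownian begin

text \<open>Every approximating step integral uses times up to s only. Since \<open>past t\<close>
  is not completed, its L^2 limit is merely almost surely equal to a past-measurable function,
  namely the pointwise \<open>lim\<close> of an almost surely convergent subsequence.\<close>

lemma wiener_integral_past:
  assumes I: "is_wiener_integral M W s f I" and s: "0 \<le> s" "s \<le> t" "t \<le> 1"
  shows "\<exists>I'\<in>borel_measurable (past t). AE \<omega> in M. I \<omega> = I' \<omega>"
proof -
  obtain n \<tau> c where \<tau>: "\<And>k. \<tau> k ` {..n k} \<subseteq> {0..s}"
    and lim: "(\<lambda>k. \<integral>\<^sup>+\<omega>. ennreal ((I \<omega> - step_integral (n k) (\<tau> k) (c k) W \<omega>)\<^sup>2) \<partial>M) \<longlonglongrightarrow> 0"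
    and [measurable]: "I \<in> borel_measurable M"
    by (rule is_wiener_integralE[OF I]) (rule that; assumption)
  let ?S = "\<lambda>k. step_integral (n k) (\<tau> k) (c k) W"
  have past: "?S k \<in> borel_measurable (past t)" for k
    unfolding step_integral_def[abs_def]
  proof (intro borel_measurable_sum borel_measurable_times borel_measurable_diff measurable_past_W borel_measurable_const)
    fix i assume "i \<in> {..<n k}"
    then have "\<tau> k i \<in> {0..s}" "\<tau> k (Suc i) \<in> {0..s}" using \<tau>[of k] by (auto simp: image_subset_iff)
    then show "\<tau> k i \<in> {0..t}" "\<tau> k (Suc i) \<in> {0..t}" using s by auto
  qed
  then have [measurable]: "?S k \<in> borel_measurable M" for k
    using subalgebra_past[OF s(3)] measurable_from_subalg by blast
  obtain r where r: "AE \<omega> in M. (\<lambda>k. ?S (r k) \<omega>) \<longlonglongrightarrow> I \<omega>"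
    using L2_tendsto_AE_subseq[OF _ _ lim] by auto
  show ?thesis
  proof (rule bexI)
    show "AE \<omega> in M. I \<omega> = lim (\<lambda>k. ?S (r k) \<omega>)"
      using r by eventually_elim (simp add: limI)
    show "(\<lambda>\<omega>. lim (\<lambda>k. ?S (r k) \<omega>)) \<in> borel_measurable (past t)"
      by (rule borel_measurable_lim_metric) (rule past)
  qed
qed

lemma step_integral_isometry:
  fixes \<rho> :: real
  assumes \<tau>: "mono_on {..n} \<tau>" "\<tau> ` {..n} \<subseteq> {0..1}"
    and \<tau>': "mono_on {..n'} \<tau>'" "\<tau>' ` {..n'} \<subseteq> {0..1}"
  shows "(\<integral>\<^sup>+\<omega>. ennreal ((step_integral n' \<tau>' c' W \<omega> - \<rho> * step_integral n \<tau> c W \<omega>)\<^sup>2) \<partial>M) =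
    (\<integral>\<^sup>+s. ennreal ((step_function n' \<tau>' c' s - \<rho> * step_function n \<tau> c s)\<^sup>2) \<partial>lborel)"
proof -
  \<comment> \<open>The disjoint union of the index sets carries the difference of both step
    functions as a single family of intervals, with coefficients - \<rho> c on the second
    summand.\<close>
  let ?J = "{..<n'} <+> {..<n}"
  let ?a = "case_sum \<tau>' \<tau>" and ?b = "case_sum (\<lambda>i. \<tau>' (Suc i)) (\<lambda>i. \<tau> (Suc i))"
    and ?c = "case_sum c' (\<lambda>i. - \<rho> * c i)"
  have *: "i < n \<Longrightarrow> 0 \<le> \<tau> i \<and> \<tau> i \<le> \<tau> (Suc i) \<and> \<tau> (Suc i) \<le> 1"
    "i < n' \<Longrightarrow> 0 \<le> \<tau>' i \<and> \<tau>' i \<le> \<tau>' (Suc i) \<and> \<tau>' (Suc i) \<le> 1" for i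
    using \<tau> \<tau>' by (auto simp: mono_on_def image_subset_iff)
  have "(\<integral>\<^sup>+\<omega>. ennreal ((\<Sum>j\<in>?J. ?c j * (W (?b j) \<omega> - W (?a j) \<omega>))\<^sup>2) \<partial>M) =
      (\<integral>\<^sup>+s. ennreal ((\<Sum>j\<in>?J. ?c j * indicator {?a j<..?b j} s)\<^sup>2) \<partial>lborel)"
    by (rule increments_isometry) (use * in auto)
  moreover have "(\<Sum>j\<in>?J. g j) = (\<Sum>i<n'. g (Inl i)) + (\<Sum>i<n. g (Inr i))" for g :: "nat + nat \<Rightarrow> real"
    by (simp add: sum.Plus)
  moreover have "(\<Sum>i<n. - \<rho> * c i * z i) = - (\<rho> * (\<Sum>i<n. c i * z i))" for z
    by (simp add: sum_distrib_left sum_negf mult.assoc)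
  ultimately show ?thesis
    by (simp only: step_integral_def step_function_def sum.case minus_mult_left[symmetric]) simp
qed

text \<open>The relation f' = \<rho> f up to time t removes the past from I'. The approximants of I'
  are cut at t. Their lower parts and \<rho> times the approximants of I tend to the same integrand,
  so by the isometry the lower parts tend to \<rho> I. What remains are the upper parts, built from
  increments after t; the last conclusion identifies the limit of their variances.\<close>

lemma wiener_increment_approx:
  assumes t: "0 \<le> t" "t < t'" "t' \<le> 1"
    and I: "is_wiener_integral M W t f I" and I': "is_wiener_integral M W t' f' I'"
    and ff': "\<And>s. s \<in> {0..t} \<Longrightarrow> f' s = \<rho> * f s"
    and sq: "integrable lborel (\<lambda>s. (indicator {t<..t'} s * f' s)\<^sup>2)"
  obtains n :: "nat \<Rightarrow> nat" and \<tau> c where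
    "\<And>k. mono_on {..n k} (\<tau> k)" "\<And>k. \<tau> k ` {..n k} \<subseteq> {t..1}"
    "(\<lambda>k. \<integral>\<^sup>+\<omega>. ennreal ((I' \<omega> - \<rho> * I \<omega> - step_integral (n k) (\<tau> k) (c k) W \<omega>)\<^sup>2) \<partial>M) \<longlonglongrightarrow> 0"
    "(\<lambda>k. LINT s|lborel. (step_function (n k) (\<tau> k) (c k) s)\<^sup>2) \<longlonglongrightarrow> (LINT s|lborel. (indicator {t<..t'} s * f' s)\<^sup>2)"
proof -
  obtain n \<tau> c where \<tau>: "\<And>k. mono_on {..n k} (\<tau> k)" "\<And>k. \<tau> k ` {..n k} \<subseteq> {0..t}"
    and f_lim: "(\<lambda>k. \<integral>\<^sup>+s\<in>{0..t}. ennreal ((f s - step_function (n k) (\<tau> k) (c k) s)\<^sup>2) \<partial>lborel) \<longlonglongrightarrow> 0"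
    and I_lim: "(\<lambda>k. \<integral>\<^sup>+\<omega>. ennreal ((I \<omega> - step_integral (n k) (\<tau> k) (c k) W \<omega>)\<^sup>2) \<partial>M) \<longlonglongrightarrow> 0"
    and I_meas [measurable]: "I \<in> borel_measurable M"
    and f_meas [measurable]: "(\<lambda>s. indicator {0..t} s * f s) \<in> borel_measurable lborel"
    by (rule is_wiener_integralE[OF I]) (rule that; assumption)
  obtain n' \<tau>' c' where \<tau>': "\<And>k. mono_on {..n' k} (\<tau>' k)" "\<And>k. \<tau>' k ` {..n' k} \<subseteq> {0..t'}"
    and f'_lim: "(\<lambda>k. \<integral>\<^sup>+s\<in>{0..t'}. ennreal ((f' s - step_function (n' k) (\<tau>' k) (c' k) s)\<^sup>2) \<partial>lborel) \<longlonglongrightarrow> 0"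
    and I'_lim: "(\<lambda>k. \<integral>\<^sup>+\<omega>. ennreal ((I' \<omega> - step_integral (n' k) (\<tau>' k) (c' k) W \<omega>)\<^sup>2) \<partial>M) \<longlonglongrightarrow> 0"
    and I'_meas [measurable]: "I' \<in> borel_measurable M"
    and f'm [measurable]: "(\<lambda>s. indicator {0..t'} s * f' s) \<in> borel_measurable lborel"
    by (rule is_wiener_integralE[OF I']) (rule that; assumption)
  let ?S = "\<lambda>k. step_integral (n k) (\<tau> k) (c k) W"
  let ?\<phi> = "\<lambda>k. step_function (n k) (\<tau> k) (c k)"
  let ?S' = "\<lambda>k. step_integral (n' k) (\<tau>' k) (c' k) W"
  let ?\<phi>' = "\<lambda>k. step_function (n' k) (\<tau>' k) (c' k)"
  let ?lo = "\<lambda>k i. min (\<tau>' k i) t" and ?up = "\<lambda>k i. max (\<tau>' k i) t"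
  let ?L = "\<lambda>k. step_integral (n' k) (?lo k) (c' k) W"
  let ?U = "\<lambda>k. step_integral (n' k) (?up k) (c' k) W"
  have mono: "mono_on {..n' k} (?lo k)" "mono_on {..n' k} (?up k)" for k
    using \<tau>'(1)[of k] unfolding mono_on_def by (auto intro: min.coboundedI1 max.coboundedI1)
  have range: "?lo k ` {..n' k} \<subseteq> {0..t}" "?up k ` {..n' k} \<subseteq> {t..t'}" for k
    using \<tau>'(2)[of k] t by (auto simp: image_subset_iff)
  have range1: "\<tau> k ` {..n k} \<subseteq> {0..1}" "\<tau>' k ` {..n' k} \<subseteq> {0..1}" "?lo k ` {..n' k} \<subseteq> {0..1}"
    "?up k ` {..n' k} \<subseteq> {0..1}" for k
    using \<tau>(2)[of k] \<tau>'(2)[of k] range[of k] t by force+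
  have [measurable]: "?S k \<in> borel_measurable M" "?S' k \<in> borel_measurable M"
    "?L k \<in> borel_measurable M" "?U k \<in> borel_measurable M" for k
    using range1[of k] by (auto intro: measurable_step_integral)
  have ind: "indicator {t<..t'} s = indicator {t<..t'} s * (indicator {0..t'} s :: real)"
    "indicator {0..t} s = indicator {0..t} s * (indicator {0..t'} s :: real)" for s
    using t by (auto simp: indicator_def)
  have f'm1 [measurable]: "(\<lambda>s. indicator {t<..t'} s * f' s) \<in> borel_measurable lborel"
    by (subst ind(1)) (unfold mult.assoc, measurable)
  have f'm2 [measurable]: "(\<lambda>s. indicator {0..t} s * f' s) \<in> borel_measurable lborel"
    by (subst ind(2)) (unfold mult.assoc, measurable)
  have up_lim: "(\<lambda>k. \<integral>\<^sup>+s. ennreal ((indicator {t<..t'} s * f' s - step_function (n' k) (?up k) (c' k) s)\<^sup>2) \<partial>lborel) \<longlonglongrightarrow> 0"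
  proof (rule tendsto_0_ennreal_le[OF f'_lim], rule nn_integral_mono)
    fix k s
    have "step_function (n' k) (?up k) (c' k) s = 0" if "s \<notin> {t<..t'}"
      using range(2) that by (rule step_function_eq_0)
    then show "ennreal ((indicator {t<..t'} s * f' s - step_function (n' k) (?up k) (c' k) s)\<^sup>2)
        \<le> ennreal ((f' s - ?\<phi>' k s)\<^sup>2) * indicator {0..t'} s"
      using t by (cases "s \<in> {t<..t'}") (auto simp: step_function_max)
  qed
  \<comment> \<open>The isometry moves the comparison to integrands on [0, t], where both step
    functions are close to f' = \<rho> f.\<close>
  have lo_lim: "(\<lambda>k. \<integral>\<^sup>+\<omega>. ennreal ((?L k \<omega> - \<rho> * ?S k \<omega>)\<^sup>2) \<partial>M) \<longlonglongrightarrow> 0"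
  proof -
    let ?g = "\<lambda>k s. indicator {0..t} s * (?\<phi>' k s)"
    let ?h = "\<lambda>s. indicator {0..t} s * f' s"
    have eq: "(\<integral>\<^sup>+\<omega>. ennreal ((?L k \<omega> - \<rho> * ?S k \<omega>)\<^sup>2) \<partial>M) =
        (\<integral>\<^sup>+s. ennreal ((?g k s - \<rho> * (indicator {0..t} s * ?\<phi> k s))\<^sup>2) \<partial>lborel)" for k
    proof -
      have "step_function (n' k) (?lo k) (c' k) s = ?g k s" for s
      proof (cases "s \<in> {0<..t}")
        case False
        then have "step_function (n' k) (?lo k) (c' k) s = 0" by (rule step_function_eq_0[OF range(1)])
        moreover have "?\<phi>' k s = 0 \<or> s > t" if "s \<ge> 0"
          using False that by (cases "s = 0") (auto intro!: step_function_eq_0[OF \<tau>'(2)])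
        ultimately show ?thesis by (auto simp: indicator_def)
      qed (auto simp: step_function_min)
      moreover have "?\<phi> k s = indicator {0..t} s * ?\<phi> k s" for s
        using step_function_eq_0[OF \<tau>(2), of s k] by (cases "s \<in> {0<..t}") auto
      ultimately show ?thesis
        by (subst step_integral_isometry[OF \<tau>(1) range1(1) mono(1) range1(3)],
            intro nn_integral_cong arg_cong[where f = "\<lambda>x. ennreal (x\<^sup>2)"]) metis
    qed
    have 1: "(\<lambda>k. \<integral>\<^sup>+s. ennreal ((?h s - ?g k s)\<^sup>2) \<partial>lborel) \<longlonglongrightarrow> 0"
      by (rule tendsto_0_ennreal_le[OF f'_lim], rule nn_integral_mono) (use t in \<open>auto simp: indicator_def\<close>)
    have 2: "(\<lambda>k. \<integral>\<^sup>+s. ennreal ((?h s - \<rho> * (indicator {0..t} s * ?\<phi> k s))\<^sup>2) \<partial>lborel) \<longlonglongrightarrow> 0"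
    proof -
      have "(\<integral>\<^sup>+s. ennreal ((?h s - \<rho> * (indicator {0..t} s * ?\<phi> k s))\<^sup>2) \<partial>lborel) =
          ennreal (\<rho>\<^sup>2) * (\<integral>\<^sup>+s\<in>{0..t}. ennreal ((f s - ?\<phi> k s)\<^sup>2) \<partial>lborel)" for k
      proof -
        have "ennreal ((?h s - \<rho> * (indicator {0..t} s * ?\<phi> k s))\<^sup>2) =
            ennreal (\<rho>\<^sup>2) * ennreal ((indicator {0..t} s * f s - indicator {0..t} s * ?\<phi> k s)\<^sup>2)" for s
          using ff'[of s] by (auto simp: indicator_def ennreal_mult'[symmetric] power_mult_distrib[symmetric] right_diff_distrib)
        moreover have "(\<integral>\<^sup>+s\<in>{0..t}. ennreal ((f s - ?\<phi> k s)\<^sup>2) \<partial>lborel) =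
            (\<integral>\<^sup>+s. ennreal ((indicator {0..t} s * f s - indicator {0..t} s * ?\<phi> k s)\<^sup>2) \<partial>lborel)"
          by (intro nn_integral_cong) (auto simp: indicator_def)
        ultimately show ?thesis by (simp add: nn_integral_cmult)
      qed
      then show ?thesis
        using ennreal_tendsto_cmult[OF _ f_lim, of "ennreal (\<rho>\<^sup>2)"] by simp
    qed
    have "(\<lambda>k. 2 * (\<integral>\<^sup>+s. ennreal ((?g k s - ?h s)\<^sup>2) \<partial>lborel) +
        2 * (\<integral>\<^sup>+s. ennreal ((?h s - \<rho> * (indicator {0..t} s * ?\<phi> k s))\<^sup>2) \<partial>lborel)) \<longlonglongrightarrow> 0"
      using tendsto_add[OF ennreal_tendsto_cmult[OF _ 1, of 2] ennreal_tendsto_cmult[OF _ 2, of 2]]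
      by (simp add: power2_commute)
    then show ?thesis
      by (rule tendsto_0_ennreal_le) (unfold eq, rule L2_triangle, auto)
  qed
  have S_lim: "(\<lambda>k. \<integral>\<^sup>+\<omega>. ennreal ((\<rho> * I \<omega> - \<rho> * ?S k \<omega>)\<^sup>2) \<partial>M) \<longlonglongrightarrow> 0"
  proof -
    have "(\<integral>\<^sup>+\<omega>. ennreal ((\<rho> * I \<omega> - \<rho> * ?S k \<omega>)\<^sup>2) \<partial>M) =
        ennreal (\<rho>\<^sup>2) * (\<integral>\<^sup>+\<omega>. ennreal ((I \<omega> - ?S k \<omega>)\<^sup>2) \<partial>M)" for k
      by (simp add: ennreal_mult'[symmetric] nn_integral_cmult[symmetric]
          power_mult_distrib[symmetric] right_diff_distrib)
    then show ?thesis
      using ennreal_tendsto_cmult[OF _ I_lim, of "ennreal (\<rho>\<^sup>2)"] by simp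
  qed
  have 1: "(\<lambda>k. \<integral>\<^sup>+\<omega>. ennreal ((\<rho> * I \<omega> - ?L k \<omega>)\<^sup>2) \<partial>M) \<longlonglongrightarrow> 0"
    by (rule L2_tendsto_trans[OF _ _ _ S_lim]) (use lo_lim in \<open>auto simp: power2_commute\<close>)
  have 2: "(\<lambda>k. \<integral>\<^sup>+\<omega>. ennreal ((I' \<omega> - \<rho> * I \<omega> - ?U k \<omega>)\<^sup>2) \<partial>M) \<longlonglongrightarrow> 0"
  proof -
    \<comment> \<open>Here \<open>?S'\<close> splits as \<open>?L\<close> + \<open>?U\<close>, so
      its distance to \<rho> I + \<open>?U\<close> is that of \<open>?L\<close> to \<rho> I.\<close>
    have "(\<lambda>k. 2 * (\<integral>\<^sup>+\<omega>. ennreal ((I' \<omega> - ?S' k \<omega>)\<^sup>2) \<partial>M) +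
        2 * (\<integral>\<^sup>+\<omega>. ennreal ((?S' k \<omega> - (\<rho> * I \<omega> + ?U k \<omega>))\<^sup>2) \<partial>M)) \<longlonglongrightarrow> 0"
      using tendsto_add[OF ennreal_tendsto_cmult[OF _ I'_lim, of 2] ennreal_tendsto_cmult[OF _ 1, of 2]]
      by (simp add: step_integral_split[where \<tau> = "\<tau>' _" and t = t] power2_commute)
    then show ?thesis
      unfolding diff_diff_eq by (rule tendsto_0_ennreal_le) (rule L2_triangle, auto)
  qed
  show thesis
  proof (rule that[OF mono(2) _ 2])
    show "?up k ` {..n' k} \<subseteq> {t..1}" for k using range(2)[of k] t(3) by force
    show "(\<lambda>k. LINT s|lborel. (step_function (n' k) (?up k) (c' k) s)\<^sup>2) \<longlonglongrightarrow>
        (LINT s|lborel. (indicator {t<..t'} s * f' s)\<^sup>2)"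
      by (rule L2_norm_tendsto[OF f'm1 _ up_lim sq])
        (auto simp: integral_step_function_square(1)[OF mono(2)])
  qed
qed

section \<open>Law of a standardized Wiener increment given the past\<close>

context
  fixes t t' \<rho> \<sigma> :: real and f f' :: "real \<Rightarrow> real" and I I' increment :: "'a \<Rightarrow> real"
  assumes t: "0 \<le> t" "t < t'" "t' \<le> 1"
    and I: "is_wiener_integral M W t f I" and I': "is_wiener_integral M W t' f' I'"
    and ff': "\<And>s. s \<in> {0..t} \<Longrightarrow> f' s = \<rho> * f s"
    and sq: "integrable lborel (\<lambda>s. (indicator {t<..t'} s * f' s)\<^sup>2)"
    and \<sigma>: "\<sigma> > 0" "(LINT s|lborel. (indicator {t<..t'} s * f' s)\<^sup>2) = \<sigma>\<^sup>2"
    and increment_eq: "increment = (\<lambda>\<omega>. (I' \<omega> - \<rho> * I \<omega>) / \<sigma>)"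
begin

lemma measurable_increment [measurable]: "increment \<in> borel_measurable M"
proof -
  have [measurable]: "I \<in> borel_measurable M" "I' \<in> borel_measurable M"
    using I I' by (auto simp: is_wiener_integral_def)
  show ?thesis unfolding increment_eq by measurable
qed

lemma past_in_events: "A \<in> sets (past t) \<Longrightarrow> A \<in> events"
  using subalgebra_past[of t] t by (auto simp: subalgebra_def)

text \<open>For the approximating step integrals, independence of A and the Gaussian characteristic
  function are exact. Both sides then converge: the left by dominated convergence along an almost
  sure subsequence, the right because the variances converge to \<sigma>^2.\<close>

lemma iexp_increment_past:
  assumes A: "A \<in> sets (past t)"
  shows "(CLINT \<omega>|M. complex_of_real (indicator A \<omega>) * iexp (\<theta> * increment \<omega>)) = prob A * exp (- (\<theta>\<^sup>2) / 2)"
proof -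
  obtain n \<tau> c where \<tau>: "\<And>k. mono_on {..n k} (\<tau> k)" "\<And>k. \<tau> k ` {..n k} \<subseteq> {t..1}"
    and lim: "(\<lambda>k. \<integral>\<^sup>+\<omega>. ennreal ((I' \<omega> - \<rho> * I \<omega> - step_integral (n k) (\<tau> k) (c k) W \<omega>)\<^sup>2) \<partial>M) \<longlonglongrightarrow> 0"
    and norm_lim: "(\<lambda>k. LINT s|lborel. (step_function (n k) (\<tau> k) (c k) s)\<^sup>2) \<longlonglongrightarrow> \<sigma>\<^sup>2"
    using wiener_increment_approx[OF t I I' ff' sq] unfolding \<sigma>(2) by blast
  let ?U = "\<lambda>k. step_integral (n k) (\<tau> k) (c k) W"
  let ?V = "\<lambda>k. LINT s|lborel. (step_function (n k) (\<tau> k) (c k) s)\<^sup>2"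
  have \<tau>1: "\<tau> k ` {..n k} \<subseteq> {0..1}" for k using \<tau>(2)[of k] t by force
  have [measurable]: "?U k \<in> borel_measurable M" for k using \<tau>1 by (rule measurable_step_integral)
  have [measurable]: "I \<in> borel_measurable M" "I' \<in> borel_measurable M"
    using I I' by (auto simp: is_wiener_integral_def)
  have [measurable]: "A \<in> events" using A by (rule past_in_events)
  obtain r where r: "strict_mono r" "AE \<omega> in M. (\<lambda>k. ?U (r k) \<omega>) \<longlonglongrightarrow> I' \<omega> - \<rho> * I \<omega>"
    using L2_tendsto_AE_subseq[OF _ _ lim] by auto
  \<comment> \<open>The step integrals approximate \<sigma> times \<open>increment\<close>, hence
    the rescaled frequency.\<close>
  define \<eta> where "\<eta> = \<theta> / \<sigma>"
  have eq: "(CLINT \<omega>|M. complex_of_real (indicator A \<omega>) * iexp (\<eta> * ?U k \<omega>)) = prob A * exp (- (\<eta>\<^sup>2 * ?V k) / 2)" for k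
  proof -
    have "(indicator A :: 'a \<Rightarrow> real) \<in> borel_measurable (past t)"
      using A by (rule borel_measurable_indicator)
    from indep_var_past_step_integral[OF this _ _ \<tau>] t
    have "indep_var borel (indicator A :: 'a \<Rightarrow> real) borel (?U k)" by auto
    then have "indep_var borel (complex_of_real \<circ> indicator A) borel ((\<lambda>x. iexp (\<eta> * x)) \<circ> ?U k)"
      by (rule indep_var_compose) auto
    then have "(CLINT \<omega>|M. complex_of_real (indicator A \<omega>) * iexp (\<eta> * ?U k \<omega>)) =
        (CLINT \<omega>|M. complex_of_real (indicator A \<omega>)) * (CLINT \<omega>|M. iexp (\<eta> * ?U k \<omega>))"
      unfolding comp_def
      by (intro indep_var_lebesgue_integral)
        (auto intro!: integrable_const_bound[where B = 1] simp: indicator_def)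
    also have "(CLINT \<omega>|M. iexp (\<eta> * ?U k \<omega>)) = char (distr M borel (?U k)) \<eta>"
      by (simp add: char_def integral_distr)
    also have "\<dots> = exp (- (\<eta>\<^sup>2 * ?V k) / 2)"
      by (rule char_step_integral[OF \<tau>(1) \<tau>1])
    also have "(CLINT \<omega>|M. complex_of_real (indicator A \<omega>)) = prob A"
      by simp
    finally show ?thesis by simp
  qed
  have "(\<lambda>k. CLINT \<omega>|M. complex_of_real (indicator A \<omega>) * iexp (\<eta> * ?U (r k) \<omega>)) \<longlonglongrightarrow>
      (CLINT \<omega>|M. complex_of_real (indicator A \<omega>) * iexp (\<eta> * (I' \<omega> - \<rho> * I \<omega>)))"
  proof (rule integral_dominated_convergence[where w = "\<lambda>_. 1"])
    show "AE \<omega> in M. (\<lambda>k. complex_of_real (indicator A \<omega>) * iexp (\<eta> * ?U (r k) \<omega>)) \<longlonglongrightarrow>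
        complex_of_real (indicator A \<omega>) * iexp (\<eta> * (I' \<omega> - \<rho> * I \<omega>))"
      using r(2) by eventually_elim (intro tendsto_intros)
    show "AE \<omega> in M. norm (complex_of_real (indicator A \<omega>) * iexp (\<eta> * ?U (r k) \<omega>)) \<le> 1" for k
      by (simp add: norm_mult indicator_def)
  qed simp_all
  moreover have "(\<lambda>k. complex_of_real (prob A * exp (- (\<eta>\<^sup>2 * ?V (r k)) / 2))) \<longlonglongrightarrow>
      complex_of_real (prob A * exp (- (\<eta>\<^sup>2 * \<sigma>\<^sup>2) / 2))"
    using LIMSEQ_subseq_LIMSEQ[OF norm_lim r(1)] unfolding comp_def by (intro tendsto_intros) auto
  ultimately have "(CLINT \<omega>|M. complex_of_real (indicator A \<omega>) * iexp (\<eta> * (I' \<omega> - \<rho> * I \<omega>))) =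
      complex_of_real (prob A * exp (- (\<eta>\<^sup>2 * \<sigma>\<^sup>2) / 2))"
    unfolding eq by (rule LIMSEQ_unique)
  then show ?thesis
    using \<sigma>(1) by (simp add: increment_eq \<eta>_def power_divide)
qed

text \<open>Conditioned on A, the increment has the standard normal characteristic function, so
  Levy's uniqueness theorem gives its conditional law. A null event admits no conditioning and is
  treated separately.\<close>

lemma prob_past_Int_increment:
  assumes A: "A \<in> sets (past t)" and B [measurable]: "B \<in> sets borel"
  shows "prob (A \<inter> (increment -` B \<inter> space M)) = prob A * measure std_normal_distribution B"
proof (cases "prob A = 0")
  case True
  have [measurable]: "A \<in> events" using A by (rule past_in_events)
  have "prob (A \<inter> (increment -` B \<inter> space M)) \<le> prob A"
    by (intro finite_measure_mono) auto
  then show ?thesis using True by (simp add: measure_le_0_iff)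
next
  case False
  have A' [measurable]: "A \<in> events" using A by (rule past_in_events)
  have pos: "prob A > 0" using False by (simp add: zero_less_measure_iff)
  let ?d = "\<lambda>\<omega>. indicator A \<omega> / prob A"
  let ?U = "density M (\<lambda>\<omega>. ennreal (?d \<omega>))"
  let ?N = "distr ?U borel increment"
  have em: "emeasure ?U E = ennreal (prob (A \<inter> E) / prob A)" if [measurable]: "E \<in> events" for E
  proof -
    have "emeasure ?U E = (\<integral>\<^sup>+\<omega>. ennreal (1 / prob A) * indicator (A \<inter> E) \<omega> \<partial>M)"
      by (subst emeasure_density) (auto intro!: nn_integral_cong simp: indicator_def)
    also have "\<dots> = ennreal (prob (A \<inter> E) / prob A)"
      using pos by (simp add: nn_integral_cmult_indicator emeasure_eq_measure ennreal_mult'[symmetric])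
    finally show ?thesis .
  qed
  have "prob_space ?U"
    by (rule prob_spaceI) (use em[OF sets.top] pos sets.sets_into_space[OF A'] in \<open>auto simp: Int_absorb2\<close>)
  then interpret U: prob_space ?U .
  have "real_distribution ?N"
    unfolding real_distribution_def real_distribution_axioms_def
    by (auto intro: U.prob_space_distr)
  moreover have "char ?N = char std_normal_distribution"
  proof
    fix \<theta>
    have "char ?N \<theta> = (CLINT \<omega>|M. ?d \<omega> *\<^sub>R iexp (\<theta> * increment \<omega>))"
      using pos by (simp add: char_def integral_distr integral_density)
    also have "\<dots> = (CLINT \<omega>|M. (1 / prob A) *\<^sub>R (complex_of_real (indicator A \<omega>) * iexp (\<theta> * increment \<omega>)))"
      by (intro Bochner_Integration.integral_cong) (auto simp: indicator_def scaleR_conv_of_real)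
    also have "\<dots> = exp (- (\<theta>\<^sup>2) / 2)"
      using pos by (simp only: integral_scaleR_right iexp_increment_past[OF A]) (simp add: scaleR_conv_of_real)
    finally show "char ?N \<theta> = char std_normal_distribution \<theta>"
      by (simp add: char_std_normal_distribution)
  qed
  ultimately have "?N = std_normal_distribution"
    by (intro Levy_uniqueness real_dist_normal_dist)
  moreover have "measure ?N B = prob (A \<inter> (increment -` B \<inter> space M)) / prob A"
    using em[of "increment -` B \<inter> space M"] by (simp add: measure_distr measure_def[of ?U])
  ultimately show ?thesis
    using pos by (simp add: field_simps)
qed

text \<open>The past-measurable copy X' and the increment have a product joint law, so Fubini
  integrates the increment out. X is allowed to agree with X' only almost surely because path values
  at grid times are versions of Wiener integrals.\<close>

lemma nn_integral_increment:
  assumes X: "X \<in> measurable M S" and X': "X' \<in> measurable (past t) S" "AE \<omega> in M. X \<omega> = X' \<omega>"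
    and g [measurable]: "g \<in> borel_measurable (S \<Otimes>\<^sub>M borel)"
  shows "(\<integral>\<^sup>+\<omega>. g (X \<omega>, increment \<omega>) \<partial>M) =
    (\<integral>\<^sup>+\<omega>. (\<integral>\<^sup>+y. g (X \<omega>, y) * ennreal (std_normal_density y) \<partial>lborel) \<partial>M)"
proof -
  note [measurable] = X
  have X'm [measurable]: "X' \<in> measurable M S"
    by (rule measurable_from_subalg[OF subalgebra_past X'(1)]) (use t in simp)
  have distr: "distr M borel increment = std_normal_distribution"
  proof (rule measure_eqI)
    fix B assume "B \<in> sets (distr M borel increment)"
    then have [measurable]: "B \<in> sets borel" by simp
    interpret N: real_distribution std_normal_distribution by (rule real_dist_normal_dist)
    have "space M \<in> sets (past t)" using sets.top[of "past t"] by simp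
    from prob_past_Int_increment[OF this, of B]
    have "prob (increment -` B \<inter> space M) = measure std_normal_distribution B"
      by (simp add: prob_space Int_absorb1)
    then show "emeasure (distr M borel increment) B = emeasure std_normal_distribution B"
      by (simp add: emeasure_distr emeasure_eq_measure N.emeasure_eq_measure)
  qed simp
  interpret N: real_distribution std_normal_distribution by (rule real_dist_normal_dist)
  interpret D: prob_space "distr M S X'" by (rule prob_space_distr) simp
  have joint: "distr M S X' \<Otimes>\<^sub>M std_normal_distribution = distr M (S \<Otimes>\<^sub>M borel) (\<lambda>\<omega>. (X' \<omega>, increment \<omega>))"
  proof (rule pair_measure_eqI)
    fix A B assume "A \<in> sets (distr M S X')" "B \<in> sets std_normal_distribution"
    then have [measurable]: "A \<in> sets S" "B \<in> sets borel" by auto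
    then have "X' -` A \<inter> space M \<in> sets (past t)"
      using measurable_sets[OF X'(1), of A] by simp
    from prob_past_Int_increment[OF this, of B]
    have "prob ((\<lambda>\<omega>. (X' \<omega>, increment \<omega>)) -` (A \<times> B) \<inter> space M) =
        prob (X' -` A \<inter> space M) * measure std_normal_distribution B"
      by (simp add: vimage_def Int_def conj_ac)
    then show "emeasure (distr M S X') A * emeasure std_normal_distribution B =
        emeasure (distr M (S \<Otimes>\<^sub>M borel) (\<lambda>\<omega>. (X' \<omega>, increment \<omega>))) (A \<times> B)"
      by (simp add: emeasure_distr emeasure_eq_measure N.emeasure_eq_measure ennreal_mult'[symmetric])
  qed (auto intro: D.sigma_finite_measure_axioms N.sigma_finite_measure_axioms cong: sets_pair_measure_cong)
  have gm: "g \<in> borel_measurable (S \<Otimes>\<^sub>M std_normal_distribution)"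
    using g by (simp cong: measurable_cong_sets sets_pair_measure_cong)
  have "(\<integral>\<^sup>+\<omega>. g (X \<omega>, increment \<omega>) \<partial>M) = (\<integral>\<^sup>+\<omega>. g (X' \<omega>, increment \<omega>) \<partial>M)"
    using X'(2) by (intro nn_integral_cong_AE) auto
  also have "\<dots> = (\<integral>\<^sup>+z. g z \<partial>(distr M S X' \<Otimes>\<^sub>M std_normal_distribution))"
    unfolding joint by (subst nn_integral_distr) auto
  also have "\<dots> = (\<integral>\<^sup>+x. (\<integral>\<^sup>+y. g (x, y) \<partial>std_normal_distribution) \<partial>distr M S X')"
    using gm by (subst N.nn_integral_fst[symmetric]) (auto cong: measurable_cong_sets sets_pair_measure_cong)
  also have "\<dots> = (\<integral>\<^sup>+\<omega>. (\<integral>\<^sup>+y. g (X' \<omega>, y) \<partial>std_normal_distribution) \<partial>M)"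
    using gm by (intro nn_integral_distr) (auto intro!: N.borel_measurable_nn_integral)
  also have "\<dots> = (\<integral>\<^sup>+\<omega>. (\<integral>\<^sup>+y. g (X \<omega>, y) \<partial>std_normal_distribution) \<partial>M)"
    using X'(2) by (intro nn_integral_cong_AE) auto
  also have "\<dots> = (\<integral>\<^sup>+\<omega>. (\<integral>\<^sup>+y. g (X \<omega>, y) * ennreal (std_normal_density y) \<partial>lborel) \<partial>M)"
  proof (rule nn_integral_cong)
    fix \<omega> assume "\<omega> \<in> space M"
    then have [measurable]: "X \<omega> \<in> space S" by (rule measurable_space[OF X])
    show "(\<integral>\<^sup>+y. g (X \<omega>, y) \<partial>std_normal_distribution) = (\<integral>\<^sup>+y. g (X \<omega>, y) * ennreal (std_normal_density y) \<partial>lborel)"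
      by (subst nn_integral_density) (auto simp: mult.commute)
  qed
  finally show ?thesis .
qed

end

end

section \<open>The bridge on a grid\<close>

definition grid :: "real \<Rightarrow> nat \<Rightarrow> real"
  where "grid h i = 1 - exp (- (real i * h))"

text \<open>Since 1 - \<open>grid h i\<close> = exp(- i h), the factor is 1 / sqrt(1 - t) at t =
  \<open>grid h i\<close>.\<close>

definition ou_coord :: "real \<Rightarrow> nat \<Rightarrow> path \<Rightarrow> real"
  where "ou_coord h i x = coord (grid h i) x * exp (real i * h / 2)"

text \<open>Padding with zeros puts the histories of all lengths into one product space, so that
  adding an observation is a function update and inductions on n keep their types.\<close>

definition ou_history :: "real \<Rightarrow> nat \<Rightarrow> path \<Rightarrow> nat \<Rightarrow> real"
  where "ou_history h n x = (\<lambda>i. if i \<le> n then ou_coord h i x else 0)"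

lemma measurable_ou_coord [measurable]: "ou_coord h i \<in> borel_measurable borel"
  unfolding ou_coord_def[abs_def] by measurable

lemma measurable_ou_history [measurable]: "ou_history h n \<in> measurable borel (Pi\<^sub>M UNIV (\<lambda>_. borel))"
  unfolding ou_history_def by (rule measurable_PiM_single') (auto intro: measurable_If)

lemma ou_history_Suc: "ou_history h (Suc n) x = (ou_history h n x)(Suc n := ou_coord h (Suc n) x)"
  by (auto simp: ou_history_def fun_eq_iff)

lemma bridge_variance:
  fixes \<alpha> t t' :: real
  assumes t: "0 \<le> t" "t < t'" "t' < 1"
  defines "f \<equiv> \<lambda>s. indicator {t<..t'} s * ((1 - t') / (1 - s)) powr \<alpha>"
    and "h \<equiv> ln ((1 - t) / (1 - t'))"
  shows "integrable lborel (\<lambda>s. (f s)\<^sup>2)"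
    and "(LINT s|lborel. (f s)\<^sup>2) = (1 - t') * ou_var (\<alpha> - 1 / 2) h"
proof -
  define \<kappa> where "\<kappa> = \<alpha> - 1 / 2"
  define q where "q s = (1 - t') / (1 - s)" for s
  \<comment> \<open>The squared integrand is q^(2 \<alpha>) = q^(2 \<kappa> + 1), and dq/ds = q^2 /
    (1 - t') leaves (1 - t') q^(2 \<kappa> - 1) dq, with q running from exp(- h) to 1. The primitive
    is logarithmic exactly when \<kappa> = 0.\<close>
  define F where "F s = (if \<kappa> = 0 then - (1 - t') * ln (1 - s) else (1 - t') / (2 * \<kappa>) * q s powr (2 * \<kappa>))" for s
  have q: "q s > 0" if "s \<le> t'" for s using that t by (simp add: q_def)
  have eq: "(f s)\<^sup>2 = indicator {t<..t'} s * q s powr (2 * \<kappa> + 1)" for s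
    using q[of s] by (auto simp: f_def q_def[symmetric] indicator_def \<kappa>_def powr_add[symmetric] power2_eq_square)
  have AE: "AE s in lborel. q s powr (2 * \<kappa> + 1) * indicator {t..t'} s = (f s)\<^sup>2"
    using AE_lborel_singleton[of t] by eventually_elim (auto simp: eq indicator_def)
  have cont: "isCont (\<lambda>s. q s powr (2 * \<kappa> + 1)) s" if "s \<le> t'" for s
    using q[OF that] that t unfolding q_def by (intro continuous_intros) auto
  have int: "integrable lborel (\<lambda>s. q s powr (2 * \<kappa> + 1) * indicator {t..t'} s)"
    by (intro borel_integrable_atLeastAtMost cont) simp_all
  have "f \<in> borel_measurable lborel" unfolding f_def by measurable
  then have meas: "(\<lambda>s. (f s)\<^sup>2) \<in> borel_measurable lborel" by measurable
  show "integrable lborel (\<lambda>s. (f s)\<^sup>2)"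
    using int meas AE by (rule integrable_cong_AE_imp[where g = "\<lambda>s. q s powr (2 * \<kappa> + 1) * indicator {t..t'} s"])
  have "(F has_real_derivative q s powr (2 * \<kappa> + 1)) (at s)" if "s \<le> t'" for s
  proof (cases "\<kappa> = 0")
    case True
    have "((\<lambda>s. ln (1 - s)) has_real_derivative - (1 / (1 - s))) (at s)"
      using that t by (auto intro!: derivative_eq_intros)
    moreover have "- (1 - t') * - (1 / (1 - s)) = q s"
      unfolding q_def by (metis minus_mult_minus mult.right_neutral times_divide_eq_right)
    ultimately have "((\<lambda>s. - (1 - t') * ln (1 - s)) has_real_derivative q s) (at s)"
      using DERIV_cmult[where c = "- (1 - t')"] by metis
    moreover have "F = (\<lambda>s. - (1 - t') * ln (1 - s))" using True by (simp add: F_def fun_eq_iff)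
    ultimately show ?thesis using True q[OF that] by simp
  next
    case False
    have "(q has_real_derivative (1 - t') / (1 - s)\<^sup>2) (at s)"
      unfolding q_def[abs_def] using that t
      by (auto intro!: derivative_eq_intros simp: power2_eq_square)
    from DERIV_powr[OF this q[OF that] DERIV_const[of "2 * \<kappa>"]]
    have "((\<lambda>s. q s powr (2 * \<kappa>)) has_real_derivative q s powr (2 * \<kappa>) * (2 * \<kappa> * ((1 - t') / (1 - s)\<^sup>2) / q s)) (at s)"
      by (simp add: mult.commute)
    from DERIV_cmult[OF this, of "(1 - t') / (2 * \<kappa>)"]
    have "(F has_real_derivative (1 - t') / (2 * \<kappa>) * (q s powr (2 * \<kappa>) * (2 * \<kappa> * ((1 - t') / (1 - s)\<^sup>2) / q s))) (at s)"
      using False by (simp add: F_def[abs_def])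
    moreover have "(1 - t') / (2 * \<kappa>) * (q s powr (2 * \<kappa>) * (2 * \<kappa> * ((1 - t') / (1 - s)\<^sup>2) / q s)) = q s powr (2 * \<kappa> + 1)"
      using False q[OF that] that t by (simp add: powr_add) (simp add: q_def power2_eq_square)
    ultimately show ?thesis by simp
  qed
  then have "(LINT s|lborel. q s powr (2 * \<kappa> + 1) * indicator {t..t'} s) = F t' - F t"
    using t by (intro integral_FTC_Icc_real cont) auto
  moreover have "(LINT s|lborel. q s powr (2 * \<kappa> + 1) * indicator {t..t'} s) = (LINT s|lborel. (f s)\<^sup>2)"
    using int meas AE by (intro integral_cong_AE) auto
  moreover have "F t' - F t = (1 - t') * ou_var \<kappa> h"
  proof (cases "\<kappa> = 0")
    case True
    then show ?thesis using t by (simp add: F_def ou_var_def h_def ln_div algebra_simps)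
  next
    case False
    have "q t' = 1" using t by (simp add: q_def)
    moreover have "q t powr (2 * \<kappa>) = exp (- (2 * \<kappa> * h))"
      using t by (simp add: q_def h_def powr_def ln_div algebra_simps)
    ultimately show ?thesis using False by (simp add: F_def ou_var_def field_simps)
  qed
  ultimately show "(LINT s|lborel. (f s)\<^sup>2) = (1 - t') * ou_var (\<alpha> - 1 / 2) h"
    by (simp add: \<kappa>_def)
qed

lemma nn_integral_normal_shift:
  fixes g :: "real \<Rightarrow> ennreal"
  assumes [measurable]: "g \<in> borel_measurable borel" and \<sigma>: "\<sigma> > 0"
  shows "(\<integral>\<^sup>+z. g (\<mu> + \<sigma> * z) * ennreal (std_normal_density z) \<partial>lborel) =
    (\<integral>\<^sup>+y. g y * ennreal (normal_density \<mu> \<sigma> y) \<partial>lborel)"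
proof -
  have "(\<integral>\<^sup>+y. g y * ennreal (normal_density \<mu> \<sigma> y) \<partial>lborel) =
      ennreal \<sigma> * (\<integral>\<^sup>+z. g (\<mu> + \<sigma> * z) * ennreal (normal_density \<mu> \<sigma> (\<mu> + \<sigma> * z)) \<partial>lborel)"
    using \<sigma> by (subst nn_integral_real_affine[of _ \<sigma> \<mu>]) auto
  also have "\<dots> = (\<integral>\<^sup>+z. ennreal \<sigma> * (g (\<mu> + \<sigma> * z) * ennreal (normal_density \<mu> \<sigma> (\<mu> + \<sigma> * z))) \<partial>lborel)"
    by (rule nn_integral_cmult[symmetric]) measurable
  also have "\<dots> = (\<integral>\<^sup>+z. g (\<mu> + \<sigma> * z) * ennreal (std_normal_density z) \<partial>lborel)"
  proof (rule nn_integral_cong)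
    fix z
    have "\<sigma> * normal_density \<mu> \<sigma> (\<mu> + \<sigma> * z) = std_normal_density z"
      using \<sigma> by (simp add: normal_density_def real_sqrt_mult power_mult_distrib)
    then show "ennreal \<sigma> * (g (\<mu> + \<sigma> * z) * ennreal (normal_density \<mu> \<sigma> (\<mu> + \<sigma> * z))) =
        g (\<mu> + \<sigma> * z) * ennreal (std_normal_density z)"
      using \<sigma> by (metis ennreal_mult' less_imp_le mult.left_commute)
  qed
  finally show ?thesis ..
qed

lemma measurable_ou_density [measurable (raw)]:
  assumes [measurable]: "p \<in> borel_measurable N" "q \<in> borel_measurable N"
  shows "(\<lambda>z. ou_density \<kappa> h (p z) (q z)) \<in> borel_measurable N"
  unfolding ou_density_def normal_density_def by measurable

text \<open>The Markov property with its Gaussian kernel. The integrand of the bridge at the later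
  time is a constant multiple of the one at the earlier time, so X at the next grid point is \<rho>
  times the present value plus an independent normal variable; rescaling gives the
  Ornstein-Uhlenbeck transition.\<close>

lemma bridge_step:
  assumes bridge: "alpha_brownian_bridge \<alpha> M W Y" and h: "h > 0"
    and g [measurable]: "g \<in> borel_measurable (Pi\<^sub>M UNIV (\<lambda>_. borel) \<Otimes>\<^sub>M borel)"
  shows "(\<integral>\<^sup>+x. g (ou_history h n x, ou_coord h (Suc n) x) \<partial>distr M borel Y) =
    (\<integral>\<^sup>+x. (\<integral>\<^sup>+y. g (ou_history h n x, y) * ennreal (ou_density (\<alpha> - 1 / 2) h (ou_coord h n x) y) \<partial>lborel)
      \<partial>distr M borel Y)"
proof -
  have bm: "brownian_motion M W" and Y [measurable]: "Y \<in> borel_measurable M"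
    and wi: "\<And>t. 0 \<le> t \<Longrightarrow> t < 1 \<Longrightarrow>
      is_wiener_integral M W t (\<lambda>s. ((1 - t) / (1 - s)) powr \<alpha>) (\<lambda>\<omega>. coord t (Y \<omega>))"
    using bridge by (auto simp: alpha_brownian_bridge_def)
  interpret brownian M W
    using bm by (auto simp: brownian_def brownian_axioms_def brownian_motion_def)
  define \<kappa> where "\<kappa> = \<alpha> - 1 / 2"
  define v where "v = ou_var \<kappa> h"
  have v: "v > 0" using ou_var_pos[OF h] by (simp add: v_def)
  have grid: "0 \<le> grid h i" "grid h i < 1" for i using h by (auto simp: grid_def)
  have grid_mono: "grid h i \<le> grid h j" if "i \<le> j" for i j
    using that h by (simp add: grid_def mult_right_mono)
  let ?t = "grid h n" and ?t' = "grid h (Suc n)"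
  have t: "0 \<le> ?t" "?t < ?t'" "?t' < 1" using grid h by (auto simp: grid_def)
  have one_minus: "1 - ?t = exp (- (real n * h))" "1 - ?t' = exp (- (real n * h)) * exp (- h)"
    by (auto simp: grid_def exp_add[symmetric] algebra_simps)
  \<comment> \<open>This \<rho> is the contraction exp(- \<alpha> h) of X itself. Rescaling
    contributes exp(h / 2) per step, which turns \<alpha> into \<kappa> = \<alpha> - 1/2 and
    \<sigma> into sqrt v.\<close>
  define \<rho> where "\<rho> = exp (- (\<alpha> * h))"
  define \<sigma> where "\<sigma> = sqrt ((1 - ?t') * v)"
  have \<sigma>: "\<sigma> > 0" using v t by (simp add: \<sigma>_def)
  have ff': "((1 - ?t') / (1 - s)) powr \<alpha> = \<rho> * ((1 - ?t) / (1 - s)) powr \<alpha>" if "s \<in> {0..?t}" for s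
  proof -
    have "\<rho> = exp (- h) powr \<alpha>" by (simp add: \<rho>_def powr_def)
    moreover have "(1 - ?t') / (1 - s) = exp (- h) * ((1 - ?t) / (1 - s))" by (simp add: one_minus)
    moreover have "(exp (- h) * ((1 - ?t) / (1 - s))) powr \<alpha> = exp (- h) powr \<alpha> * ((1 - ?t) / (1 - s)) powr \<alpha>"
      by (rule powr_mult)
    ultimately show ?thesis by (simp only:)
  qed
  have h_eq: "ln ((1 - ?t) / (1 - ?t')) = h" by (simp add: one_minus exp_minus inverse_eq_divide)
  have sq: "(LINT s|lborel. (indicator {?t<..?t'} s * ((1 - ?t') / (1 - s)) powr \<alpha>)\<^sup>2) = \<sigma>\<^sup>2"
    using bridge_variance(2)[OF t, of \<alpha>] v t by (simp add: h_eq \<sigma>_def v_def \<kappa>_def)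
  define D where "D \<omega> = (coord ?t' (Y \<omega>) - \<rho> * coord ?t (Y \<omega>)) / \<sigma>" for \<omega>
  then have D_eq: "D = (\<lambda>\<omega>. (coord ?t' (Y \<omega>) - \<rho> * coord ?t (Y \<omega>)) / \<sigma>)" by (rule ext)
  have Suc_eq: "ou_coord h (Suc n) (Y \<omega>) = exp (- (\<kappa> * h)) * ou_coord h n (Y \<omega>) + sqrt v * D \<omega>" for \<omega>
  proof -
    have s1: "sqrt (1 - ?t') = exp (- (real (Suc n) * h / 2))"
      by (rule real_sqrt_unique) (auto simp: grid_def power2_eq_square exp_add[symmetric])
    have "coord ?t' (Y \<omega>) = \<rho> * coord ?t (Y \<omega>) + \<sigma> * D \<omega>" using \<sigma> by (simp add: D_def)
    then have "ou_coord h (Suc n) (Y \<omega>) = \<rho> * exp (real (Suc n) * h / 2) * coord ?t (Y \<omega>) + exp (real (Suc n) * h / 2) * \<sigma> * D \<omega>"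
      by (simp add: ou_coord_def algebra_simps)
    also have "\<rho> * exp (real (Suc n) * h / 2) = exp (- (\<kappa> * h)) * exp (real n * h / 2)"
      by (simp add: \<rho>_def \<kappa>_def exp_add[symmetric] algebra_simps add_divide_distrib)
    also have "exp (real (Suc n) * h / 2) * \<sigma> = sqrt v"
      by (simp add: \<sigma>_def real_sqrt_mult s1 exp_minus del: of_nat_Suc)
    finally show ?thesis by (simp add: ou_coord_def mult_ac)
  qed
  \<comment> \<open>The history is replaced, coordinate by coordinate, by past-measurable versions;
    finitely many exceptional null sets are united below.\<close>
  have "\<exists>I'\<in>borel_measurable (past ?t). AE \<omega> in M. coord (grid h i) (Y \<omega>) = I' \<omega>" if "i \<le> n" for i
    using wi[OF grid] grid_mono[OF that] grid t by (intro wiener_integral_past) (auto intro: less_imp_le)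
  then obtain I' where I': "\<And>i. i \<le> n \<Longrightarrow> I' i \<in> borel_measurable (past ?t)"
    "\<And>i. i \<le> n \<Longrightarrow> AE \<omega> in M. coord (grid h i) (Y \<omega>) = I' i \<omega>"
    by metis
  define H where "H \<omega> = (\<lambda>i. if i \<le> n then I' i \<omega> * exp (real i * h / 2) else 0)" for \<omega>
  have H: "H \<in> measurable (past ?t) (Pi\<^sub>M UNIV (\<lambda>_. borel))"
    unfolding H_def
  proof (rule measurable_PiM_single')
    show "(\<lambda>\<omega>. if i \<le> n then I' i \<omega> * exp (real i * h / 2) else 0) \<in> borel_measurable (past ?t)" for i
    proof (cases "i \<le> n")
      case True
      note [measurable] = I'(1)[OF True]
      show ?thesis using True by simp
    qed simp
  qed simp
  have "AE \<omega> in M. \<forall>i\<in>{..n}. coord (grid h i) (Y \<omega>) = I' i \<omega>"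
    using I'(2) by (intro AE_finite_allI) auto
  then have H_eq: "AE \<omega> in M. ou_history h n (Y \<omega>) = H \<omega>"
    by eventually_elim (auto simp: ou_history_def H_def ou_coord_def)
  let ?g = "\<lambda>(\<eta>, z). g (\<eta>, exp (- (\<kappa> * h)) * \<eta> n + sqrt v * z)"
  have g': "?g \<in> borel_measurable (Pi\<^sub>M UNIV (\<lambda>_. borel) \<Otimes>\<^sub>M borel)" by measurable
  have hist_n: "ou_history h n x n = ou_coord h n x" for x by (simp add: ou_history_def)
  have "(\<integral>\<^sup>+x. g (ou_history h n x, ou_coord h (Suc n) x) \<partial>distr M borel Y) =
      (\<integral>\<^sup>+\<omega>. g (ou_history h n (Y \<omega>), ou_coord h (Suc n) (Y \<omega>)) \<partial>M)"
    by (rule nn_integral_distr) measurable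
  also have "\<dots> = (\<integral>\<^sup>+\<omega>. ?g (ou_history h n (Y \<omega>), D \<omega>) \<partial>M)"
    by (simp add: Suc_eq hist_n)
  also have "\<dots> = (\<integral>\<^sup>+\<omega>. (\<integral>\<^sup>+z. ?g (ou_history h n (Y \<omega>), z) * ennreal (std_normal_density z) \<partial>lborel) \<partial>M)"
    by (rule nn_integral_increment[OF t(1,2) less_imp_le[OF t(3)] wi[OF grid] wi[OF grid] ff'
          bridge_variance(1)[OF t] \<sigma> sq D_eq _ H H_eq g']) measurable
  also have "\<dots> = (\<integral>\<^sup>+\<omega>. (\<integral>\<^sup>+y. g (ou_history h n (Y \<omega>), y) * ennreal (ou_density \<kappa> h (ou_coord h n (Y \<omega>)) y) \<partial>lborel) \<partial>M)"
  proof (rule nn_integral_cong)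
    fix \<omega>
    have "(\<lambda>y. g (ou_history h n (Y \<omega>), y)) \<in> borel_measurable borel"
      by (rule measurable_compose[OF _ g]) (auto simp: space_PiM)
    then show "(\<integral>\<^sup>+z. ?g (ou_history h n (Y \<omega>), z) * ennreal (std_normal_density z) \<partial>lborel) =
        (\<integral>\<^sup>+y. g (ou_history h n (Y \<omega>), y) * ennreal (ou_density \<kappa> h (ou_coord h n (Y \<omega>)) y) \<partial>lborel)"
      using nn_integral_normal_shift[of "\<lambda>y. g (ou_history h n (Y \<omega>), y)" "sqrt v"] v
      by (simp add: hist_n ou_density_def v_def)
  qed
  also have "\<dots> = (\<integral>\<^sup>+x. (\<integral>\<^sup>+y. g (ou_history h n x, y) * ennreal (ou_density \<kappa> h (ou_coord h n x) y) \<partial>lborel) \<partial>distr M borel Y)"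
  proof -
    have "(\<lambda>(x, y). g (ou_history h n x, y) * ennreal (ou_density \<kappa> h (ou_coord h n x) y))
        \<in> borel_measurable (borel \<Otimes>\<^sub>M lborel)"
      by measurable
    note m = lborel.borel_measurable_nn_integral[OF this]
    have "integral\<^sup>N (distr M borel Y) F = (\<integral>\<^sup>+\<omega>. F (Y \<omega>) \<partial>M)" if "F \<in> borel_measurable borel" for F
      using that by (intro nn_integral_distr[OF Y]) simp
    from this[OF m] show ?thesis by (rule sym)
  qed
  finally show ?thesis unfolding \<kappa>_def .
qed

section \<open>Likelihood ratios on a grid\<close>

lemma continuous_on_coord: "continuous_on {0..1} (\<lambda>t. coord t x)"
  unfolding coord_def
proof (rule continuous_on_compose2[where t = UNIV, OF continuous_on_apply_bcontfun])
  show "continuous_on {0..1} Abs_unit_interval"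
    unfolding continuous_on_iff by (force simp: dist_unit_interval_def Abs_unit_interval_inverse)
qed simp

text \<open>At t = 0 every admissible partition is constantly 0, so all step integrals vanish and
  with them their L^2 limit.\<close>

lemma bridge_coord_0:
  assumes "alpha_brownian_bridge \<alpha> M W Y"
  shows "AE x in distr M borel Y. coord 0 x = 0"
proof -
  have Y [measurable]: "Y \<in> borel_measurable M"
    and wi: "is_wiener_integral M W 0 (\<lambda>s. ((1 - 0) / (1 - s)) powr \<alpha>) (\<lambda>\<omega>. coord 0 (Y \<omega>))"
    using assms by (auto simp: alpha_brownian_bridge_def)
  obtain n \<tau> c where \<tau>: "\<And>k. \<tau> k ` {..n k} \<subseteq> {0..0}"
    and lim: "(\<lambda>k. \<integral>\<^sup>+\<omega>. ennreal ((coord 0 (Y \<omega>) - step_integral (n k) (\<tau> k) (c k) W \<omega>)\<^sup>2) \<partial>M) \<longlonglongrightarrow> 0"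
    by (rule is_wiener_integralE[OF wi]) (rule that; assumption)
  have "step_integral (n k) (\<tau> k) (c k) W \<omega> = 0" for k \<omega>
  proof -
    have "\<tau> k i = 0" if "i \<le> n k" for i using \<tau>[of k] that by (auto simp: image_subset_iff)
    then show ?thesis by (auto simp: step_integral_def)
  qed
  with lim have "(\<integral>\<^sup>+\<omega>. ennreal ((coord 0 (Y \<omega>))\<^sup>2) \<partial>M) = 0"
    by (simp add: LIMSEQ_const_iff)
  then have "AE \<omega> in M. coord 0 (Y \<omega>) = 0"
    by (subst (asm) nn_integral_0_iff_AE) auto
  then show ?thesis by (subst AE_distr_iff) auto
qed

lemma measurable_ou_loglik [measurable]:
  "ou_loglik \<kappa> h n \<in> borel_measurable (Pi\<^sub>M UNIV (\<lambda>_. borel))"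
  unfolding ou_loglik_def[abs_def] normal_density_def by measurable

lemma ou_loglik_cong:
  "(\<And>i. i \<le> n \<Longrightarrow> y i = z i) \<Longrightarrow> ou_loglik \<kappa> h n y = ou_loglik \<kappa> h n z"
  unfolding ou_loglik_def by (intro sum.cong refl) simp

lemma exp_ou_loglik_Suc:
  assumes "h > 0"
  shows "exp (ou_loglik \<kappa> h (Suc n) y - ou_loglik \<kappa>' h (Suc n) y) * ou_density \<kappa>' h (y n) (y (Suc n)) =
    exp (ou_loglik \<kappa> h n y - ou_loglik \<kappa>' h n y) * ou_density \<kappa> h (y n) (y (Suc n))"
proof -
  let ?p = "ou_density \<kappa> h (y n) (y (Suc n))" and ?p' = "ou_density \<kappa>' h (y n) (y (Suc n))"
    and ?q = "normal_density (y n) (sqrt h) (y (Suc n))"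
  have pos: "?p > 0" "?p' > 0" "?q > 0"
    using assms by (simp_all add: ou_density_pos normal_density_pos)
  have "ou_loglik \<kappa> h (Suc n) y - ou_loglik \<kappa>' h (Suc n) y =
      ou_loglik \<kappa> h n y - ou_loglik \<kappa>' h n y + ln (?p / ?p')"
    using pos by (simp add: ou_loglik_def ln_div)
  then have "exp (ou_loglik \<kappa> h (Suc n) y - ou_loglik \<kappa>' h (Suc n) y) =
      exp (ou_loglik \<kappa> h n y - ou_loglik \<kappa>' h n y) * (?p / ?p')"
    using pos by (simp add: exp_add)
  then show ?thesis using pos by simp
qed

text \<open>Induction on the number of observations: the last coordinate is integrated out with the
  kernel of the second bridge, the induction hypothesis changes the measure for the remaining
  history, and the kernel of the first bridge restores the coordinate at the price of one more
  density ratio.\<close>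

lemma bridge_likelihood_ratio:
  assumes b0: "alpha_brownian_bridge \<alpha>\<^sub>0 M\<^sub>0 W\<^sub>0 Y\<^sub>0" and b1: "alpha_brownian_bridge \<alpha>\<^sub>1 M\<^sub>1 W\<^sub>1 Y\<^sub>1"
    and h: "h > 0"
    and g: "g \<in> borel_measurable (Pi\<^sub>M UNIV (\<lambda>_. borel))"
  shows "(\<integral>\<^sup>+x. g (ou_history h n x) \<partial>distr M\<^sub>1 borel Y\<^sub>1) =
    (\<integral>\<^sup>+x. g (ou_history h n x) * ennreal (exp (ou_loglik (\<alpha>\<^sub>1 - 1 / 2) h n (ou_history h n x)
      - ou_loglik (\<alpha>\<^sub>0 - 1 / 2) h n (ou_history h n x))) \<partial>distr M\<^sub>0 borel Y\<^sub>0)"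
  using g
proof (induction n arbitrary: g)
  case 0
  \<comment> \<open>With only time 0 observed, the history is almost surely the zero sequence under
    either law.\<close>
  have *: "(\<integral>\<^sup>+x. g (ou_history h 0 x) \<partial>distr M borel Y) = g (\<lambda>_. 0)"
    if b: "alpha_brownian_bridge \<alpha> M W Y" for \<alpha> and M :: "'c measure" and W Y
  proof -
    have [measurable]: "Y \<in> borel_measurable M" and "prob_space M"
      using b by (auto simp: alpha_brownian_bridge_def brownian_motion_def)
    then interpret prob_space "distr M borel Y" by (intro prob_space.prob_space_distr) auto
    have "AE x in distr M borel Y. g (ou_history h 0 x) = g (\<lambda>_. 0)"
      using bridge_coord_0[OF b]
      by eventually_elim (auto intro!: arg_cong[where f = g] simp: ou_history_def ou_coord_def grid_def)
    then have "(\<integral>\<^sup>+x. g (ou_history h 0 x) \<partial>distr M borel Y) = (\<integral>\<^sup>+x. g (\<lambda>_. 0) \<partial>distr M borel Y)"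
      by (rule nn_integral_cong_AE)
    also have "\<dots> = g (\<lambda>_. 0)" using emeasure_space_1 by simp
    finally show ?thesis .
  qed
  show ?case by (simp add: *[OF b0] *[OF b1] ou_loglik_def)
next
  case (Suc n)
  let ?\<kappa>0 = "\<alpha>\<^sub>0 - 1 / 2" and ?\<kappa>1 = "\<alpha>\<^sub>1 - 1 / 2"
  let ?P0 = "distr M\<^sub>0 borel Y\<^sub>0" and ?P1 = "distr M\<^sub>1 borel Y\<^sub>1"
  let ?H = "ou_history h n" and ?y = "ou_coord h n"
  let ?R = "\<lambda>n \<eta>. ennreal (exp (ou_loglik ?\<kappa>1 h n \<eta> - ou_loglik ?\<kappa>0 h n \<eta>))"
  note [measurable] = Suc.prems
  have H_n: "?H x n = ?y x" for x by (simp add: ou_history_def)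
  have upd [measurable]: "(\<lambda>(\<eta>, y). \<eta>(Suc n := y)) \<in>
      measurable (Pi\<^sub>M UNIV (\<lambda>_. borel) \<Otimes>\<^sub>M borel) (Pi\<^sub>M UNIV (\<lambda>_. borel :: real measure))"
    unfolding case_prod_beta by (rule measurable_fun_upd[where J = UNIV]) auto
  have g1: "(\<lambda>(\<eta>, y). g (\<eta>(Suc n := y))) \<in> borel_measurable (Pi\<^sub>M UNIV (\<lambda>_. borel) \<Otimes>\<^sub>M borel)"
    using measurable_compose[OF upd Suc.prems] by (simp add: case_prod_beta')
  have R1: "(\<lambda>(\<eta>, y). ?R (Suc n) (\<eta>(Suc n := y))) \<in> borel_measurable (Pi\<^sub>M UNIV (\<lambda>_. borel) \<Otimes>\<^sub>M borel)"
    using measurable_compose[OF upd, of "?R (Suc n)" borel] by (simp add: case_prod_beta')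
  have g2: "(\<lambda>(\<eta>, y). g (\<eta>(Suc n := y)) * ?R (Suc n) (\<eta>(Suc n := y))) \<in>
      borel_measurable (Pi\<^sub>M UNIV (\<lambda>_. borel) \<Otimes>\<^sub>M borel)"
    using borel_measurable_times_ennreal[OF g1 R1] by (simp add: case_prod_beta')
  \<comment> \<open>The integrated functional depends on the history up to n only; the induction
    hypothesis is applied to it, which is why g is kept arbitrary.\<close>
  let ?K = "\<lambda>\<eta>. \<integral>\<^sup>+y. g (\<eta>(Suc n := y)) * ennreal (ou_density ?\<kappa>1 h (\<eta> n) y) \<partial>lborel"
  have "(\<lambda>(\<eta>, y). ennreal (ou_density ?\<kappa>1 h (\<eta> n) y)) \<in> borel_measurable (Pi\<^sub>M UNIV (\<lambda>_. borel) \<Otimes>\<^sub>M borel)"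
    by measurable
  from borel_measurable_times_ennreal[OF g1 this]
  have "(\<lambda>(\<eta>, y). g (\<eta>(Suc n := y)) * ennreal (ou_density ?\<kappa>1 h (\<eta> n) y))
      \<in> borel_measurable (Pi\<^sub>M UNIV (\<lambda>_. borel) \<Otimes>\<^sub>M lborel)"
    by (simp add: case_prod_beta' cong: measurable_cong_sets sets_pair_measure_cong)
  then have K: "?K \<in> borel_measurable (Pi\<^sub>M UNIV (\<lambda>_. borel))"
    by (rule lborel.borel_measurable_nn_integral)
  have "(\<integral>\<^sup>+x. g (ou_history h (Suc n) x) \<partial>?P1) = (\<integral>\<^sup>+x. ?K (?H x) \<partial>?P1)"
    using bridge_step[OF b1 h g1, of n] by (simp add: ou_history_Suc H_n)
  also have "\<dots> = (\<integral>\<^sup>+x. ?K (?H x) * ?R n (?H x) \<partial>?P0)"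
    by (rule Suc.IH[OF K])
  also have "\<dots> = (\<integral>\<^sup>+x. (\<integral>\<^sup>+y. g ((?H x)(Suc n := y)) * ?R (Suc n) ((?H x)(Suc n := y)) *
      ennreal (ou_density ?\<kappa>0 h (?y x) y) \<partial>lborel) \<partial>?P0)"
  proof (rule nn_integral_cong)
    fix x
    have gx: "(\<lambda>y. g ((?H x)(Suc n := y))) \<in> borel_measurable borel"
      using measurable_compose[OF measurable_Pair1' g1, of "?H x"] by (simp add: space_PiM)
    have "?R (Suc n) ((?H x)(Suc n := y)) * ennreal (ou_density ?\<kappa>0 h (?y x) y) =
        ennreal (ou_density ?\<kappa>1 h (?y x) y) * ?R n (?H x)" for y
    proof -
      have "ou_loglik \<kappa> h n ((?H x)(Suc n := y)) = ou_loglik \<kappa> h n (?H x)" for \<kappa>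
        by (rule ou_loglik_cong) simp
      with exp_ou_loglik_Suc[OF h, of ?\<kappa>1 n "(?H x)(Suc n := y)" ?\<kappa>0]
      have "exp (ou_loglik ?\<kappa>1 h (Suc n) ((?H x)(Suc n := y)) - ou_loglik ?\<kappa>0 h (Suc n) ((?H x)(Suc n := y)))
          * ou_density ?\<kappa>0 h (?y x) y = ou_density ?\<kappa>1 h (?y x) y *
          exp (ou_loglik ?\<kappa>1 h n (?H x) - ou_loglik ?\<kappa>0 h n (?H x))"
        by (simp add: H_n mult.commute)
      then show ?thesis
        using ou_density_pos[OF h] by (simp add: ennreal_mult'[symmetric] less_imp_le)
    qed
    then have "(\<integral>\<^sup>+y. g ((?H x)(Suc n := y)) * ?R (Suc n) ((?H x)(Suc n := y)) *
        ennreal (ou_density ?\<kappa>0 h (?y x) y) \<partial>lborel) =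
      (\<integral>\<^sup>+y. g ((?H x)(Suc n := y)) * ennreal (ou_density ?\<kappa>1 h (?y x) y) * ?R n (?H x) \<partial>lborel)"
      by (simp only: mult.assoc)
    also have "\<dots> = ?K (?H x) * ?R n (?H x)"
      using gx by (subst nn_integral_multc) (auto simp: H_n)
    finally show "?K (?H x) * ?R n (?H x) = (\<integral>\<^sup>+y. g ((?H x)(Suc n := y)) * ?R (Suc n) ((?H x)(Suc n := y)) *
        ennreal (ou_density ?\<kappa>0 h (?y x) y) \<partial>lborel)" ..
  qed
  also have "\<dots> = (\<integral>\<^sup>+x. g (ou_history h (Suc n) x) * ?R (Suc n) (ou_history h (Suc n) x) \<partial>?P0)"
    using bridge_step[OF b0 h g2, of n] by (simp add: ou_history_Suc)
  finally show ?case .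
qed

text \<open>Substitution s = 1 - exp(- u): here ds = (1 - s) du, and the squared rescaled path is
  X_s^2 / (1 - s).\<close>

lemma time_change_integral:
  assumes T: "0 \<le> T" "T < 1"
  shows "integral {0..- ln (1 - T)} (\<lambda>u. (coord (1 - exp (- u)) x * exp (u / 2))\<^sup>2) =
    (LBINT s:{0..T}. (coord s x)\<^sup>2 / (1 - s)\<^sup>2)"
proof -
  let ?U = "- ln (1 - T)" and ?f = "\<lambda>s. (coord s x)\<^sup>2 / (1 - s)\<^sup>2" and ?g = "\<lambda>u. 1 - exp (- u)"
  have U: "?U \<ge> 0" and gU: "?g ?U = T" using T by simp_all
  have cont: "continuous_on {0..T} ?f"
    using T continuous_on_subset[OF continuous_on_coord, of "{0..T}"] by (intro continuous_intros) auto
  have "((\<lambda>u. exp (- u) *\<^sub>R ?f (?g u)) has_integral (integral {?g 0..?g ?U} ?f)) {0..?U}"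
  proof (rule has_integral_substitution[OF U _ _ cont])
    show "?g ` {0..?U} \<subseteq> {0..T}"
    proof safe
      fix u assume "u \<in> {0..?U}"
      then have "exp (- u) \<le> 1" "exp (- ?U) \<le> exp (- u)" by auto
      then show "?g u \<in> {0..T}" using gU unfolding atLeastAtMost_iff by linarith
    qed
    show "(?g has_field_derivative exp (- u)) (at u within {0..?U})" for u
      by (auto intro!: derivative_eq_intros)
  qed (use T in auto)
  moreover have "exp (- u) *\<^sub>R ?f (?g u) = (coord (?g u) x * exp (u / 2))\<^sup>2" for u
  proof -
    have "(exp (u / 2))\<^sup>2 = exp (- u) / (exp (- u))\<^sup>2"
      by (simp add: power2_eq_square exp_add[symmetric] exp_minus field_simps)
    then show ?thesis by (simp add: power_mult_distrib)
  qed
  ultimately have "integral {0..?U} (\<lambda>u. (coord (?g u) x * exp (u / 2))\<^sup>2) = integral {0..T} ?f"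
    using gU by (simp add: integral_unique)
  also have "\<dots> = (LBINT s:{0..T}. ?f s)"
    by (rule set_borel_integral_eq_integral(2)[symmetric]) (rule borel_integrable_atLeastAtMost'[OF cont])
  finally show ?thesis .
qed

text \<open>The grid sizes are restricted to powers of two to make the grids nested. The limit holds
  for every path, including those that do not start at 0, hence the term with
  \<open>coord 0 x\<close>.\<close>

lemma ou_loglik_path_tendsto:
  assumes T: "0 < T" "T < 1"
  defines "U \<equiv> - ln (1 - T)"
  shows "(\<lambda>m. ou_loglik \<kappa> (U / 2 ^ m) (2 ^ m) (\<lambda>i. ou_coord (U / 2 ^ m) i x)) \<longlonglongrightarrow>
    - \<kappa> / 2 * (ln (1 - T) + (coord T x)\<^sup>2 / (1 - T) - (coord 0 x)\<^sup>2)
      - \<kappa>\<^sup>2 / 2 * (LBINT s:{0..T}. (coord s x)\<^sup>2 / (1 - s)\<^sup>2)"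
proof -
  have U: "U > 0" using T by (simp add: U_def)
  define f where "f u = coord (1 - exp (- u)) x * exp (u / 2)" for u
  have "continuous_on {0..U} (\<lambda>u. coord (1 - exp (- u)) x)"
    by (rule continuous_on_compose2[OF continuous_on_coord]) (auto intro!: continuous_intros)
  then have "continuous_on {0..U} f"
    unfolding f_def by (intro continuous_intros) simp_all
  from ou_loglik_tendsto[OF this U, of \<kappa>]
  have "(\<lambda>m. ou_loglik \<kappa> (U / real (2 ^ m)) (2 ^ m) (\<lambda>i. f (real i * (U / real (2 ^ m))))) \<longlonglongrightarrow>
      \<kappa> * U / 2 - \<kappa> / 2 * ((f U)\<^sup>2 - (f 0)\<^sup>2) - \<kappa>\<^sup>2 / 2 * integral {0..U} (\<lambda>u. (f u)\<^sup>2)"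
    by (rule filterlim_compose) (rule filterlim_subseq, simp add: strict_mono_def)
  moreover have "f (real i * h) = ou_coord h i x" for i h
    by (simp add: f_def ou_coord_def grid_def)
  moreover have "(f U)\<^sup>2 = (coord T x)\<^sup>2 / (1 - T)"
  proof -
    have "(exp (U / 2))\<^sup>2 = 1 / (1 - T)"
      using T by (simp add: U_def power2_eq_square exp_add[symmetric] exp_minus inverse_eq_divide)
    then show ?thesis using T by (simp add: f_def U_def power_mult_distrib)
  qed
  moreover have "integral {0..U} (\<lambda>u. (f u)\<^sup>2) = (LBINT s:{0..T}. (coord s x)\<^sup>2 / (1 - s)\<^sup>2)"
    unfolding f_def U_def using T by (intro time_change_integral) auto
  moreover have "f 0 = coord 0 x" by (simp add: f_def)
  ultimately have "(\<lambda>m. ou_loglik \<kappa> (U / 2 ^ m) (2 ^ m) (\<lambda>i. ou_coord (U / 2 ^ m) i x)) \<longlonglongrightarrow>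
      \<kappa> * U / 2 - \<kappa> / 2 * ((coord T x)\<^sup>2 / (1 - T) - (coord 0 x)\<^sup>2)
      - \<kappa>\<^sup>2 / 2 * (LBINT s:{0..T}. (coord s x)\<^sup>2 / (1 - s)\<^sup>2)"
    by (simp only: of_nat_power of_nat_numeral)
  then show ?thesis
    by (rule tendsto_eq_rhs) (simp add: U_def algebra_simps)
qed

section \<open>Passage to the limit\<close>

text \<open>Pointwise convergence of likelihood ratios suffices: truncating the ratio makes both
  sides converge boundedly, so no uniform integrability is required.\<close>

lemma likelihood_ratio_limit:
  fixes Z :: "'x \<Rightarrow> real" and Zs :: "nat \<Rightarrow> 'x \<Rightarrow> real"
  assumes P: "prob_space P" "prob_space Q" and sets: "sets Q = sets P"
    and [measurable]: "\<And>m. Zs m \<in> borel_measurable P" "A \<in> sets P"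
    and nonneg: "\<And>m x. 0 \<le> Zs m x"
    and lim: "\<And>x. x \<in> space P \<Longrightarrow> (\<lambda>m. Zs m x) \<longlonglongrightarrow> Z x"
    and ratio: "\<And>m \<phi>. m \<ge> m0 \<Longrightarrow> \<phi> \<in> borel_measurable borel \<Longrightarrow>
      (\<integral>\<^sup>+x. indicator A x * \<phi> (Zs m x) \<partial>Q) = (\<integral>\<^sup>+x. indicator A x * \<phi> (Zs m x) * ennreal (Zs m x) \<partial>P)"
  shows "emeasure Q A = (\<integral>\<^sup>+x. ennreal (Z x) * indicator A x \<partial>P)"
proof -
  interpret P: prob_space P by fact
  interpret Q: prob_space Q by fact
  note [measurable_cong] = sets
  have space: "space Q = space P" using sets by (rule sets_eq_imp_space_eq)
  have Z [measurable]: "Z \<in> borel_measurable P"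
    by (rule borel_measurable_LIMSEQ_real[OF lim]) auto
  have Z_nonneg: "0 \<le> Z x" if "x \<in> space P" for x
    by (rule LIMSEQ_le_const[OF lim[OF that]]) (use nonneg in auto)
  \<comment> \<open>A continuous cutoff equal to 1 up to K and to 0 beyond K + 1. On nonnegative
    arguments both \<phi>(z) and z \<phi>(z) are bounded, and continuity lets the cutoff follow the
    convergent ratios.\<close>
  define \<phi> :: "nat \<Rightarrow> real \<Rightarrow> real" where "\<phi> K z = max 0 (min 1 (real K + 1 - z))" for K z
  have \<phi>: "0 \<le> \<phi> K z" "\<phi> K z \<le> 1" "z > real K + 1 \<Longrightarrow> \<phi> K z = 0" for K z
    by (auto simp: \<phi>_def)
  have \<phi>_meas [measurable]: "\<phi> K \<in> borel_measurable borel" for K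
    unfolding \<phi>_def[abs_def] by measurable
  have \<phi>_mono: "\<phi> K z \<le> \<phi> K' z" if "K \<le> K'" for K K' z
    using that unfolding \<phi>_def by (intro max.mono min.mono) auto
  have \<phi>_lim: "(\<lambda>K. \<phi> K z) \<longlonglongrightarrow> 1" for z
  proof (rule tendsto_eventually)
    have "\<forall>\<^sub>F K in sequentially. z \<le> real K" using filterlim_real_sequentially by (simp add: filterlim_at_top)
    then show "\<forall>\<^sub>F K in sequentially. \<phi> K z = 1" by eventually_elim (simp add: \<phi>_def)
  qed
  have cont: "isCont (\<phi> K) z" for K z
    unfolding \<phi>_def[abs_def] by (intro continuous_intros)
  have truncated: "(\<integral>\<^sup>+x. indicator A x * ennreal (\<phi> K (Z x)) \<partial>Q) =
      (\<integral>\<^sup>+x. indicator A x * ennreal (\<phi> K (Z x)) * ennreal (Z x) \<partial>P)" for K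
  proof (rule LIMSEQ_unique)
    have \<phi>Z: "(\<lambda>m. \<phi> K (Zs m x)) \<longlonglongrightarrow> \<phi> K (Z x)" if "x \<in> space P" for x
      using cont lim[OF that] by (rule isCont_tendsto_compose)
    show "(\<lambda>m. \<integral>\<^sup>+x. indicator A x * ennreal (\<phi> K (Zs m x)) \<partial>Q) \<longlonglongrightarrow>
        (\<integral>\<^sup>+x. indicator A x * ennreal (\<phi> K (Z x)) \<partial>Q)"
    proof (rule nn_integral_dominated_convergence[where w = "\<lambda>_. 1"])
      show "AE x in Q. (\<lambda>m. indicator A x * ennreal (\<phi> K (Zs m x))) \<longlonglongrightarrow> indicator A x * ennreal (\<phi> K (Z x))"
        by (rule AE_I2) (use \<phi>Z in \<open>auto simp: space indicator_def intro!: tendsto_ennrealI\<close>)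
      show "AE x in Q. indicator A x * ennreal (\<phi> K (Zs m x)) \<le> 1" for m
        using \<phi> by (auto simp: indicator_def)
    qed (auto simp: Q.emeasure_space_1)
    have "(\<lambda>m. \<integral>\<^sup>+x. indicator A x * ennreal (\<phi> K (Zs m x)) * ennreal (Zs m x) \<partial>P) \<longlonglongrightarrow>
        (\<integral>\<^sup>+x. indicator A x * ennreal (\<phi> K (Z x)) * ennreal (Z x) \<partial>P)"
    proof (rule nn_integral_dominated_convergence[where w = "\<lambda>_. ennreal (real K + 1)"])
      show "AE x in P. (\<lambda>m. indicator A x * ennreal (\<phi> K (Zs m x)) * ennreal (Zs m x)) \<longlonglongrightarrow>
          indicator A x * ennreal (\<phi> K (Z x)) * ennreal (Z x)"
      proof (rule AE_I2)
        fix x assume x: "x \<in> space P"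
        have "(\<lambda>m. ennreal (\<phi> K (Zs m x) * Zs m x)) \<longlonglongrightarrow> ennreal (\<phi> K (Z x) * Z x)"
          by (intro tendsto_ennrealI tendsto_mult \<phi>Z lim x)
        then show "(\<lambda>m. indicator A x * ennreal (\<phi> K (Zs m x)) * ennreal (Zs m x)) \<longlonglongrightarrow>
            indicator A x * ennreal (\<phi> K (Z x)) * ennreal (Z x)"
          using \<phi>(1) by (auto simp: indicator_def ennreal_mult')
      qed
      show "AE x in P. indicator A x * ennreal (\<phi> K (Zs m x)) * ennreal (Zs m x) \<le> ennreal (real K + 1)" for m
      proof (rule AE_I2)
        fix x
        have "\<phi> K (Zs m x) * Zs m x \<le> real K + 1"
        proof (cases "Zs m x > real K + 1")
          case False
          then have "\<phi> K (Zs m x) * Zs m x \<le> 1 * (real K + 1)"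
            using \<phi> nonneg by (intro mult_mono) auto
          then show ?thesis by simp
        qed (simp add: \<phi>)
        then show "indicator A x * ennreal (\<phi> K (Zs m x)) * ennreal (Zs m x) \<le> ennreal (real K + 1)"
          using \<phi>(1) by (auto simp: indicator_def ennreal_mult'[symmetric] simp del: ennreal_plus intro!: ennreal_leI)
      qed
    qed (auto simp: P.emeasure_space_1)
    moreover have "\<forall>\<^sub>F m in sequentially. (\<integral>\<^sup>+x. indicator A x * ennreal (\<phi> K (Zs m x)) * ennreal (Zs m x) \<partial>P) =
        (\<integral>\<^sup>+x. indicator A x * ennreal (\<phi> K (Zs m x)) \<partial>Q)"
      using eventually_ge_at_top[of m0]
    proof eventually_elim
      case (elim m)
      then show ?case using ratio[of m "\<lambda>z. ennreal (\<phi> K z)"] by simp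
    qed
    ultimately show "(\<lambda>m. \<integral>\<^sup>+x. indicator A x * ennreal (\<phi> K (Zs m x)) \<partial>Q) \<longlonglongrightarrow>
        (\<integral>\<^sup>+x. indicator A x * ennreal (\<phi> K (Z x)) * ennreal (Z x) \<partial>P)"
      by (rule Lim_transform_eventually)
  qed
  \<comment> \<open>The cutoff is now released: it increases to 1 with K, and monotone convergence
    applies under both measures.\<close>
  show ?thesis
  proof (rule LIMSEQ_unique)
    show "(\<lambda>K. \<integral>\<^sup>+x. indicator A x * ennreal (\<phi> K (Z x)) \<partial>Q) \<longlonglongrightarrow> emeasure Q A"
    proof -
      have "(\<lambda>K. \<integral>\<^sup>+x. indicator A x * ennreal (\<phi> K (Z x)) \<partial>Q) \<longlonglongrightarrow> (\<integral>\<^sup>+x. indicator A x \<partial>Q)"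
      proof (rule nn_integral_LIMSEQ)
        show "incseq (\<lambda>K x. indicator A x * ennreal (\<phi> K (Z x)))"
          by (auto simp: incseq_def le_fun_def intro!: mult_left_mono ennreal_leI \<phi>_mono)
        show "(\<lambda>K. indicator A x * ennreal (\<phi> K (Z x))) \<longlonglongrightarrow> indicator A x" for x
          using tendsto_ennrealI[OF \<phi>_lim[of "Z x"]] by (cases "x \<in> A") auto
      qed measurable
      then show ?thesis by simp
    qed
    show "(\<lambda>K. \<integral>\<^sup>+x. indicator A x * ennreal (\<phi> K (Z x)) \<partial>Q) \<longlonglongrightarrow> (\<integral>\<^sup>+x. ennreal (Z x) * indicator A x \<partial>P)"
      unfolding truncated
    proof (rule nn_integral_LIMSEQ)
      show "incseq (\<lambda>K x. indicator A x * ennreal (\<phi> K (Z x)) * ennreal (Z x))"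
        by (auto simp: incseq_def le_fun_def intro!: mult_left_mono mult_right_mono ennreal_leI \<phi>_mono)
      show "(\<lambda>K. indicator A x * ennreal (\<phi> K (Z x)) * ennreal (Z x)) \<longlonglongrightarrow> ennreal (Z x) * indicator A x" for x
      proof (cases "x \<in> A")
        case True
        have "(\<lambda>K. ennreal (\<phi> K (Z x) * Z x)) \<longlonglongrightarrow> ennreal (1 * Z x)"
          by (intro tendsto_ennrealI tendsto_mult \<phi>_lim tendsto_const)
        then show ?thesis using True \<phi>(1) by (simp add: ennreal_mult')
      qed simp
    qed measurable
  qed
qed

section \<open>Dyadic grid events generate the path filtration\<close>

lemma measurable_path_filtration_coord:
  "s \<in> {0..t} \<Longrightarrow> coord s \<in> borel_measurable (path_filtration t)"
  by (rule measurableI) (auto simp: path_filtration_def)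

lemma sets_path_filtration:
  "sets (path_filtration t) = sigma_sets UNIV {coord s -` A | s A. s \<in> {0..t} \<and> A \<in> sets borel}"
  by (simp add: path_filtration_def)

lemma space_path_filtration [simp]: "space (path_filtration t) = UNIV"
  by (simp add: path_filtration_def)

text \<open>The event must be visible on all sufficiently fine grids. A fixed event then satisfies
  the likelihood identity for every m from \<open>m0\<close> on, as the limit requires, and two
  events share a level, which gives stability under intersection.\<close>

definition grid_events :: "real \<Rightarrow> path set set"
  where "grid_events U = {A. \<exists>m0. \<forall>m\<ge>m0. \<exists>C\<in>sets (Pi\<^sub>M UNIV (\<lambda>_. borel)).
    A = ou_history (U / 2 ^ m) (2 ^ m) -` C}"

lemma Int_stable_grid_events: "Int_stable (grid_events U)"
proof (rule Int_stableI)
  fix A B assume "A \<in> grid_events U" "B \<in> grid_events U"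
  then obtain a b where
    a: "\<And>m. m \<ge> a \<Longrightarrow> \<exists>C\<in>sets (Pi\<^sub>M UNIV (\<lambda>_. borel)). A = ou_history (U / 2 ^ m) (2 ^ m) -` C"
    and b: "\<And>m. m \<ge> b \<Longrightarrow> \<exists>C\<in>sets (Pi\<^sub>M UNIV (\<lambda>_. borel)). B = ou_history (U / 2 ^ m) (2 ^ m) -` C"
    unfolding grid_events_def by blast
  have "\<exists>C\<in>sets (Pi\<^sub>M UNIV (\<lambda>_. borel)). A \<inter> B = ou_history (U / 2 ^ m) (2 ^ m) -` C" if "m \<ge> max a b" for m
  proof -
    obtain C D where "C \<in> sets (Pi\<^sub>M UNIV (\<lambda>_. borel))" "A = ou_history (U / 2 ^ m) (2 ^ m) -` C"
      "D \<in> sets (Pi\<^sub>M UNIV (\<lambda>_. borel))" "B = ou_history (U / 2 ^ m) (2 ^ m) -` D"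
      using a[of m] b[of m] \<open>m \<ge> max a b\<close> by auto
    then show ?thesis by (intro bexI[of _ "C \<inter> D"]) auto
  qed
  then show "A \<inter> B \<in> grid_events U" unfolding grid_events_def by blast
qed

text \<open>Point i at level m is point i 2^(k - m) at every finer level k. The factor
  \<open>?e\<close> in the proof undoes the scaling of \<open>ou_coord\<close>.\<close>

lemma coord_grid_in_grid_events:
  assumes i: "i \<le> 2 ^ m" and B: "B \<in> sets borel"
  shows "coord (grid (U / 2 ^ m) i) -` B \<in> grid_events U"
proof -
  have "\<exists>C\<in>sets (Pi\<^sub>M UNIV (\<lambda>_. borel)). coord (grid (U / 2 ^ m) i) -` B = ou_history (U / 2 ^ k) (2 ^ k) -` C"
    if "k \<ge> m" for k
  proof -
    define j where "j = i * 2 ^ (k - m)"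
    \<comment> \<open>Polymorphic because it rewrites powers both in nat, for the index bound, and
      in real, for the grid point.\<close>
    have k: "(2::'a::semiring_1) ^ k = 2 ^ m * 2 ^ (k - m)" using that by (simp add: power_add[symmetric])
    have j: "j \<le> 2 ^ k" unfolding j_def k using i by (rule mult_right_mono) simp
    have "real j * (U / 2 ^ k) = real i * (U / 2 ^ m)" by (simp add: j_def k)
    then have g: "grid (U / 2 ^ k) j = grid (U / 2 ^ m) i" by (simp add: grid_def)
    let ?e = "exp (- (real j * (U / 2 ^ k) / 2))"
    have "coord (grid (U / 2 ^ m) i) x = ou_history (U / 2 ^ k) (2 ^ k) x j * ?e" for x
      using j by (simp add: ou_history_def ou_coord_def g mult.assoc exp_add[symmetric])
    then have "coord (grid (U / 2 ^ m) i) -` B = ou_history (U / 2 ^ k) (2 ^ k) -` ((\<lambda>\<eta>. \<eta> j * ?e) -` B)"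
      by auto
    moreover have "(\<lambda>\<eta>. \<eta> j * ?e) \<in> borel_measurable (Pi\<^sub>M UNIV (\<lambda>_. borel))" by measurable
    from measurable_sets[OF this B] have "(\<lambda>\<eta>. \<eta> j * ?e) -` B \<in> sets (Pi\<^sub>M UNIV (\<lambda>_. borel))"
      by (simp add: space_PiM)
    ultimately show ?thesis by blast
  qed
  then show ?thesis unfolding grid_events_def by blast
qed

lemma dyadic_floor_tendsto:
  fixes u U :: real
  assumes "U > 0" "0 \<le> u" "u \<le> U"
  shows "(\<lambda>m. real (nat \<lfloor>u / U * 2 ^ m\<rfloor>) * (U / 2 ^ m)) \<longlonglongrightarrow> u"
    and "nat \<lfloor>u / U * 2 ^ m\<rfloor> \<le> 2 ^ m"
proof -
  have q: "0 \<le> u / U" "u / U \<le> 1" using assms by auto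
  have n: "real (nat \<lfloor>u / U * 2 ^ m\<rfloor>) = \<lfloor>u / U * 2 ^ m\<rfloor>" for m
  proof -
    have "0 \<le> u / U * 2 ^ m" using q by (intro mult_nonneg_nonneg) auto
    then show ?thesis by (simp only: of_nat_nat zero_le_floor)
  qed
  have "u / U * 2 ^ m \<le> 2 ^ m" using q by (intro mult_left_le_one_le) auto
  then have "real (nat \<lfloor>u / U * 2 ^ m\<rfloor>) \<le> real (2 ^ m)"
    unfolding n by (intro order.trans[OF of_int_floor_le]) simp
  then show "nat \<lfloor>u / U * 2 ^ m\<rfloor> \<le> 2 ^ m" by linarith
  have bounds: "u - U / 2 ^ m \<le> real (nat \<lfloor>u / U * 2 ^ m\<rfloor>) * (U / 2 ^ m)"
    "real (nat \<lfloor>u / U * 2 ^ m\<rfloor>) * (U / 2 ^ m) \<le> u" for m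
  proof -
    let ?f = "real_of_int \<lfloor>u / U * 2 ^ m\<rfloor>"
    have p: "U / 2 ^ m > 0" using assms by simp
    have e: "u / U * 2 ^ m * (U / 2 ^ m) = u" using assms by simp
    have "(u / U * 2 ^ m - 1) * (U / 2 ^ m) \<le> ?f * (U / 2 ^ m)"
      using p by (intro mult_right_mono) linarith+
    moreover have "?f * (U / 2 ^ m) \<le> u / U * 2 ^ m * (U / 2 ^ m)"
      using p by (intro mult_right_mono of_int_floor_le) simp
    ultimately show "u - U / 2 ^ m \<le> real (nat \<lfloor>u / U * 2 ^ m\<rfloor>) * (U / 2 ^ m)"
      "real (nat \<lfloor>u / U * 2 ^ m\<rfloor>) * (U / 2 ^ m) \<le> u"
      unfolding n e left_diff_distrib by simp_all
  qed
  show "(\<lambda>m. real (nat \<lfloor>u / U * 2 ^ m\<rfloor>) * (U / 2 ^ m)) \<longlonglongrightarrow> u"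
  proof (rule tendsto_sandwich[OF always_eventually always_eventually _ tendsto_const])
    show "(\<lambda>m. u - U / 2 ^ m) \<longlonglongrightarrow> u" by real_asymp
  qed (use bounds in auto)
qed

text \<open>Dyadic grid points are dense in [0, T], and by path continuity each
  \<open>coord s\<close> is the pointwise limit of coordinates at such points.\<close>

lemma path_filtration_grid_events:
  assumes T: "0 < T" "T < 1"
  shows "sets (path_filtration T) \<subseteq> sigma_sets UNIV (grid_events (- ln (1 - T)))"
  unfolding sets_path_filtration
proof (rule sigma_sets_mono, safe)
  let ?U = "- ln (1 - T)"
  let ?G = "sigma UNIV (grid_events ?U)"
  have sets_G: "sets ?G = sigma_sets UNIV (grid_events ?U)" by (simp add: sets_measure_of)
  fix s and B :: "real set" assume s: "s \<in> {0..T}" and B: "B \<in> sets borel"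
  have U: "?U > 0" using T by simp
  define u where "u = - ln (1 - s)"
  have u: "0 \<le> u" "u \<le> ?U" and s_eq: "s = 1 - exp (- u)" using s T by (auto simp: u_def)
  define i where "i m = nat \<lfloor>u / ?U * 2 ^ m\<rfloor>" for m
  have "coord (grid (?U / 2 ^ m) (i m)) \<in> borel_measurable ?G" for m
  proof (rule measurableI)
    fix B :: "real set" assume "B \<in> sets borel"
    then have "coord (grid (?U / 2 ^ m) (i m)) -` B \<in> grid_events ?U"
      using dyadic_floor_tendsto(2)[OF U u, of m] unfolding i_def by (intro coord_grid_in_grid_events)
    then show "coord (grid (?U / 2 ^ m) (i m)) -` B \<inter> space ?G \<in> sets ?G"
      unfolding sets_G space_measure_of_conv Int_UNIV_right by (rule sigma_sets.Basic)
  qed simp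
  note meas = this
  have lim: "(\<lambda>m. coord (grid (?U / 2 ^ m) (i m)) x) \<longlonglongrightarrow> coord s x" for x
  proof (rule continuous_on_tendsto_compose[OF continuous_on_coord])
    show "(\<lambda>m. grid (?U / 2 ^ m) (i m)) \<longlonglongrightarrow> s"
      unfolding grid_def s_eq i_def by (intro tendsto_intros dyadic_floor_tendsto(1) U u)
    show "s \<in> {0..1}" using s T by auto
    show "\<forall>\<^sub>F m in sequentially. grid (?U / 2 ^ m) (i m) \<in> {0..1}"
    proof (rule always_eventually, rule allI)
      fix m
      have p: "0 < ?U / 2 ^ m" using U by (rule divide_pos_pos) simp
      have "0 \<le> real (i m) * (?U / 2 ^ m)" by (rule mult_nonneg_nonneg[OF of_nat_0_le_iff less_imp_le[OF p]])
      then have "exp (- (real (i m) * (?U / 2 ^ m))) \<le> 1" by (simp only: exp_le_one_iff neg_le_0_iff_le)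
      with exp_ge_zero[of "- (real (i m) * (?U / 2 ^ m))"] show "grid (?U / 2 ^ m) (i m) \<in> {0..1}"
        unfolding grid_def atLeastAtMost_iff by linarith
    qed
  qed
  have "coord s \<in> borel_measurable ?G"
    by (rule borel_measurable_LIMSEQ_real[OF lim meas])
  from measurable_sets[OF this B] show "coord s -` B \<in> sigma_sets UNIV (grid_events ?U)"
    by (simp add: sets_G)
qed

section \<open>The density on the path filtration\<close>

lemma loglik_limit_diff:
  fixes \<alpha>\<^sub>0 \<alpha>\<^sub>1 a b c I :: real
  shows "(- (\<alpha>\<^sub>1 - 1 / 2) / 2 * (c + a - b) - (\<alpha>\<^sub>1 - 1 / 2)\<^sup>2 / 2 * I)
      - (- (\<alpha>\<^sub>0 - 1 / 2) / 2 * (c + a - b) - (\<alpha>\<^sub>0 - 1 / 2)\<^sup>2 / 2 * I) =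
    (\<alpha>\<^sub>0 - \<alpha>\<^sub>1) * (a + (\<alpha>\<^sub>0 + \<alpha>\<^sub>1 - 1) * I + c) / 2 - (\<alpha>\<^sub>0 - \<alpha>\<^sub>1) * b / 2"
  by (simp add: field_simps power2_eq_square)

text \<open>The limit of the grid ratios gives the density formula on grid events, and the
  uniqueness of finite measures on an intersection-stable generator extends it to the
  filtration.\<close>

lemma likelihood_ratio_on_path_filtration:
  fixes \<alpha>\<^sub>0 \<alpha>\<^sub>1 T :: real
  assumes b0: "alpha_brownian_bridge \<alpha>\<^sub>0 M\<^sub>0 W\<^sub>0 Y\<^sub>0" and b1: "alpha_brownian_bridge \<alpha>\<^sub>1 M\<^sub>1 W\<^sub>1 Y\<^sub>1"
    and T: "0 < T" "T < 1"
  defines "Z \<equiv> \<lambda>x. exp ((\<alpha>\<^sub>0 - \<alpha>\<^sub>1) * (psi \<alpha>\<^sub>0 \<alpha>\<^sub>1 T x + ln (1 - T)) / 2)"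
  shows "Z \<in> borel_measurable (path_filtration T)"
    and "A \<in> sets (path_filtration T) \<Longrightarrow>
      emeasure (distr M\<^sub>1 borel Y\<^sub>1) A = (\<integral>\<^sup>+x. ennreal (Z x) * indicator A x \<partial>distr M\<^sub>0 borel Y\<^sub>0)"
proof -
  let ?P0 = "distr M\<^sub>0 borel Y\<^sub>0" and ?P1 = "distr M\<^sub>1 borel Y\<^sub>1"
  have Y: "Y\<^sub>0 \<in> borel_measurable M\<^sub>0" "Y\<^sub>1 \<in> borel_measurable M\<^sub>1"
    and M: "prob_space M\<^sub>0" "prob_space M\<^sub>1"
    using b0 b1 by (auto simp: alpha_brownian_bridge_def brownian_motion_def)
  have P: "prob_space ?P0" "prob_space ?P1"
    using M Y by (auto intro: prob_space.prob_space_distr)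
  interpret P0: prob_space ?P0 by fact
  interpret P1: prob_space ?P1 by fact
  define U where "U = - ln (1 - T)"
  have U: "U > 0" using T by (simp add: U_def)
  let ?h = "\<lambda>m. U / 2 ^ m"
  have h: "?h m > 0" for m using U by simp
  \<comment> \<open>The pathwise limit of the ratios contains the squared starting value. S collects
    this factor, which is 1 almost surely, so that convergence still holds at every path.\<close>
  define S where "S x = exp (- ((\<alpha>\<^sub>0 - \<alpha>\<^sub>1) * (coord 0 x)\<^sup>2 / 2))" for x
  define R where "R m \<eta> = exp (ou_loglik (\<alpha>\<^sub>1 - 1 / 2) (?h m) (2 ^ m) \<eta> - ou_loglik (\<alpha>\<^sub>0 - 1 / 2) (?h m) (2 ^ m) \<eta>)"
    for m \<eta>
  define Zs where "Zs m x = R m (ou_history (?h m) (2 ^ m) x)" for m x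
  have R [measurable]: "R m \<in> borel_measurable (Pi\<^sub>M UNIV (\<lambda>_. borel))" for m
    unfolding R_def[abs_def] by measurable
  have lim: "(\<lambda>m. Zs m x) \<longlonglongrightarrow> Z x * S x" for x
  proof -
    have "Zs m x = exp (ou_loglik (\<alpha>\<^sub>1 - 1 / 2) (?h m) (2 ^ m) (\<lambda>i. ou_coord (?h m) i x)
        - ou_loglik (\<alpha>\<^sub>0 - 1 / 2) (?h m) (2 ^ m) (\<lambda>i. ou_coord (?h m) i x))" for m
      unfolding Zs_def R_def
      by (intro arg_cong[where f = exp] arg_cong2[where f = "(-)"] ou_loglik_cong) (simp_all add: ou_history_def)
    moreover note tendsto_exp[OF tendsto_diff[OF ou_loglik_path_tendsto[OF T, of "\<alpha>\<^sub>1 - 1 / 2" x]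
          ou_loglik_path_tendsto[OF T, of "\<alpha>\<^sub>0 - 1 / 2" x]], folded U_def]
    ultimately show ?thesis
      by (simp only: loglik_limit_diff exp_diff) (simp add: Z_def S_def psi_def U_def exp_minus field_simps)
  qed
  have grid_T: "grid (?h m) i \<in> {0..T}" if "i \<le> 2 ^ m" for m i
  proof -
    have "real i \<le> 2 ^ m" using that by (metis of_nat_le_iff of_nat_numeral of_nat_power)
    then have "real i * ?h m \<le> 2 ^ m * ?h m" using h[of m] by (intro mult_right_mono) auto
    then have "exp (- U) \<le> exp (- (real i * ?h m))" by simp
    moreover have "0 \<le> real i * ?h m" using U by simp
    moreover have "exp (- U) = 1 - T" using T by (simp add: U_def)
    ultimately show ?thesis unfolding grid_def by simp
  qed
  have coord_meas: "coord s \<in> borel_measurable (path_filtration T)" if "s \<in> {0..T}" for s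
    using that by (rule measurable_path_filtration_coord)
  have hist: "ou_history (?h m) (2 ^ m) \<in> measurable (path_filtration T) (Pi\<^sub>M UNIV (\<lambda>_. borel))" for m
    unfolding ou_history_def
  proof (rule measurable_PiM_single')
    show "(\<lambda>x. if i \<le> 2 ^ m then ou_coord (?h m) i x else 0) \<in> borel_measurable (path_filtration T)" for i
    proof (cases "i \<le> 2 ^ m")
      case True
      note [measurable] = coord_meas[OF grid_T[OF True]]
      show ?thesis using True unfolding ou_coord_def by simp
    qed simp
  qed simp
  have Zs_meas: "Zs m \<in> borel_measurable (path_filtration T)" for m
    unfolding Zs_def[abs_def] by (rule measurable_compose[OF hist R])
  \<comment> \<open>Measurability of the integral in \<open>psi\<close> relative to the path
    filtration comes from the grid ratios, of which this product is the pointwise limit. Dividing by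
    the positive function S, measurable in \<open>coord 0\<close>, leaves Z.\<close>
  have ZS: "(\<lambda>x. Z x * S x) \<in> borel_measurable (path_filtration T)"
    by (rule borel_measurable_LIMSEQ_real[OF lim Zs_meas])
  have [measurable]: "coord 0 \<in> borel_measurable (path_filtration T)"
    using T by (intro coord_meas) auto
  have "S \<in> borel_measurable (path_filtration T)"
    unfolding S_def[abs_def] by measurable
  from borel_measurable_divide[OF ZS this]
  have "(\<lambda>x. Z x * S x / S x) \<in> borel_measurable (path_filtration T)" .
  then show Z: "Z \<in> borel_measurable (path_filtration T)"
    by (simp add: S_def)
  have sub: "f \<in> borel_measurable ?P0" if "f \<in> borel_measurable (path_filtration T)" for f :: "path \<Rightarrow> real"
    using measurable_from_subalg[OF subalgebra_path_filtration that] by simp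
  have on_grid: "emeasure ?P1 A = (\<integral>\<^sup>+x. ennreal (Z x * S x) * indicator A x \<partial>?P0)" if A: "A \<in> grid_events U" for A
  proof -
    obtain m0 where m0: "\<And>m. m \<ge> m0 \<Longrightarrow> \<exists>C\<in>sets (Pi\<^sub>M UNIV (\<lambda>_. borel)). A = ou_history (?h m) (2 ^ m) -` C"
      using A unfolding grid_events_def by blast
    have "A \<in> sets borel"
    proof -
      obtain C where C: "C \<in> sets (Pi\<^sub>M UNIV (\<lambda>_. borel))" "A = ou_history (?h m0) (2 ^ m0) -` C"
        using m0[of m0] by auto
      then show ?thesis using measurable_sets[OF measurable_ou_history C(1)] by simp
    qed
    show ?thesis
    proof (rule likelihood_ratio_limit[OF P, where Zs = Zs and ?m0.0 = m0])
      fix m and \<phi> :: "real \<Rightarrow> ennreal"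
      assume m: "m0 \<le> m" and [measurable]: "\<phi> \<in> borel_measurable borel"
      obtain C where [measurable]: "C \<in> sets (Pi\<^sub>M UNIV (\<lambda>_. borel))" and C: "A = ou_history (?h m) (2 ^ m) -` C"
        using m0[OF m] by auto
      have A_C: "indicator A x = (indicator C (ou_history (?h m) (2 ^ m) x) :: ennreal)" for x
        by (simp add: C indicator_def)
      have "(\<lambda>\<eta>. indicator C \<eta> * \<phi> (R m \<eta>)) \<in> borel_measurable (Pi\<^sub>M UNIV (\<lambda>_. borel))"
        by measurable
      from bridge_likelihood_ratio[OF b0 b1 h this, of m "2 ^ m"]
      show "(\<integral>\<^sup>+x. indicator A x * \<phi> (Zs m x) \<partial>?P1) =
          (\<integral>\<^sup>+x. indicator A x * \<phi> (Zs m x) * ennreal (Zs m x) \<partial>?P0)"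
        unfolding A_C Zs_def R_def .
    next
      show "sets ?P1 = sets ?P0" by simp
      show "Zs m \<in> borel_measurable ?P0" for m by (rule sub[OF Zs_meas])
      show "A \<in> sets ?P0" using \<open>A \<in> sets borel\<close> by simp
      show "0 \<le> Zs m x" for m x by (simp add: Zs_def R_def)
      show "(\<lambda>m. Zs m x) \<longlonglongrightarrow> Z x * S x" for x by (rule lim)
    qed
  qed
  have "AE x in ?P0. S x = 1"
    using bridge_coord_0[OF b0] by eventually_elim (simp add: S_def)
  then have S1: "(\<integral>\<^sup>+x. ennreal (Z x * S x) * indicator A x \<partial>?P0) = (\<integral>\<^sup>+x. ennreal (Z x) * indicator A x \<partial>?P0)" for A
    by (intro nn_integral_cong_AE) (auto elim: eventually_mono)
  let ?G = "sigma UNIV (grid_events U)" and ?Q = "density ?P0 (\<lambda>x. ennreal (Z x))"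
  have ZP: "(\<lambda>x. ennreal (Z x)) \<in> borel_measurable ?P0" using sub[OF Z] by measurable
  have grid_borel: "grid_events U \<subseteq> sets borel"
  proof
    fix A assume "A \<in> grid_events U"
    then obtain m C where "C \<in> sets (Pi\<^sub>M UNIV (\<lambda>_. borel))" "A = ou_history (?h m) (2 ^ m) -` C"
      unfolding grid_events_def by blast
    then show "A \<in> sets borel" using measurable_sets[OF measurable_ou_history] by fastforce
  qed
  have sub_G: "sigma_sets UNIV (grid_events U) \<subseteq> sets borel"
    using sets.sigma_sets_subset[OF grid_borel] by simp
  have "emeasure ?P1 A = emeasure ?Q A" if "A \<in> sigma_sets UNIV (grid_events U)" for A
  proof -
    have subalg: "subalgebra ?P1 ?G" "subalgebra ?Q ?G"
      using sub_G by (auto simp: subalgebra_def space_measure_of_conv sets_measure_of)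
    \<comment> \<open>The generator spans only part of the Borel sets, so both measures are first
      restricted to the sigma-algebra it generates.\<close>
    have "restr_to_subalg ?P1 ?G = restr_to_subalg ?Q ?G"
    proof (rule measure_eqI_generator_eq[where E = "grid_events U" and \<Omega> = UNIV and A = "\<lambda>_. UNIV"])
      fix A assume A: "A \<in> grid_events U"
      then have "A \<in> sets ?G" "A \<in> sets borel" using grid_borel by (auto simp: sets_measure_of)
      then show "emeasure (restr_to_subalg ?P1 ?G) A = emeasure (restr_to_subalg ?Q ?G) A"
        using on_grid[OF A] ZP by (simp add: emeasure_restr_to_subalg[OF subalg(1)]
            emeasure_restr_to_subalg[OF subalg(2)] emeasure_density S1)
    next
      have "UNIV = ou_history (?h m) (2 ^ m) -` space (Pi\<^sub>M UNIV (\<lambda>_. borel))" for m by (simp add: space_PiM)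
      then show "range (\<lambda>_::nat. UNIV) \<subseteq> grid_events U"
        unfolding grid_events_def by (blast intro: sets.top)
      show "emeasure (restr_to_subalg ?P1 ?G) UNIV \<noteq> \<infinity>"
        using P1.emeasure_space_1 sets.top[of ?G]
        by (simp add: emeasure_restr_to_subalg[OF subalg(1)] space_measure_of_conv)
    qed (auto simp: sets_restr_to_subalg[OF subalg(1)] sets_restr_to_subalg[OF subalg(2)] sets_measure_of Int_stable_grid_events)
    moreover have "A \<in> sets ?G" using that by (simp add: sets_measure_of)
    ultimately show ?thesis
      using emeasure_restr_to_subalg[OF subalg(1)] emeasure_restr_to_subalg[OF subalg(2)] by metis
  qed
  moreover assume A: "A \<in> sets (path_filtration T)"
  moreover have "A \<in> sigma_sets UNIV (grid_events U)"
    using A path_filtration_grid_events[OF T] unfolding U_def by blast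
  ultimately have "emeasure ?P1 A = emeasure ?Q A" by blast
  also have "\<dots> = (\<integral>\<^sup>+x. ennreal (Z x) * indicator A x \<partial>?P0)"
    using A subalgebra_path_filtration[of T] ZP by (intro emeasure_density) (auto simp: subalgebra_def)
  finally show "emeasure ?P1 A = (\<integral>\<^sup>+x. ennreal (Z x) * indicator A x \<partial>?P0)" .
qed

text \<open>For T = 0 the time horizon - ln (1 - T) vanishes and the grids degenerate. The initial
  sigma-algebra is generated by \<open>coord 0\<close>, which is almost surely 0 under both laws, so
  every event in it has the same probability 0 or 1, and Z is 1 almost surely.\<close>

lemma likelihood_ratio_on_path_filtration_0:
  fixes \<alpha>\<^sub>0 \<alpha>\<^sub>1 :: real
  assumes b0: "alpha_brownian_bridge \<alpha>\<^sub>0 M\<^sub>0 W\<^sub>0 Y\<^sub>0" and b1: "alpha_brownian_bridge \<alpha>\<^sub>1 M\<^sub>1 W\<^sub>1 Y\<^sub>1"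
  defines "Z \<equiv> \<lambda>x. exp ((\<alpha>\<^sub>0 - \<alpha>\<^sub>1) * (psi \<alpha>\<^sub>0 \<alpha>\<^sub>1 0 x + ln (1 - 0)) / 2)"
  shows "Z \<in> borel_measurable (path_filtration 0)"
    and "A \<in> sets (path_filtration 0) \<Longrightarrow>
      emeasure (distr M\<^sub>1 borel Y\<^sub>1) A = (\<integral>\<^sup>+x. ennreal (Z x) * indicator A x \<partial>distr M\<^sub>0 borel Y\<^sub>0)"
proof -
  have "(LBINT s:{0..0::real}. g s) = (0 :: real)" for g :: "real \<Rightarrow> real"
  proof -
    have "AE s in lborel. indicator {0..0::real} s *\<^sub>R g s = 0"
      using AE_lborel_singleton[of "0 :: real"] by eventually_elim (auto simp: indicator_def)
    then show ?thesis unfolding set_lebesgue_integral_def by (rule integral_eq_zero_AE)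
  qed
  then have Z_eq: "Z = (\<lambda>x. exp ((\<alpha>\<^sub>0 - \<alpha>\<^sub>1) * (coord 0 x)\<^sup>2 / 2))"
    by (simp add: Z_def psi_def)
  have [measurable]: "coord 0 \<in> borel_measurable (path_filtration 0)"
    by (rule measurable_path_filtration_coord) simp
  show "Z \<in> borel_measurable (path_filtration 0)" unfolding Z_eq by measurable
  assume "A \<in> sets (path_filtration 0)"
  moreover have "sets (path_filtration 0) \<subseteq> sets (vimage_algebra UNIV (coord 0) (borel :: real measure))"
  proof -
    have "{coord s -` A | s A. s \<in> {0..0} \<and> A \<in> sets (borel :: real measure)} \<subseteq>
        sets (vimage_algebra UNIV (coord 0) (borel :: real measure))"
      by (auto simp: sets_vimage_algebra2)
    from sets.sigma_sets_subset[OF this] show ?thesis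
      by (simp only: sets_path_filtration space_vimage_algebra)
  qed
  ultimately obtain B where B [measurable]: "B \<in> sets (borel :: real measure)" and A: "A = coord 0 -` B"
    by (auto simp: sets_vimage_algebra2)
  have "A \<in> sets borel"
    using measurable_sets[OF borel_measurable_coord B] by (simp add: A)
  have AE_A: "AE x in distr M borel Y. indicator A x = (indicator B 0 :: ennreal)"
    if "alpha_brownian_bridge \<alpha> M W Y" for \<alpha> and M :: "'c measure" and W Y
    using bridge_coord_0[OF that] by eventually_elim (simp add: A indicator_def)
  have emeasure_space: "(\<integral>\<^sup>+x. c \<partial>distr M borel Y) = c" if b: "alpha_brownian_bridge \<alpha> M W Y"
    for \<alpha> and M :: "'c measure" and W and Y :: "'c \<Rightarrow> path" and c
  proof -
    have "Y \<in> borel_measurable M" and "prob_space M"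
      using b by (auto simp: alpha_brownian_bridge_def brownian_motion_def)
    then interpret prob_space "distr M borel Y" by (intro prob_space.prob_space_distr)
    show ?thesis using emeasure_space_1 by simp
  qed
  have "emeasure (distr M\<^sub>1 borel Y\<^sub>1) A = (\<integral>\<^sup>+x. indicator A x \<partial>distr M\<^sub>1 borel Y\<^sub>1)"
    using \<open>A \<in> sets borel\<close> by simp
  also have "\<dots> = (\<integral>\<^sup>+x. indicator B 0 \<partial>distr M\<^sub>1 borel Y\<^sub>1)"
    by (rule nn_integral_cong_AE[OF AE_A[OF b1]])
  also have "\<dots> = indicator B 0" by (rule emeasure_space[OF b1])
  also have "\<dots> = (\<integral>\<^sup>+x. indicator B 0 \<partial>distr M\<^sub>0 borel Y\<^sub>0)" by (rule emeasure_space[OF b0, symmetric])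
  also have "\<dots> = (\<integral>\<^sup>+x. ennreal (Z x) * indicator A x \<partial>distr M\<^sub>0 borel Y\<^sub>0)"
  proof (rule nn_integral_cong_AE)
    show "AE x in distr M\<^sub>0 borel Y\<^sub>0. indicator B 0 = ennreal (Z x) * indicator A x"
      using AE_A[OF b0] bridge_coord_0[OF b0] by eventually_elim (simp add: Z_eq)
  qed
  finally show "emeasure (distr M\<^sub>1 borel Y\<^sub>1) A = (\<integral>\<^sup>+x. ennreal (Z x) * indicator A x \<partial>distr M\<^sub>0 borel Y\<^sub>0)" .
qed

text \<open>Z is measurable in F, so its integrals over F-events are the same for P and for the
  restriction of P. The restricted Q is therefore the restricted P with density Z, and the
  uniqueness of Radon-Nikodym derivatives concludes.\<close>

lemma restricted_RN_deriv:
  assumes "prob_space P" and sub: "subalgebra P F" "subalgebra Q F"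
    and Z [measurable]: "Z \<in> borel_measurable F"
    and Q: "\<And>A. A \<in> sets F \<Longrightarrow> emeasure Q A = (\<integral>\<^sup>+x. Z x * indicator A x \<partial>P)"
  shows "absolutely_continuous (restr_to_subalg P F) (restr_to_subalg Q F)"
    and "AE x in restr_to_subalg P F. RN_deriv (restr_to_subalg P F) (restr_to_subalg Q F) x = Z x"
proof -
  interpret P: prob_space P by fact
  let ?P = "restr_to_subalg P F" and ?Q = "restr_to_subalg Q F"
  interpret R: finite_measure ?P by (rule finite_measure_restr_to_subalg[OF sub(1) P.finite_measure_axioms])
  have Z': "Z \<in> borel_measurable ?P" by (rule measurable_in_subalg[OF sub(1) Z])
  have "density ?P Z = ?Q"
  proof (rule measure_eqI)
    show "sets (density ?P Z) = sets ?Q"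
      by (simp add: sets_restr_to_subalg[OF sub(1)] sets_restr_to_subalg[OF sub(2)])
    fix A assume "A \<in> sets (density ?P Z)"
    then have A [measurable]: "A \<in> sets F" by (simp add: sets_restr_to_subalg[OF sub(1)])
    then have "emeasure (density ?P Z) A = (\<integral>\<^sup>+x. Z x * indicator A x \<partial>?P)"
      using Z' by (intro emeasure_density) (auto simp: sets_restr_to_subalg[OF sub(1)])
    also have "\<dots> = (\<integral>\<^sup>+x. Z x * indicator A x \<partial>P)"
      using A by (intro nn_integral_subalgebra2[OF sub(1)]) measurable
    also have "\<dots> = emeasure ?Q A"
      using A by (simp add: Q emeasure_restr_to_subalg[OF sub(2)])
    finally show "emeasure (density ?P Z) A = emeasure ?Q A" .
  qed
  note density_eq = this
  show "absolutely_continuous ?P ?Q"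
    using absolutely_continuousI_density[OF Z'] unfolding density_eq .
  show "AE x in ?P. RN_deriv ?P ?Q x = Z x"
    using R.RN_deriv_unique[OF Z' density_eq] by eventually_elim (rule sym)
qed

theorem proposition1p1:
  fixes \<alpha>\<^sub>0 \<alpha>\<^sub>1 T :: real
    and M\<^sub>0 :: "'a measure" and W\<^sub>0 :: "real \<Rightarrow> 'a \<Rightarrow> real" and Y\<^sub>0 :: "'a \<Rightarrow> path"
    and M\<^sub>1 :: "'b measure" and W\<^sub>1 :: "real \<Rightarrow> 'b \<Rightarrow> real" and Y\<^sub>1 :: "'b \<Rightarrow> path"
    and P\<^sub>0 P\<^sub>1 :: "path measure"
  assumes "0 \<le> \<alpha>\<^sub>0" and "0 \<le> \<alpha>\<^sub>1" and "\<alpha>\<^sub>0 \<noteq> \<alpha>\<^sub>1" and "\<alpha>\<^sub>0 + \<alpha>\<^sub>1 \<ge> 1"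
    and "0 \<le> T" and "T < 1"
    and "alpha_brownian_bridge \<alpha>\<^sub>0 M\<^sub>0 W\<^sub>0 Y\<^sub>0" and "P\<^sub>0 = distr M\<^sub>0 borel Y\<^sub>0"
    and "alpha_brownian_bridge \<alpha>\<^sub>1 M\<^sub>1 W\<^sub>1 Y\<^sub>1" and "P\<^sub>1 = distr M\<^sub>1 borel Y\<^sub>1"
  shows "absolutely_continuous (restr_to_subalg P\<^sub>0 (path_filtration T))
           (restr_to_subalg P\<^sub>1 (path_filtration T)) \<and>
         (AE x in restr_to_subalg P\<^sub>0 (path_filtration T).
           RN_deriv (restr_to_subalg P\<^sub>0 (path_filtration T))
             (restr_to_subalg P\<^sub>1 (path_filtration T)) x =
           ennreal (exp ((\<alpha>\<^sub>0 - \<alpha>\<^sub>1) * (psi \<alpha>\<^sub>0 \<alpha>\<^sub>1 T x + ln (1 - T)) / 2)))"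
proof -
  let ?Z = "\<lambda>x. exp ((\<alpha>\<^sub>0 - \<alpha>\<^sub>1) * (psi \<alpha>\<^sub>0 \<alpha>\<^sub>1 T x + ln (1 - T)) / 2)"
  have "prob_space M\<^sub>0" "Y\<^sub>0 \<in> borel_measurable M\<^sub>0"
    using assms(7) by (auto simp: alpha_brownian_bridge_def brownian_motion_def)
  then have P0: "prob_space P\<^sub>0" unfolding assms(8) by (rule prob_space.prob_space_distr)
  have sub: "subalgebra P\<^sub>0 (path_filtration T)" "subalgebra P\<^sub>1 (path_filtration T)"
    using subalgebra_path_filtration[of T] by (auto simp: assms(8,10) subalgebra_def)
  have Z: "?Z \<in> borel_measurable (path_filtration T) \<and> (\<forall>A\<in>sets (path_filtration T).
      emeasure P\<^sub>1 A = (\<integral>\<^sup>+x. ennreal (?Z x) * indicator A x \<partial>P\<^sub>0))"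
  proof (cases "T = 0")
    case True
    then show ?thesis
      using likelihood_ratio_on_path_filtration_0[OF assms(7,9)] unfolding assms(8,10) by blast
  next
    case False
    then have "0 < T" using assms(5) by simp
    then show ?thesis
      using likelihood_ratio_on_path_filtration[OF assms(7,9) _ assms(6)] unfolding assms(8,10) by blast
  qed
  then have meas: "?Z \<in> borel_measurable (path_filtration T)"
    and eq: "\<And>A. A \<in> sets (path_filtration T) \<Longrightarrow>
      emeasure P\<^sub>1 A = (\<integral>\<^sup>+x. ennreal (?Z x) * indicator A x \<partial>P\<^sub>0)"
    by blast+
  note meas' = measurable_compose[OF meas measurable_ennreal]
  show ?thesis
    by (rule conjI[OF restricted_RN_deriv[OF P0 sub meas' eq]])
qed

end
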